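(* Let $A = \varinjlim (A_n, \psi_n)$ and let $\alpha \in \mathrm{Aut}(A)$ be Blackadar's automorphism of order two of the $2^\infty$ UHF algebra, as constructed in the context. Then $\alpha$ generates an action of $\mathbf{Z}_2 = \mathbf{Z}/2\mathbf{Z}$ with the tracial Rokhlin property.
   Context: Construction of $A$ and $\alpha$ (due to Blackadar). Identify $S^1$ with $\mathbf{R}/\mathbf{Z}$ and elements of $C(S^1, M_m)$ with continuous functions $f$ on $[0,1]$ with $f(0) = f(1)$. In any block matrix decomposition all blocks have the same size. Choose a continuous unitary path $c \in C([0,1], M_2)$ with $c(0) = 1$ and $c(1) = \begin{pmatrix} 0 & 1 \\ 1 & 0 \end{pmatrix}$. Define $\varphi^+ \colon C(S^1) \to C(S^1, M_2)$ by $$\varphi^+(f)(t) = c(t) \begin{pmatrix} f(\tfrac12 t) & 0 \\ 0 & f(\tfrac12(t+1)) \end{pmatrix} c(t)^*,$$ and $\varphi^-$ by $\varphi^-(f)(t) = \varphi^+(f)(1-t)$. Extend these, with the same notation, to embeddings $C(S^1, M_m) \to C(S^1, M_{2m})$ by using $\varphi^{\pm} \otimes \mathrm{id}_{M_m}$ (so for $f \in C(S^1, M_m)$ the displayed formula holds with $2\times 2$ block matrices with $m \times m$ blocks, $c(t)$ acting as a block matrix with scalar blocks). For $n \ge 1$ set $A_n = C(S^1, M_{4^n})$, and let $u_n = \mathrm{diag}(1, -1) \in M_{4^n} \subset A_n$ ($2 \times 2$ block form, constant function). Define $\psi_n \colon A_n \to A_{n+1}$ by $$\psi_n \begin{pmatrix}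 f_{1,1} & f_{1,2} \\ f_{2,1} & f_{2,2} \end{pmatrix} = \begin{pmatrix} \varphi^+(f_{1,1}) & 0 & \varphi^+(f_{1,2}) & 0 \\ 0 & \varphi^-(f_{2,2}) & 0 & \varphi^-(f_{2,1}) \\ \varphi^+(f_{2,1}) & 0 & \varphi^+(f_{2,2}) & 0 \\ 0 & \varphi^-(f_{1,2}) & 0 & \varphi^-(f_{1,1}) \end{pmatrix}.$$ Let $A = \varinjlim A_n$ using the maps $\psi_n$. It is known (Blackadar) that $A$ is the $2^\infty$ UHF algebra and that the automorphisms $\alpha_n = \mathrm{Ad}(u_n)$ of $A_n$ define an automorphism $\alpha$ of $A$ of order two. Tracial Rokhlin property: let $A$ be a stably finite simple unital C*-algebra and let $\alpha \in \mathrm{Aut}(A)$ satisfy $\alpha^n = \mathrm{id}_A$. The action of $\mathbf{Z}_n$ generated by $\alpha$ has the tracial Rokhlin property if for every finite set $F \subset A$, every $\varepsilon > 0$, every $N \in \mathbf{N}$, and every nonzero positive element $x \in A$, there are mutually orthogonal projections $e_0, \dots, e_{n-1} \in A$ such that: (1) $\| \alpha(e_j) - e_{j+1} \| < \varepsilon$ for $0 \le j \le n-2$; (2) $\| e_j a - a e_j \| < \varepsilon$ for $0 \le j \le n-1$ and all $a \in F$; (3) with $e = \sum_{j=0}^{n-1} e_j$, the projection $1-e$ is Murray-von Neumann equivalent to a projection in the hereditary subalgebra of $A$ generated by $x$; (4) for every $0 \le j \le n-1$ there are $N$ mutually orthogonal projections $f_1, \dots, f_N \le e_j$, each Murray-von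 Neumann equivalent to $1-e$. (The case $e=1$ is allowed, and then (3) and (4) are vacuous.) *)

theory Defs
  imports "HOL-Analysis.Analysis" "Jordan_Normal_Form.Schur_Decomposition"
begin

section \<open>Unital C*-algebras\<close>

text \<open>The class \<open>real_normed_algebra_1\<close> makes the algebra nonzero (with \<open>norm 1 = 1\<close>).\<close>

class unital_cstar_algebra = real_normed_algebra_1 + banach +
  fixes scaleC :: "complex \<Rightarrow> 'a \<Rightarrow> 'a" (infixr "*\<^sub>C" 75)
    and star :: "'a \<Rightarrow> 'a"
  assumes scaleC_add_right: "z *\<^sub>C (a + b) = z *\<^sub>C a + z *\<^sub>C b"
    and scaleC_add_left: "(z + w) *\<^sub>C a = z *\<^sub>C a + w *\<^sub>C a"
    and scaleC_scaleC: "z *\<^sub>C (w *\<^sub>C a) = (z * w) *\<^sub>C a"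
    and scaleC_of_real: "complex_of_real r *\<^sub>C a = r *\<^sub>R a"
    and mult_scaleC_left: "(z *\<^sub>C a) * b = z *\<^sub>C (a * b)"
    and mult_scaleC_right: "a * (z *\<^sub>C b) = z *\<^sub>C (a * b)"
    and norm_scaleC: "norm (z *\<^sub>C a) = cmod z * norm a"
    and star_star: "star (star a) = a"
    and star_add: "star (a + b) = star a + star b"
    and star_scaleC: "star (z *\<^sub>C a) = cnj z *\<^sub>C star a"
    and star_mult: "star (a * b) = star b * star a"
    and cstar_identity: "norm (star a * a) = (norm a)\<^sup>2"

definition projection :: "'a::unital_cstar_algebra \<Rightarrow> bool" where
  "projection p \<longleftrightarrow> p * p = p \<and> star p = p"

definition mvn_equiv :: "'a::unital_cstar_algebra \<Rightarrow> 'a \<Rightarrow> bool" where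
  "mvn_equiv p q \<longleftrightarrow> (\<exists>v. star v * v = p \<and> v * star v = q)"

definition cpositive :: "'a::unital_cstar_algebra \<Rightarrow> bool" where
  "cpositive a \<longleftrightarrow> (\<exists>b. a = star b * b)"

definition cle :: "'a::unital_cstar_algebra \<Rightarrow> 'a \<Rightarrow> bool" where
  "cle a b \<longleftrightarrow> cpositive (b - a)"

definition orthogonal_family :: "nat \<Rightarrow> (nat \<Rightarrow> 'a::unital_cstar_algebra) \<Rightarrow> bool" where
  "orthogonal_family n p \<longleftrightarrow> (\<forall>i<n. \<forall>j<n. i \<noteq> j \<longrightarrow> p i * p j = 0)"

definition hereditary_subalgebra :: "'a::unital_cstar_algebra set \<Rightarrow> bool" where
  "hereditary_subalgebra B \<longleftrightarrow>
     closed B \<and> 0 \<in> B \<and>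
     (\<forall>a\<in>B. \<forall>b\<in>B. a + b \<in> B \<and> a * b \<in> B) \<and>
     (\<forall>a\<in>B. star a \<in> B \<and> (\<forall>z. z *\<^sub>C a \<in> B)) \<and>
     (\<forall>a. \<forall>b\<in>B. cpositive a \<and> cle a b \<longrightarrow> a \<in> B)"

definition hereditary_generated :: "'a::unital_cstar_algebra \<Rightarrow> 'a set" where
  "hereditary_generated x = \<Inter>{B. hereditary_subalgebra B \<and> x \<in> B}"

definition closed_ideal :: "'a::unital_cstar_algebra set \<Rightarrow> bool" where
  "closed_ideal I \<longleftrightarrow>
     closed I \<and> 0 \<in> I \<and> (\<forall>x\<in>I. \<forall>y\<in>I. x + y \<in> I) \<and> (\<forall>a. \<forall>x\<in>I. a * x \<in> I \<and> x * a \<in> I)"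

definition simple_algebra :: "'a::unital_cstar_algebra itself \<Rightarrow> bool" where
  "simple_algebra _ \<longleftrightarrow> (\<forall>I::'a set. closed_ideal I \<longrightarrow> I = {0} \<or> I = UNIV)"

text \<open>Matrices over the algebra are compared only through their entries, so no norm on them is
  needed: the algebra is stably finite if every isometry in every matrix algebra over it is
  unitary.\<close>

definition mat_star :: "'a::unital_cstar_algebra mat \<Rightarrow> 'a mat" where
  "mat_star V = mat (dim_col V) (dim_row V) (\<lambda>(i, j). star (V $$ (j, i)))"

definition stably_finite :: "'a::unital_cstar_algebra itself \<Rightarrow> bool" where
  "stably_finite _ \<longleftrightarrow>
     (\<forall>k. \<forall>V::'a mat. V \<in> carrier_mat k k \<and> mat_star V * V = 1\<^sub>m k \<longrightarrow> V * mat_star V = 1\<^sub>m k)"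

definition star_automorphism :: "('a::unital_cstar_algebra \<Rightarrow> 'a) \<Rightarrow> bool" where
  "star_automorphism \<alpha> \<longleftrightarrow>
     bij \<alpha> \<and>
     (\<forall>a b. \<alpha> (a + b) = \<alpha> a + \<alpha> b) \<and>
     (\<forall>z a. \<alpha> (z *\<^sub>C a) = z *\<^sub>C \<alpha> a) \<and>
     (\<forall>a b. \<alpha> (a * b) = \<alpha> a * \<alpha> b) \<and>
     (\<forall>a. \<alpha> (star a) = star (\<alpha> a))"

section \<open>The tracial Rokhlin property\<close>

text \<open>The standing requirements on the algebra and on \<open>\<alpha>\<close> are part of the property.\<close>

definition tracial_rokhlin :: "nat \<Rightarrow> ('a::unital_cstar_algebra \<Rightarrow> 'a) \<Rightarrow> bool" where
  "tracial_rokhlin n \<alpha> \<longleftrightarrow>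
     0 < n \<and> simple_algebra TYPE('a) \<and> stably_finite TYPE('a) \<and>
     star_automorphism \<alpha> \<and> (\<alpha> ^^ n) = id \<and>
     (\<forall>F \<epsilon> N x. finite F \<and> (0::real) < \<epsilon> \<and> cpositive x \<and> x \<noteq> 0 \<longrightarrow>
       (\<exists>e. (\<forall>j<n. projection (e j)) \<and> orthogonal_family n e \<and>
          (\<forall>j. j + 1 < n \<longrightarrow> norm (\<alpha> (e j) - e (j + 1)) < \<epsilon>) \<and>
          (\<forall>j<n. \<forall>a\<in>F. norm (e j * a - a * e j) < \<epsilon>) \<and>
          (\<exists>q\<in>hereditary_generated x. projection q \<and> mvn_equiv (1 - (\<Sum>j<n. e j)) q) \<and>
          (\<forall>j<n. \<exists>f. (\<forall>i<N. projection (f i) \<and> cle (f i) (e j) \<and>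
                               mvn_equiv (f i) (1 - (\<Sum>j<n. e j))) \<and>
                      orthogonal_family (N::nat) f)))"

section \<open>Inductive limits\<close>

record 'b star_algebra = "(complex, 'b) module" +
  adj :: "'b \<Rightarrow> 'b"
  norm_of :: "'b \<Rightarrow> real"

definition unital_star_hom ::
    "'b star_algebra \<Rightarrow> ('b \<Rightarrow> 'a::unital_cstar_algebra) \<Rightarrow> bool" where
  "unital_star_hom R h \<longleftrightarrow>
     h \<one>\<^bsub>R\<^esub> = 1 \<and>
     (\<forall>f\<in>carrier R. \<forall>g\<in>carrier R. h (f \<oplus>\<^bsub>R\<^esub> g) = h f + h g \<and> h (f \<otimes>\<^bsub>R\<^esub> g) = h f * h g) \<and>
     (\<forall>f\<in>carrier R. h (adj R f) = star (h f) \<and> (\<forall>z. h (z \<odot>\<^bsub>R\<^esub> f) = z *\<^sub>C h f))"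

primrec transition :: "(nat \<Rightarrow> 'b \<Rightarrow> 'b) \<Rightarrow> nat \<Rightarrow> nat \<Rightarrow> 'b \<Rightarrow> 'b" where
  "transition \<psi> n 0 f = f"
| "transition \<psi> n (Suc k) f = \<psi> (n + k) (transition \<psi> n k f)"

text \<open>The maps \<open>\<iota> n\<close> exhibit the type \<open>'a\<close> as the inductive limit of the unital system
  \<open>R 1 \<rightarrow> R 2 \<rightarrow> \<dots>\<close> with connecting maps \<open>\<psi> n\<close>: it is the completion of the
  algebraic direct limit in the norm which sends the class of \<open>f \<in> R n\<close> to
  \<open>lim\<^sub>k \<parallel>\<psi> (n+k-1) (\<dots> (\<psi> n f))\<parallel>\<close>. This determines \<open>'a\<close> up to a
  *-isomorphism compatible with the \<open>\<iota> n\<close>.\<close>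

definition inductive_limit ::
    "(nat \<Rightarrow> 'b star_algebra) \<Rightarrow> (nat \<Rightarrow> 'b \<Rightarrow> 'b) \<Rightarrow> (nat \<Rightarrow> 'b \<Rightarrow> 'a::unital_cstar_algebra) \<Rightarrow> bool"
  where
  "inductive_limit R \<psi> \<iota> \<longleftrightarrow>
     (\<forall>n\<ge>1. unital_star_hom (R n) (\<iota> n)) \<and>
     (\<forall>n\<ge>1. \<forall>f\<in>carrier (R n). \<iota> (Suc n) (\<psi> n f) = \<iota> n f) \<and>
     (\<forall>n\<ge>1. \<forall>f\<in>carrier (R n).
        (\<lambda>k. norm_of (R (n + k)) (transition \<psi> n k f)) \<longlonglongrightarrow> norm (\<iota> n f)) \<and>
     closure (\<Union>n\<in>{1..}. \<iota> n ` carrier (R n)) = UNIV"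

section \<open>Matrix-valued functions on the circle\<close>

definition mat_norm :: "complex mat \<Rightarrow> real" where
  "mat_norm M = (SUP v\<in>{v \<in> carrier_vec (dim_col M). Re (v \<bullet>c v) \<le> 1}.
                   sqrt (Re ((M *\<^sub>v v) \<bullet>c (M *\<^sub>v v))))"

text \<open>\<open>C(S\<^sup>1, M\<^sub>m)\<close> as functions on \<open>[0,1]\<close> with equal values at the end points, extended by
  \<open>undefined\<close> outside \<open>[0,1]\<close>. Matrices carry no topology in the library, so continuity is
  continuity of the entries.\<close>

definition circle_algebra :: "nat \<Rightarrow> (real \<Rightarrow> complex mat) star_algebra" where
  "circle_algebra m =
     \<lparr> carrier = {f \<in> {0..1} \<rightarrow>\<^sub>E carrier_mat m m.
                   (\<forall>i<m. \<forall>j<m. continuous_on {0..1} (\<lambda>t. f t $$ (i, j))) \<and> f 0 = f 1},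
       mult = (\<lambda>f g. \<lambda>t\<in>{0..1}. f t * g t),
       one = (\<lambda>t\<in>{0..1}. 1\<^sub>m m),
       zero = (\<lambda>t\<in>{0..1}. 0\<^sub>m m m),
       add = (\<lambda>f g. \<lambda>t\<in>{0..1}. f t + g t),
       smult = (\<lambda>z f. \<lambda>t\<in>{0..1}. z \<cdot>\<^sub>m f t),
       adj = (\<lambda>f. \<lambda>t\<in>{0..1}. mat_adjoint (f t)),
       norm_of = (\<lambda>f. SUP t\<in>{0..1}. mat_norm (f t)) \<rparr>"

section \<open>Blackadar's system\<close>

definition swap_path :: "(real \<Rightarrow> complex mat) \<Rightarrow> bool" where
  "swap_path c \<longleftrightarrow>
     (\<forall>t\<in>{0..1}. c t \<in> carrier_mat 2 2 \<and>
        mat_adjoint (c t) * c t = 1\<^sub>m 2 \<and> c t * mat_adjoint (c t) = 1\<^sub>m 2) \<and>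
     (\<forall>i<2. \<forall>j<2. continuous_on {0..1} (\<lambda>t. c t $$ (i, j))) \<and>
     c 0 = 1\<^sub>m 2 \<and> c 1 = mat_of_rows_list 2 [[0, 1], [1, 0]]"

definition block_diag :: "complex mat \<Rightarrow> complex mat \<Rightarrow> complex mat" where
  "block_diag X Y =
     four_block_mat X (0\<^sub>m (dim_row X) (dim_col Y)) (0\<^sub>m (dim_row Y) (dim_col X)) Y"

text \<open>The \<open>2 \<times> 2\<close> block matrix with the scalar blocks \<open>u\<^sub>i\<^sub>j 1\<^sub>k\<close>.\<close>

definition scalar_blocks :: "nat \<Rightarrow> complex mat \<Rightarrow> complex mat" where
  "scalar_blocks k u =
     four_block_mat (u $$ (0, 0) \<cdot>\<^sub>m 1\<^sub>m k) (u $$ (0, 1) \<cdot>\<^sub>m 1\<^sub>m k)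
                    (u $$ (1, 0) \<cdot>\<^sub>m 1\<^sub>m k) (u $$ (1, 1) \<cdot>\<^sub>m 1\<^sub>m k)"

text \<open>\<open>\<phi>\<^sup>+\<close> and \<open>\<phi>\<^sup>-\<close> on \<open>C(S\<^sup>1, M\<^sub>k)\<close>, pointwise for \<open>t \<in> [0,1]\<close>.\<close>

definition phi_plus ::
    "(real \<Rightarrow> complex mat) \<Rightarrow> nat \<Rightarrow> (real \<Rightarrow> complex mat) \<Rightarrow> real \<Rightarrow> complex mat" where
  "phi_plus c k f t =
     scalar_blocks k (c t) * block_diag (f (t / 2)) (f ((t + 1) / 2))
       * mat_adjoint (scalar_blocks k (c t))"

definition phi_minus ::
    "(real \<Rightarrow> complex mat) \<Rightarrow> nat \<Rightarrow> (real \<Rightarrow> complex mat) \<Rightarrow> real \<Rightarrow> complex mat" where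
  "phi_minus c k f t = phi_plus c k f (1 - t)"

text \<open>The \<open>k \<times> k\<close> block of \<open>M\<close> in block row \<open>i\<close> and block column \<open>j\<close>, counted from \<open>0\<close>.\<close>

definition block :: "nat \<Rightarrow> complex mat \<Rightarrow> nat \<Rightarrow> nat \<Rightarrow> complex mat" where
  "block k M i j = mat k k (\<lambda>(r, s). M $$ (i * k + r, j * k + s))"

definition blackadar_algebra :: "nat \<Rightarrow> (real \<Rightarrow> complex mat) star_algebra" where
  "blackadar_algebra n = circle_algebra (4 ^ n)"

text \<open>The map \<open>\<psi>\<^sub>n\<close>: the \<open>4 \<times> 4\<close> block matrix is written as a \<open>2 \<times> 2\<close> block
  matrix of block diagonal matrices.\<close>

definition blackadar_map ::
    "(real \<Rightarrow> complex mat) \<Rightarrow> nat \<Rightarrow> (real \<Rightarrow> complex mat) \<Rightarrow> (real \<Rightarrow> complex mat)" where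
  "blackadar_map c n f = (\<lambda>t\<in>{0..1}.
     let k = 4 ^ n div 2;
         P = (\<lambda>i j. phi_plus c k (\<lambda>s. block k (f s) i j) t);
         Q = (\<lambda>i j. phi_minus c k (\<lambda>s. block k (f s) i j) t)
     in four_block_mat
          (block_diag (P 0 0) (Q 1 1)) (block_diag (P 0 1) (Q 1 0))
          (block_diag (P 1 0) (Q 0 1)) (block_diag (P 1 1) (Q 0 0)))"

definition blackadar_unitary :: "nat \<Rightarrow> real \<Rightarrow> complex mat" where
  "blackadar_unitary n =
     (\<lambda>t\<in>{0..1}. block_diag (1\<^sub>m (4 ^ n div 2)) (- 1\<^sub>m (4 ^ n div 2)))"

definition Ad :: "'b star_algebra \<Rightarrow> 'b \<Rightarrow> 'b \<Rightarrow> 'b" where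
  "Ad R u f = u \<otimes>\<^bsub>R\<^esub> f \<otimes>\<^bsub>R\<^esub> adj R u"

text \<open>\<open>\<alpha>\<close> is the automorphism of the limit induced by the automorphisms \<open>Ad(u\<^sub>n)\<close>.\<close>

definition blackadar_automorphism ::
    "(nat \<Rightarrow> (real \<Rightarrow> complex mat) \<Rightarrow> 'a::unital_cstar_algebra) \<Rightarrow> ('a \<Rightarrow> 'a) \<Rightarrow> bool" where
  "blackadar_automorphism \<iota> \<alpha> \<longleftrightarrow>
     star_automorphism \<alpha> \<and>
     (\<forall>n\<ge>1. \<forall>f\<in>carrier (blackadar_algebra n).
        \<alpha> (\<iota> n f) = \<iota> n (Ad (blackadar_algebra n) (blackadar_unitary n) f))"

end

theory Submission
  imports Defs "HOL-Computational_Algebra.Formal_Power_Series"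
begin

text \<open>
  Why the statement is true. The map \<open>\<psi>\<^sub>n\<close> evaluates a function at the two points \<open>(t + i) / 2\<close> in copies
  which respect the grading of the matrices by \<open>u\<^sub>n\<close>, and at the two points \<open>(1 - t + i) / 2\<close> in copies
  which reverse it. Hence, after \<open>k\<close> steps, the algebra \<open>A\<^sub>n\<close> acts at \<open>t\<close> through evaluations at the
  points \<open>(\<plusminus>t + j) / 2\<^sup>k\<close>, the sign being the parity of the copy (\<open>iterate_eq_frame\<close>, \<open>frame_sign\<close>). Each
  even copy has an odd partner whose point is at distance at most \<open>2 / 2\<^sup>k\<close>. If the basis vectors of two partners
  are replaced by their normalized sum and difference, then \<open>Ad(u)\<close> exchanges the two new vectors, and
  the projections onto all the sums and onto all the differences are exchanged by \<open>\<alpha>\<close> and almost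
  commute with \<open>A\<^sub>n\<close>.

  The obstacle is monodromy: when \<open>t\<close> runs once around the circle, the even copy \<open>j\<close> becomes the
  even copy \<open>j + 1\<close> and the odd copy \<open>j\<close> becomes the odd copy \<open>j - 1\<close>
  (\<open>frame_monodromy\<close>), so that the vectors above do not close up. For each word of
  \<open>k\<close> signs one copy is therefore given up, the hole. The others can then be rotated one after the other into
  the place of their neighbour, which makes room for the next one and moves their points by no more
  than \<open>1 / 2\<^sup>k\<close> (\<open>rot\<close>, \<open>closed_frame_closed\<close>). In the resulting closed frame the constant matrices form a
  matrix algebra in \<open>A\<close> (\<open>rep\<close>), and away from the hole the elements of \<open>A\<^sub>n\<close> are close to
  constant block diagonal matrices (\<open>emb_close_to_sample\<close>). The hole projection, which is
  \<open>1 - e\<close>, has the trace \<open>1 / 2\<^sup>k\<close>. All the other elements needed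
  are constant matrices over the frame: moving the hole to other positions gives the \<open>N\<close> copies of
  \<open>1 - e\<close> below \<open>e\<^sub>j\<close>.

  For the comparison of \<open>1 - e\<close> with a positive element \<open>b\<^sup>* b \<noteq> 0\<close>, approximate \<open>b\<close> by \<open>g\<close> in some
  \<open>A\<^sub>n\<close>. There are a point \<open>t\<^sub>0\<close> and a unit vector \<open>v\<close> on which \<open>g g\<^sup>*\<close> is large. Sending
  the hole vectors to \<open>v\<close> in blocks whose points are near \<open>t\<^sub>0\<close> gives \<open>y\<close> such that \<open>y\<^sup>* b b\<^sup>* y\<close> is
  close to a multiple of \<open>1 - e\<close>, and a power series in the error term makes this exact
  (\<open>hole_projection_comparison\<close>, \<open>self_adjoint_normalize\<close>). The same lemma shows that a nonzero ideal contains
  \<open>1 - e\<close>, hence all its copies, hence \<open>1\<close>: the algebra is simple. It is stably finite because an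
  isometry over \<open>A\<close> is approximated by matrix functions which are pointwise almost isometric, and
  square complex matrices of this kind are almost unitary.
\<close>

section \<open>Star and scalars\<close>

lemma star_zero [simp]: "star (0::'a::unital_cstar_algebra) = 0"
proof -
  have "star (0::'a) + star 0 = star 0" by (metis star_add add_0)
  then show ?thesis by simp
qed

lemma star_minus [simp]: "star (- a) = - star (a::'a::unital_cstar_algebra)"
proof -
  have "star (- a) + star a = 0" by (metis star_add star_zero add.left_inverse)
  then show ?thesis by (simp add: eq_neg_iff_add_eq_0)
qed

lemma star_diff: "star (a - b) = star a - star (b::'a::unital_cstar_algebra)"
  using star_add[of a "- b"] by simp

lemma star_one [simp]: "star (1::'a::unital_cstar_algebra) = 1"
  by (metis mult_1 mult_1_right star_mult star_star)

lemma star_scaleR: "star (r *\<^sub>R a) = r *\<^sub>R star (a::'a::unital_cstar_algebra)"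
  using star_scaleC[of "complex_of_real r" a] by (simp add: scaleC_of_real)

lemma star_power: "star (a ^ n) = star (a::'a::unital_cstar_algebra) ^ n"
  by (induction n) (auto simp: star_mult power_commutes)

lemma norm_star [simp]: "norm (star a) = norm (a::'a::unital_cstar_algebra)"
proof -
  have *: "norm b \<le> norm (star b)" for b :: 'a
  proof (cases "b = 0")
    case False
    have "norm b * norm b \<le> norm (star b) * norm b"
      using cstar_identity[of b] norm_mult_ineq[of "star b" b] by (simp add: power2_eq_square)
    then show ?thesis using False by simp
  qed simp
  show ?thesis using *[of a] *[of "star a"] by (simp add: star_star)
qed

lemma scaleC_one [simp]: "1 *\<^sub>C (a::'a::unital_cstar_algebra) = a"
  using scaleC_of_real[of 1 a] by simp

lemma scaleC_zero_left [simp]: "0 *\<^sub>C (a::'a::unital_cstar_algebra) = 0"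
  using scaleC_of_real[of 0 a] by simp

lemma scaleC_zero_right [simp]: "z *\<^sub>C (0::'a::unital_cstar_algebra) = 0"
  using scaleC_scaleC[of z 0 "0::'a"] by simp

lemma scaleC_minus_one: "(-1) *\<^sub>C (a::'a::unital_cstar_algebra) = - a"
  using scaleC_of_real[of "-1" a] by simp

lemma scaleC_diff_right: "z *\<^sub>C (a - b) = z *\<^sub>C a - z *\<^sub>C (b::'a::unital_cstar_algebra)"
proof -
  have "z *\<^sub>C (a - b) + z *\<^sub>C b = z *\<^sub>C a" by (simp flip: scaleC_add_right)
  then show ?thesis by (simp add: eq_diff_eq)
qed

lemma bounded_linear_star: "bounded_linear (star :: 'a::unital_cstar_algebra \<Rightarrow> 'a)"
  by (rule bounded_linear_intro[where K = 1]) (auto simp: star_add star_scaleR)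

lemma norm_projection_le: "projection p \<Longrightarrow> norm p \<le> 1"
  using cstar_identity[of p] unfolding projection_def
  by (metis power2_eq_square mult_cancel_left norm_eq_zero norm_one order_refl mult_1_right norm_zero zero_le_one)

section \<open>Powers of elements near the identity\<close>

text \<open>The binomial series of \<open>(1 - w)\<^sup>a\<close>. With \<open>a = \<plusminus>1/2\<close> it
  takes the place of the continuous functional calculus everywhere below.\<close>

definition one_minus_power :: "real \<Rightarrow> 'a::unital_cstar_algebra \<Rightarrow> 'a" where
  "one_minus_power a w = (\<Sum>n. ((a gchoose n) * (-1) ^ n) *\<^sub>R w ^ n)"

text \<open>The ratio of consecutive coefficients is \<open>(a - n) / (n + 1)\<close>, of absolute value at
  most \<open>1\<close>. The bound makes the series converge absolutely for \<open>norm w < 1\<close>.\<close>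

lemma abs_gbinomial_le_1:
  assumes "\<bar>a\<bar> \<le> (1::real)"
  shows "\<bar>a gchoose n\<bar> \<le> 1"
proof (induction n)
  case (Suc n)
  have "real (Suc n) * (a gchoose Suc n) = (a - real n) * (a gchoose n)"
    using gbinomial_mult_1[of a n] by (simp add: algebra_simps)
  then have "real (Suc n) * \<bar>a gchoose Suc n\<bar> = \<bar>a - real n\<bar> * \<bar>a gchoose n\<bar>"
    by (metis abs_mult abs_of_nat)
  also have "\<dots> \<le> real (Suc n) * 1"
    using assms Suc by (intro mult_mono) auto
  finally show ?case by simp
qed simp

lemma one_minus_power_summable:
  fixes w :: "'a::unital_cstar_algebra"
  assumes "\<bar>a\<bar> \<le> 1" "norm w < 1"
  shows "summable (\<lambda>n. norm (((a gchoose n) * (-1) ^ n) *\<^sub>R w ^ n))"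
proof (rule summable_comparison_test')
  show "summable (\<lambda>n. norm w ^ n)" using assms by (simp add: summable_geometric)
  fix n
  have "norm (((a gchoose n) * (-1) ^ n) *\<^sub>R w ^ n) \<le> 1 * norm w ^ n"
    unfolding norm_scaleR using abs_gbinomial_le_1[OF assms(1), of n]
    by (intro mult_mono) (auto simp: abs_mult norm_power_ineq)
  then show "norm (norm (((a gchoose n) * (-1) ^ n) *\<^sub>R w ^ n)) \<le> norm w ^ n" by simp
qed

text \<open>Vandermonde's convolution of the binomial coefficients inside a Cauchy product.\<close>

lemma one_minus_power_mult:
  fixes w :: "'a::unital_cstar_algebra"
  assumes "\<bar>a\<bar> \<le> 1" "\<bar>b\<bar> \<le> 1" "norm w < 1"
  shows "one_minus_power a w * one_minus_power b w = one_minus_power (a + b) w"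
proof -
  have "(\<lambda>k. \<Sum>i\<le>k. (((a gchoose i) * (-1) ^ i) *\<^sub>R w ^ i) * (((b gchoose (k - i)) * (-1) ^ (k - i)) *\<^sub>R w ^ (k - i)))
     = (\<lambda>k. (((a + b) gchoose k) * (-1) ^ k) *\<^sub>R w ^ k)"
  proof
    fix k
    have "(\<Sum>i\<le>k. (((a gchoose i) * (-1) ^ i) *\<^sub>R w ^ i) * (((b gchoose (k - i)) * (-1) ^ (k - i)) *\<^sub>R w ^ (k - i)))
      = (\<Sum>i\<le>k. (((a gchoose i) * (b gchoose (k - i))) * (-1) ^ k) *\<^sub>R w ^ k)"
    proof (rule sum.cong[OF refl])
      fix i assume "i \<in> {..k}"
      then have e: "(-1::real) ^ i * (-1) ^ (k - i) = (-1) ^ k" "w ^ i * w ^ (k - i) = w ^ k"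
        by (simp_all flip: power_add)
      have "(((a gchoose i) * (-1) ^ i) *\<^sub>R w ^ i) * (((b gchoose (k - i)) * (-1) ^ (k - i)) *\<^sub>R w ^ (k - i))
        = (((a gchoose i) * (b gchoose (k - i))) * ((-1) ^ i * (-1) ^ (k - i))) *\<^sub>R (w ^ i * w ^ (k - i))"
        by (simp add: mult_ac)
      then show "(((a gchoose i) * (-1) ^ i) *\<^sub>R w ^ i) * (((b gchoose (k - i)) * (-1) ^ (k - i)) *\<^sub>R w ^ (k - i))
        = (((a gchoose i) * (b gchoose (k - i))) * (-1) ^ k) *\<^sub>R w ^ k" unfolding e .
    qed
    also have "\<dots> = ((\<Sum>i\<le>k. (a gchoose i) * (b gchoose (k - i))) * (-1) ^ k) *\<^sub>R w ^ k"
      by (simp add: scaleR_sum_left sum_distrib_right)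
    also have "(\<Sum>i\<le>k. (a gchoose i) * (b gchoose (k - i))) = ((a + b) gchoose k)"
      using gbinomial_Vandermonde[of a b k] by (simp add: atMost_atLeast0)
    finally show "(\<Sum>i\<le>k. (((a gchoose i) * (-1) ^ i) *\<^sub>R w ^ i) * (((b gchoose (k - i)) * (-1) ^ (k - i)) *\<^sub>R w ^ (k - i)))
      = (((a + b) gchoose k) * (-1) ^ k) *\<^sub>R w ^ k" .
  qed
  then show ?thesis
    unfolding one_minus_power_def
    using Cauchy_product[OF one_minus_power_summable[OF assms(1,3)] one_minus_power_summable[OF assms(2,3)]] by simp
qed

lemma one_minus_power_0 [simp]: "one_minus_power 0 (w::'a::unital_cstar_algebra) = 1"
proof -
  have "one_minus_power 0 w = (\<Sum>n. if n = 0 then 1 else 0)"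
    unfolding one_minus_power_def by (rule suminf_cong) (auto simp: gbinomial_0_left)
  then show ?thesis using suminf_finite[of "{0}" "\<lambda>n. if n = 0 then 1 else (0::'a)"] by simp
qed

lemma one_minus_power_1: "one_minus_power 1 (w::'a::unital_cstar_algebra) = 1 - w"
proof -
  have "one_minus_power 1 w = (\<Sum>n. if n = 0 then 1 else if n = 1 then - w else 0)"
    unfolding one_minus_power_def
  proof (rule suminf_cong)
    fix n :: nat
    have "(1::real) gchoose n = of_nat (1 choose n)" using binomial_gbinomial[of 1 n, where 'a = real] by simp
    then show "((1 gchoose n) * (- 1) ^ n) *\<^sub>R w ^ n = (if n = 0 then 1 else if n = 1 then - w else 0)"
      by (cases "n \<le> 1") (auto simp: binomial_eq_0 le_Suc_eq)
  qed
  also have "\<dots> = 1 - w"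
    using suminf_finite[of "{0,1}" "\<lambda>n. if n = 0 then 1 else if n = 1 then - w else (0::'a)"] by simp
  finally show ?thesis .
qed

lemma one_minus_power_commute:
  fixes w :: "'a::unital_cstar_algebra"
  assumes "\<bar>a\<bar> \<le> 1" "norm w < 1" "x * w = w * x"
  shows "x * one_minus_power a w = one_minus_power a w * x"
proof -
  have s: "summable (\<lambda>n. ((a gchoose n) * (-1) ^ n) *\<^sub>R w ^ n)"
    by (rule summable_norm_cancel[OF one_minus_power_summable[OF assms(1,2)]])
  have "x * w ^ n = w ^ n * x" for n
    using power_commuting_commutes[of w x n] assms(3) by metis
  then show ?thesis
    unfolding one_minus_power_def suminf_mult[OF s, symmetric] suminf_mult2[OF s]
    by simp
qed

lemma one_minus_power_star:
  fixes w :: "'a::unital_cstar_algebra"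
  assumes "\<bar>a\<bar> \<le> 1" "norm w < 1" "star w = w"
  shows "star (one_minus_power a w) = one_minus_power a w"
proof -
  have s: "summable (\<lambda>n. ((a gchoose n) * (-1) ^ n) *\<^sub>R w ^ n)"
    by (rule summable_norm_cancel[OF one_minus_power_summable[OF assms(1,2)]])
  show ?thesis
    unfolding one_minus_power_def bounded_linear.suminf[OF bounded_linear_star s]
    by (simp add: star_scaleR star_power assms(3))
qed

text \<open>The unitary is \<open>h + \<i> (1 - h\<^sup>2)\<^sup>1\<^sup>/\<^sup>2\<close>.\<close>

lemma contraction_self_adjoint_average_unitary:
  fixes h :: "'a::unital_cstar_algebra"
  assumes "norm h < 1" "star h = h"
  obtains u where "star u * u = 1" "h = (1/2) *\<^sub>R (u + star u)"
proof -
  let ?w = "h * h"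
  have w: "norm ?w < 1" using cstar_identity[of h] assms by (simp add: power_less_one_iff)
  have sw: "star ?w = ?w" by (simp add: star_mult assms)
  define d where "d = one_minus_power (1/2) ?w"
  have d2: "d * d = 1 - ?w" unfolding d_def using one_minus_power_mult[of "1/2" "1/2" ?w] w by (simp add: one_minus_power_1)
  have sd: "star d = d" unfolding d_def using one_minus_power_star[OF _ w sw] by simp
  have cd: "h * d = d * h" unfolding d_def by (rule one_minus_power_commute) (use w in \<open>auto simp: mult.assoc\<close>)
  define u where "u = h + \<i> *\<^sub>C d"
  have su: "star u = h - \<i> *\<^sub>C d"
    using scaleC_scaleC[of "-1" \<i> d] by (simp add: u_def star_add star_scaleC assms sd scaleC_minus_one)
  have "star u * u = h * h + \<i> *\<^sub>C (h * d) - \<i> *\<^sub>C (d * h) - \<i> *\<^sub>C (\<i> *\<^sub>C (d * d))"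
    unfolding su by (simp add: u_def algebra_simps scaleC_diff_right scaleC_add_right mult_scaleC_left mult_scaleC_right)
  also have "\<dots> = 1" by (simp add: cd scaleC_scaleC scaleC_minus_one d2)
  finally have "star u * u = 1" .
  moreover have "h = (1/2) *\<^sub>R (u + star u)"
    unfolding su by (simp add: u_def algebra_simps flip: scaleR_2)
  ultimately show ?thesis using that by blast
qed

text \<open>Unitaries have norm \<open>1\<close> and are preserved, so averages of unitaries are mapped to contractions; this
  handles the self-adjoint elements, and the C*-identity the others.\<close>

lemma star_automorphism_norm_le:
  assumes "star_automorphism \<alpha>"
  shows "norm (\<alpha> a) \<le> norm (a::'a::unital_cstar_algebra)"
proof -
  note A = assms[unfolded star_automorphism_def]
  have surj: "\<exists>x. \<alpha> x = y" for y using A by (metis bij_pointE)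
  have one: "\<alpha> 1 = 1"
  proof -
    obtain x where x: "\<alpha> x = 1" using surj by blast
    have "\<alpha> (x * 1) = \<alpha> x * \<alpha> 1" using A by blast
    then show ?thesis using x by simp
  qed
  have scR: "\<alpha> (r *\<^sub>R b) = r *\<^sub>R \<alpha> b" for r b
    using A by (metis scaleC_of_real)
  have sa: "norm (\<alpha> h) \<le> 1" if h: "norm h < 1" "star h = h" for h
  proof -
    obtain u where u: "star u * u = 1" "h = (1/2) *\<^sub>R (u + star u)"
      using contraction_self_adjoint_average_unitary[OF h] .
    have "star (\<alpha> u) * \<alpha> u = 1" using A u(1) one by metis
    then have n: "norm (\<alpha> u) = 1" using cstar_identity[of "\<alpha> u"]
      by (metis norm_ge_zero norm_one one_power2 power2_eq_iff_nonneg zero_le_one)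
    have "\<alpha> h = (1/2) *\<^sub>R (\<alpha> u + star (\<alpha> u))" using A u(2) scR by metis
    moreover have "norm (\<alpha> u + star (\<alpha> u)) \<le> 2" using norm_triangle_ineq[of "\<alpha> u" "star (\<alpha> u)"] n by simp
    ultimately show ?thesis by simp
  qed
  have sa2: "norm (\<alpha> h) \<le> norm h" if "star h = h" for h
  proof (rule field_le_mult_one_interval)
    fix z :: real assume z: "0 < z" "z < 1"
    show "z * norm (\<alpha> h) \<le> norm h"
    proof (cases "h = 0")
      case True
      have "\<alpha> 0 = 0" using scR[of 0 0] by simp
      then show ?thesis using True by simp
    next
      case False
      have "norm (\<alpha> ((z / norm h) *\<^sub>R h)) \<le> 1"
        by (rule sa) (use z False in \<open>auto simp: star_scaleR that\<close>)
      then show ?thesis using z False by (simp add: scR field_simps)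
    qed
  qed
  have "(norm (\<alpha> a))\<^sup>2 = norm (\<alpha> (star a * a))" using A cstar_identity[of "\<alpha> a"] by metis
  also have "\<dots> \<le> norm (star a * a)" by (rule sa2) (simp add: star_mult star_star)
  finally show ?thesis by (simp add: cstar_identity power2_le_iff_abs_le)
qed

text \<open>If \<open>y\<^sup>* x y\<close> is close to \<open>l p\<close>, then it is invertible in the
  corner of \<open>p\<close>, and \<open>y\<close> can be corrected by the inverse square root.\<close>

lemma self_adjoint_normalize:
  fixes x y p :: "'a::unital_cstar_algebra"
  assumes p: "projection p" and sx: "star x = x" and yp: "y * p = y"
    and l: "0 < l" "norm (star y * x * y - l *\<^sub>R p) < l"
  obtains z where "star z * x * z = p" "z * p = z"
proof -
  have pp: "p * p = p" "star p = p" using p by (auto simp: projection_def)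
  have py: "p * star y = star y" using arg_cong[OF yp, of star] by (simp add: star_mult pp)
  \<comment> \<open>\<open>w\<close> lives in the corner of \<open>p\<close>, so the powers of \<open>1 - w\<close> commute with \<open>p\<close>\<close>
  define w where "w = p - (1 / l) *\<^sub>R (star y * x * y)"
  have "norm w = norm ((1/l) *\<^sub>R (star y * x * y - l *\<^sub>R p))"
    unfolding w_def using l(1) by (simp add: scaleR_diff_right norm_minus_commute)
  also have "\<dots> = (1/l) * norm (star y * x * y - l *\<^sub>R p)" using l(1) by (simp only: norm_scaleR) simp
  also have "\<dots> < 1" using l by (simp add: divide_less_eq)
  finally have w1: "norm w < 1" .
  have sw: "star w = w" by (simp add: w_def star_diff star_scaleR star_mult star_star sx pp mult.assoc)
  have pw1: "p * w = w" by (simp add: w_def algebra_simps pp py flip: mult.assoc)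
  have wp: "w * p = w" by (simp add: w_def algebra_simps pp yp mult.assoc)
  define r where "r = one_minus_power (-1/2) w"
  have rp: "p * r = r * p" unfolding r_def by (rule one_minus_power_commute) (use w1 pw1 wp in auto)
  have rw: "w * r = r * w" unfolding r_def by (rule one_minus_power_commute) (use w1 in auto)
  have sr: "star r = r" unfolding r_def by (rule one_minus_power_star) (use w1 sw in auto)
  have rr: "r * r * (1 - w) = 1"
  proof -
    have "r * r = one_minus_power (-1) w" unfolding r_def using one_minus_power_mult[of "-1/2" "-1/2" w] w1 by simp
    then have "r * r * one_minus_power 1 w = one_minus_power 0 w" using one_minus_power_mult[of "-1" 1 w] w1 by simp
    then show ?thesis by (simp add: one_minus_power_1)
  qed
  define z where "z = (1 / sqrt l) *\<^sub>R (y * r)"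
  have "star z * x * z = (1 / l) *\<^sub>R (r * (star y * x * y) * r)"
    using l(1) by (simp add: z_def star_scaleR star_mult sr mult.assoc)
  also have "\<dots> = r * (p - w) * r" by (simp add: w_def)
  also have "\<dots> = r * ((1 - w) * p) * r" by (simp add: algebra_simps wp)
  also have "\<dots> = r * (1 - w) * (p * r)" by (simp add: mult.assoc)
  also have "\<dots> = r * ((1 - w) * r) * p" by (simp add: rp mult.assoc)
  also have "(1 - w) * r = r * (1 - w)" by (simp add: algebra_simps rw)
  also have "r * (r * (1 - w)) * p = p" using rr by (simp add: mult.assoc)
  finally have 1: "star z * x * z = p" .
  have "z * p = z"
  proof -
    have "y * r * p = y * (p * r)" by (simp add: rp mult.assoc)
    also have "\<dots> = y * r" by (simp add: yp flip: mult.assoc)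
    finally show ?thesis by (simp add: z_def)
  qed
  with 1 show ?thesis using that by blast
qed

text \<open>The range projection \<open>b\<^sup>* z z\<^sup>* b\<close> is dominated by a multiple of
  \<open>b\<^sup>* b\<close>, hence it lies in every hereditary subalgebra which contains \<open>b\<^sup>*
  b\<close>.\<close>

lemma mvn_equiv_in_hereditary_generated:
  fixes b z p :: "'a::unital_cstar_algebra"
  assumes z: "star z * (b * star b) * z = p" "z * p = z"
  shows "\<exists>q\<in>hereditary_generated (star b * b). projection q \<and> mvn_equiv p q"
proof -
  define q where "q = star b * z * star z * b"
  define C where "C = (norm z)\<^sup>2 + 1"
  have C: "C > 0" by (simp add: C_def add_nonneg_pos)
  define w where "w = (1 / C) *\<^sub>R (z * star z)"
  have "norm w = (norm z)\<^sup>2 / C"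
    using C cstar_identity[of "star z"] by (simp add: w_def star_star)
  then have w1: "norm w < 1" using C by (simp add: C_def)
  have sw: "star w = w" by (simp add: w_def star_scaleR star_mult star_star)
  \<comment> \<open>\<open>d\<close> is a square root of \<open>C - z z\<^sup>*\<close>, which exhibits \<open>C b\<^sup>* b - q\<close> as \<open>(d b)\<^sup>* (d b)\<close>\<close>
  define d where "d = sqrt C *\<^sub>R one_minus_power (1/2) w"
  have sd: "star d = d" using one_minus_power_star[OF _ w1 sw, of "1/2"] by (simp add: d_def star_scaleR)
  have "d * d = C *\<^sub>R (one_minus_power (1/2) w * one_minus_power (1/2) w)" using C by (simp add: d_def)
  also have "\<dots> = C *\<^sub>R (1 - w)" using one_minus_power_mult[of "1/2" "1/2" w] w1 by (simp add: one_minus_power_1)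
  also have "\<dots> = C *\<^sub>R 1 - z * star z" using C by (simp add: w_def scaleR_diff_right)
  finally have dd: "d * d = C *\<^sub>R 1 - z * star z" .
  have pos: "cpositive q" unfolding cpositive_def q_def
    by (rule exI[of _ "star z * b"]) (simp add: star_mult star_star mult.assoc)
  have le: "cle q (C *\<^sub>R (star b * b))" unfolding cpositive_def q_def cle_def
  proof (rule exI[of _ "d * b"])
    have "star (d * b) * (d * b) = star b * (d * d) * b" by (simp add: star_mult sd mult.assoc)
    also have "\<dots> = C *\<^sub>R (star b * b) - star b * z * star z * b"
      unfolding dd by (simp add: algebra_simps mult.assoc)
    finally show "C *\<^sub>R (star b * b) - star b * z * star z * b = star (d * b) * (d * b)" ..
  qed
  have "q \<in> B" if B: "hereditary_subalgebra B" "star b * b \<in> B" for B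
  proof -
    have "C *\<^sub>R (star b * b) \<in> B" using B unfolding hereditary_subalgebra_def
      by (metis scaleC_of_real)
    then show ?thesis using B(1) pos le unfolding hereditary_subalgebra_def by blast
  qed
  then have mem: "q \<in> hereditary_generated (star b * b)" by (auto simp: hereditary_generated_def)
  have "q * q = star b * (z * (star z * (b * star b) * z)) * star z * b" by (simp add: q_def mult.assoc)
  also have "\<dots> = q" unfolding z by (simp add: q_def)
  finally have "projection q"
    unfolding projection_def by (simp add: q_def star_mult star_star mult.assoc)
  moreover have "mvn_equiv p q" unfolding mvn_equiv_def
    by (rule exI[of _ "star b * z"]) (use z in \<open>simp add: q_def star_mult star_star mult.assoc\<close>)
  ultimately show ?thesis using mem by blast
qed

section \<open>Entrywise description of the connecting maps\<close>

lemma mat_adjoint_carrier: "A \<in> carrier_mat m k \<Longrightarrow> mat_adjoint A \<in> carrier_mat k m"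
  unfolding mat_adjoint_def by auto

lemma mat_adjoint_index:
  "A \<in> carrier_mat m k \<Longrightarrow> i < k \<Longrightarrow> j < m \<Longrightarrow> mat_adjoint A $$ (i, j) = cnj (A $$ (j, i))"
  unfolding mat_adjoint_def by (subst mat_of_rows_index) auto

text \<open>The direction in which a copy runs through the circle: forwards in \<open>\<phi>\<^sup>+\<close>,
  backwards in \<open>\<phi>\<^sup>-\<close>.\<close>

definition side :: "bool \<Rightarrow> real \<Rightarrow> real" where
  "side \<sigma> t = (if \<sigma> then t else 1 - t)"

lemma phi_plus_eq_mat:
  assumes "c t \<in> carrier_mat 2 2" "f (t / 2) \<in> carrier_mat h h" "f ((t + 1) / 2) \<in> carrier_mat h h"
  shows "phi_plus c h f t = mat (2 * h) (2 * h) (\<lambda>(x, y). \<Sum>i<2.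
     c t $$ (x div h, i) * f ((t + real i) / 2) $$ (x mod h, y mod h) * cnj (c t $$ (y div h, i)))"
proof -
  let ?u = "c t" let ?X = "f (t / 2)" let ?Y = "f ((t + 1) / 2)"
  have adj: "mat_adjoint (scalar_blocks h ?u) =
     four_block_mat (cnj (?u $$ (0,0)) \<cdot>\<^sub>m 1\<^sub>m h) (cnj (?u $$ (1,0)) \<cdot>\<^sub>m 1\<^sub>m h)
                    (cnj (?u $$ (0,1)) \<cdot>\<^sub>m 1\<^sub>m h) (cnj (?u $$ (1,1)) \<cdot>\<^sub>m 1\<^sub>m h)" (is "_ = ?A")
  proof (rule eq_matI)
    have c: "scalar_blocks h ?u \<in> carrier_mat (h + h) (h + h)"
      unfolding scalar_blocks_def by (intro four_block_carrier_mat) auto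
    fix i j assume "i < dim_row ?A" "j < dim_col ?A"
    then have ij: "i < h + h" "j < h + h" by auto
    show "mat_adjoint (scalar_blocks h ?u) $$ (i, j) = ?A $$ (i, j)"
      unfolding mat_adjoint_index[OF c ij] using ij
      by (auto simp: scalar_blocks_def)
  qed (auto simp: mat_adjoint_def scalar_blocks_def)
  have smult1: "(a \<cdot>\<^sub>m 1\<^sub>m h) * M = a \<cdot>\<^sub>m M" "M * (a \<cdot>\<^sub>m 1\<^sub>m h) = a \<cdot>\<^sub>m M"
    if "M \<in> carrier_mat h h" for a and M :: "complex mat"
    using that by (auto simp: mult_smult_assoc_mat[of _ h h] mult_smult_distrib[of _ h h])
  have 1: "scalar_blocks h ?u * block_diag ?X ?Y =
     four_block_mat (?u $$ (0,0) \<cdot>\<^sub>m ?X) (?u $$ (0,1) \<cdot>\<^sub>m ?Y) (?u $$ (1,0) \<cdot>\<^sub>m ?X) (?u $$ (1,1) \<cdot>\<^sub>m ?Y)"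
    unfolding scalar_blocks_def block_diag_def using assms
    by (subst mult_four_block_mat[of _ h h _ h _ h _ _ h _ h]) (auto simp: smult1)
  have 2: "phi_plus c h f t = four_block_mat
      (cnj (?u $$ (0,0)) \<cdot>\<^sub>m (?u $$ (0,0) \<cdot>\<^sub>m ?X) + cnj (?u $$ (0,1)) \<cdot>\<^sub>m (?u $$ (0,1) \<cdot>\<^sub>m ?Y))
      (cnj (?u $$ (1,0)) \<cdot>\<^sub>m (?u $$ (0,0) \<cdot>\<^sub>m ?X) + cnj (?u $$ (1,1)) \<cdot>\<^sub>m (?u $$ (0,1) \<cdot>\<^sub>m ?Y))
      (cnj (?u $$ (0,0)) \<cdot>\<^sub>m (?u $$ (1,0) \<cdot>\<^sub>m ?X) + cnj (?u $$ (0,1)) \<cdot>\<^sub>m (?u $$ (1,1) \<cdot>\<^sub>m ?Y))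
      (cnj (?u $$ (1,0)) \<cdot>\<^sub>m (?u $$ (1,0) \<cdot>\<^sub>m ?X) + cnj (?u $$ (1,1)) \<cdot>\<^sub>m (?u $$ (1,1) \<cdot>\<^sub>m ?Y))" (is "_ = ?R")
    unfolding phi_plus_def 1 adj using assms
    by (subst mult_four_block_mat[of _ h h _ h _ h _ _ h _ h]) (auto simp: smult1)
  show ?thesis
    unfolding 2
  proof (rule eq_matI)
    fix x y assume "x < dim_row (mat (2 * h) (2 * h) (\<lambda>(x, y). \<Sum>i<2.
     c t $$ (x div h, i) * f ((t + real i) / 2) $$ (x mod h, y mod h) * cnj (c t $$ (y div h, i))))"
     "y < dim_col (mat (2 * h) (2 * h) (\<lambda>(x, y). \<Sum>i<2.
     c t $$ (x div h, i) * f ((t + real i) / 2) $$ (x mod h, y mod h) * cnj (c t $$ (y div h, i))))"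
    then have xy: "x < 2 * h" "y < 2 * h" by auto
    have d: "z div h = (if z < h then 0 else 1)" "z mod h = (if z < h then z else z - h)" if "z < 2 * h" for z
      using that by (auto simp: div_if mod_if)
    show "?R $$ (x, y) = mat (2 * h) (2 * h) (\<lambda>(x, y). \<Sum>i<2.
     c t $$ (x div h, i) * f ((t + real i) / 2) $$ (x mod h, y mod h) * cnj (c t $$ (y div h, i))) $$ (x, y)"
      using xy assms by (simp add: d lessThan_nat_numeral eval_nat_numeral)
  qed (use assms in auto)
qed

text \<open>With \<open>2 h\<close> the size of \<open>f\<close>, a row \<open>x < 8 h\<close> of \<open>\<psi>(f)\<close> is described by three binary digits and a
  remainder below \<open>h\<close>: the outer block, the choice between \<open>\<phi>\<^sup>+\<close> and \<open>\<phi>\<^sup>-\<close>, and the block inside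
  \<open>\<phi>\<^sup>\<plusminus>\<close>. The row of \<open>f\<close> from which it comes has the same outer block for \<open>\<phi>\<^sup>+\<close> and the opposite one for
  \<open>\<phi>\<^sup>-\<close>.\<close>

definition plus_row :: "nat \<Rightarrow> nat \<Rightarrow> bool" where
  "plus_row h x \<longleftrightarrow> even (x div (2 * h))"

definition source_row :: "nat \<Rightarrow> nat \<Rightarrow> nat" where
  "source_row h x = (if plus_row h x then x div (4 * h) else 1 - x div (4 * h)) * h + x mod h"

definition path_row :: "nat \<Rightarrow> nat \<Rightarrow> nat" where
  "path_row h x = (x div h) mod 2"

definition step_entry :: "(real \<Rightarrow> complex mat) \<Rightarrow> nat \<Rightarrow> (real \<Rightarrow> nat \<Rightarrow> nat \<Rightarrow> complex) \<Rightarrow>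
    real \<Rightarrow> nat \<Rightarrow> nat \<Rightarrow> complex" where
  "step_entry c h X t x y = (if plus_row h x = plus_row h y then
     let s = side (plus_row h x) t in
     \<Sum>i<2. c s $$ (path_row h x, i) * X ((s + real i) / 2) (source_row h x) (source_row h y)
            * cnj (c s $$ (path_row h y, i)) else 0)"

text \<open>Elements of the circle algebras are handled through their entries, as functions of the time and of
  two natural numbers. In this form sums can be exchanged and products re-associated without side conditions
  on dimensions.\<close>

definition mat_fun :: "nat \<Rightarrow> (real \<Rightarrow> nat \<Rightarrow> nat \<Rightarrow> complex) \<Rightarrow> real \<Rightarrow> complex mat" where
  "mat_fun d X = (\<lambda>t\<in>{0..1}. mat d d (\<lambda>(x, y). X t x y))"

lemma row_decode:
  assumes "0 < h" "x < 8 * h"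
  shows "x < 2 * h \<Longrightarrow> plus_row h x \<and> source_row h x = x mod h \<and> path_row h x = x div h"
    "2 * h \<le> x \<Longrightarrow> x < 4 * h \<Longrightarrow> \<not> plus_row h x \<and> source_row h x = h + (x - 2 * h) mod h \<and> path_row h x = (x - 2 * h) div h"
    "4 * h \<le> x \<Longrightarrow> x < 6 * h \<Longrightarrow> plus_row h x \<and> source_row h x = h + (x - 4 * h) mod h \<and> path_row h x = (x - 4 * h) div h"
    "6 * h \<le> x \<Longrightarrow> \<not> plus_row h x \<and> source_row h x = (x - 6 * h) mod h \<and> path_row h x = (x - 6 * h) div h"
proof -
  have *: "plus_row h (k * (2 * h) + q) = even k \<and> path_row h (k * (2 * h) + q) = q div h \<and>
     (k * (2 * h) + q) mod h = q mod h \<and> (k * (2 * h) + q) div (4 * h) = k div 2"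
    if "q < 2 * h" for k q
  proof -
    have 1: "(k * (2 * h) + q) div (2 * h) = k" using that assms(1) by simp
    have "q div h < 2" using that assms(1) by (simp add: less_mult_imp_div_less)
    moreover have "(k * (2 * h) + q) div h = 2 * k + q div h"
      using assms(1) div_mult_self1[of h q "2 * k"] by (simp add: algebra_simps)
    moreover have "(k * (2 * h) + q) mod h = q mod h"
      using mod_mult_self1[of q "2 * k" h] by (simp add: algebra_simps)
    moreover have "(k * (2 * h) + q) div (4 * h) = (k * (2 * h) + q) div (2 * h) div 2"
      by (simp add: div_mult2_eq[symmetric] algebra_simps)
    ultimately show ?thesis unfolding plus_row_def path_row_def 1 by simp
  qed
  show "x < 2 * h \<Longrightarrow> plus_row h x \<and> source_row h x = x mod h \<and> path_row h x = x div h"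
    using *[of x 0] by (simp add: source_row_def)
  show "2 * h \<le> x \<Longrightarrow> x < 4 * h \<Longrightarrow> \<not> plus_row h x \<and> source_row h x = h + (x - 2 * h) mod h \<and> path_row h x = (x - 2 * h) div h"
    using *[of "x - 2 * h" 1] by (simp add: source_row_def)
  show "4 * h \<le> x \<Longrightarrow> x < 6 * h \<Longrightarrow> plus_row h x \<and> source_row h x = h + (x - 4 * h) mod h \<and> path_row h x = (x - 4 * h) div h"
    using *[of "x - 4 * h" 2] by (simp add: source_row_def)
  show "6 * h \<le> x \<Longrightarrow> \<not> plus_row h x \<and> source_row h x = (x - 6 * h) mod h \<and> path_row h x = (x - 6 * h) div h"
    using *[of "x - 6 * h" 3] assms by (simp add: source_row_def)
qed

text \<open>In every block \<open>\<phi>\<^sup>\<plusminus>\<close> contributes one sum over the two preimages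
  of \<open>t\<close> under doubling.\<close>

lemma blackadar_map_mat_fun:
  assumes n: "n \<ge> 1" and c: "\<And>t. t \<in> {0..1} \<Longrightarrow> c t \<in> carrier_mat 2 2"
  shows "blackadar_map c n (mat_fun (4 ^ n) X) = mat_fun (4 ^ Suc n) (step_entry c (4 ^ n div 2) X)"
proof
  fix t :: real
  define h where "h = (4::nat) ^ n div 2"
  have h: "4 ^ n = 2 * h" "0 < h" using n by (cases n; simp add: h_def)+
  show "blackadar_map c n (mat_fun (4 ^ n) X) t = mat_fun (4 ^ Suc n) (step_entry c (4 ^ n div 2) X) t"
  proof (cases "t \<in> {0..1}")
    case False
    then show ?thesis by (simp only: blackadar_map_def mat_fun_def restrict_def if_False)
  next
    case True
    define f where "f = mat_fun (4 ^ n) X"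
    define E where "E i j \<sigma> = mat (2 * h) (2 * h) (\<lambda>(x, y). \<Sum>k<2.
       c (side \<sigma> t) $$ (x div h, k) * X ((side \<sigma> t + real k) / 2) (i * h + x mod h) (j * h + y mod h)
        * cnj (c (side \<sigma> t) $$ (y div h, k)))" for i j :: nat and \<sigma>
    have P: "phi_plus c h (\<lambda>s. block h (f s) i j) s = mat (2 * h) (2 * h) (\<lambda>(x, y). \<Sum>k<2.
       c s $$ (x div h, k) * X ((s + real k) / 2) (i * h + x mod h) (j * h + y mod h)
        * cnj (c s $$ (y div h, k)))" if s: "s \<in> {0..1}" and ij: "i < 2" "j < 2" for i j s
    proof (subst phi_plus_eq_mat)
      show "c s \<in> carrier_mat 2 2" using c s by blast
      show "mat (2 * h) (2 * h) (\<lambda>(x, y). \<Sum>k<2. c s $$ (x div h, k) *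
            block h (f ((s + real k) / 2)) i j $$ (x mod h, y mod h) * cnj (c s $$ (y div h, k))) =
         mat (2 * h) (2 * h) (\<lambda>(x, y). \<Sum>k<2. c s $$ (x div h, k) *
            X ((s + real k) / 2) (i * h + x mod h) (j * h + y mod h) * cnj (c s $$ (y div h, k)))"
      proof (rule cong_mat[OF refl refl], clarsimp, rule sum.cong[OF refl])
        fix x y k :: nat assume "k \<in> {..<2}"
        then have k: "(s + real k) / 2 \<in> {0..1}" using s by auto
        have b: "i * h + z mod h < 2 * h" if "i < 2" for i z
        proof -
          have "z mod h < h" using h by simp
          moreover have "i * h \<le> 1 * h" using that by (intro mult_right_mono) auto
          ultimately show ?thesis by linarith
        qed
        show "c s $$ (x div h, k) * block h (f ((s + real k) / 2)) i j $$ (x mod h, y mod h) * cnj (c s $$ (y div h, k)) =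
          c s $$ (x div h, k) * X ((s + real k) / 2) (i * h + x mod h) (j * h + y mod h) * cnj (c s $$ (y div h, k))"
          using k h(2) b[of i x] b[of j y] ij by (simp add: block_def f_def mat_fun_def h(1))
      qed
    qed (auto simp: block_def)
    have PE: "phi_plus c h (\<lambda>s. block h (f s) i j) t = E i j True" if "i < 2" "j < 2" for i j
      using P[OF True that] by (simp add: E_def side_def)
    have QE: "phi_minus c h (\<lambda>s. block h (f s) i j) t = E i j False" if "i < 2" "j < 2" for i j
      using P[OF _ that, of "1 - t"] True by (simp add: E_def side_def phi_minus_def)
    have dE: "dim_row (E i j s) = 2 * h" "dim_col (E i j s) = 2 * h" for i j s by (auto simp: E_def)
    have L: "blackadar_map c n f t = four_block_mat
          (block_diag (E 0 0 True) (E 1 1 False)) (block_diag (E 0 1 True) (E 1 0 False))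
          (block_diag (E 1 0 True) (E 0 1 False)) (block_diag (E 1 1 True) (E 0 0 False))" (is "_ = ?B")
      using True by (simp add: blackadar_map_def Let_def PE QE flip: h_def)
    have "?B = mat (4 ^ Suc n) (4 ^ Suc n) (\<lambda>(x, y). step_entry c h X t x y)"
    proof (rule eq_matI)
      fix x y assume "x < dim_row (mat (4 ^ Suc n) (4 ^ Suc n) (\<lambda>(x, y). step_entry c h X t x y))"
        "y < dim_col (mat (4 ^ Suc n) (4 ^ Suc n) (\<lambda>(x, y). step_entry c h X t x y))"
      then have xy: "x < 8 * h" "y < 8 * h" using h by auto
      have four: "z < 2 * h \<or> 2 * h \<le> z \<and> z < 4 * h \<or> 4 * h \<le> z \<and> z < 6 * h \<or> 6 * h \<le> z" for z by linarith
      note R = row_decode[OF h(2) xy(1)] row_decode[OF h(2) xy(2)]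
      have "?B $$ (x, y) = step_entry c h X t x y"
        using four[of x] four[of y] xy h(2)
        apply (elim disjE conjE)
        apply (simp_all add: block_diag_def dE step_entry_def R Let_def)
        apply (simp_all add: E_def)
        apply arith+
        done
      then show "?B $$ (x, y) = mat (4 ^ Suc n) (4 ^ Suc n) (\<lambda>(x, y). step_entry c h X t x y) $$ (x, y)"
        using xy h by simp
    qed (use h in \<open>auto simp: dE block_diag_def\<close>)
    then show ?thesis using L True by (simp add: f_def mat_fun_def h_def)
  qed
qed

section \<open>Operator bounds for finite matrices\<close>

text \<open>The operator norm of a matrix over finite index sets is at most \<open>C\<close>. Working with
  bounds avoids the supremum in \<open>mat_norm\<close> and allows arbitrary index types.\<close>

definition op_bound :: "'i set \<Rightarrow> 'j set \<Rightarrow> ('i \<Rightarrow> 'j \<Rightarrow> complex) \<Rightarrow> real \<Rightarrow> bool" where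
  "op_bound I J Y C \<longleftrightarrow>
     (\<forall>u. (\<Sum>x\<in>I. (cmod (\<Sum>y\<in>J. Y x y * u y))\<^sup>2) \<le> C\<^sup>2 * (\<Sum>y\<in>J. (cmod (u y))\<^sup>2))"

lemma complex_Cauchy_Schwarz:
  "(cmod (\<Sum>y\<in>J. a y * b y))\<^sup>2 \<le> (\<Sum>y\<in>J. (cmod (a y))\<^sup>2) * (\<Sum>y\<in>J. (cmod (b y))\<^sup>2)"
proof -
  have "cmod (\<Sum>y\<in>J. a y * b y) \<le> (\<Sum>y\<in>J. cmod (a y) * cmod (b y))"
    using norm_sum[of "\<lambda>y. a y * b y" J] by (simp add: norm_mult)
  then have "(cmod (\<Sum>y\<in>J. a y * b y))\<^sup>2 \<le> (\<Sum>y\<in>J. cmod (a y) * cmod (b y))\<^sup>2"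
    by (intro power_mono) auto
  also have "\<dots> \<le> (\<Sum>y\<in>J. (cmod (a y))\<^sup>2) * (\<Sum>y\<in>J. (cmod (b y))\<^sup>2)"
    by (rule Cauchy_Schwarz_ineq_sum)
  finally show ?thesis .
qed

lemma op_bound_entries:
  assumes "finite I" "finite J" "\<And>x y. x \<in> I \<Longrightarrow> y \<in> J \<Longrightarrow> cmod (Y x y) \<le> B" "0 \<le> B"
  shows "op_bound I J Y (real (card I) * real (card J) * B)"
  unfolding op_bound_def
proof
  fix u
  let ?S = "\<Sum>y\<in>J. (cmod (u y))\<^sup>2"
  have S: "0 \<le> ?S" by (intro sum_nonneg) auto
  have a: "(cmod (\<Sum>y\<in>J. Y x y * u y))\<^sup>2 \<le> (real (card J) * B\<^sup>2) * ?S" if x: "x \<in> I" for x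
  proof -
    have "(\<Sum>y\<in>J. (cmod (Y x y))\<^sup>2) \<le> (\<Sum>y\<in>J. B\<^sup>2)"
      by (intro sum_mono power_mono assms x) auto
    then have "(\<Sum>y\<in>J. (cmod (Y x y))\<^sup>2) * ?S \<le> (real (card J) * B\<^sup>2) * ?S"
      using S by (intro mult_right_mono) auto
    then show ?thesis using complex_Cauchy_Schwarz[of "Y x" u J] by linarith
  qed
  have sq: "real n \<le> (real n)\<^sup>2" for n
    by (cases n) (auto simp: power2_eq_square)
  have "(\<Sum>x\<in>I. (cmod (\<Sum>y\<in>J. Y x y * u y))\<^sup>2) \<le> (\<Sum>x\<in>I. (real (card J) * B\<^sup>2) * ?S)"
    by (rule sum_mono) (rule a)
  also have "\<dots> = real (card I) * real (card J) * (B\<^sup>2 * ?S)" by simp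
  also have "\<dots> \<le> (real (card I))\<^sup>2 * (real (card J))\<^sup>2 * (B\<^sup>2 * ?S)"
    using S by (intro mult_right_mono mult_mono sq) auto
  finally show "(\<Sum>x\<in>I. (cmod (\<Sum>y\<in>J. Y x y * u y))\<^sup>2) \<le> (real (card I) * real (card J) * B)\<^sup>2 * ?S"
    by (simp add: power_mult_distrib mult_ac)
qed

lemma op_bound_mono:
  assumes "op_bound I J Y C" "0 \<le> C" "C \<le> D"
  shows "op_bound I J Y D"
  unfolding op_bound_def
proof
  fix u
  have "C\<^sup>2 * (\<Sum>y\<in>J. (cmod (u y))\<^sup>2) \<le> D\<^sup>2 * (\<Sum>y\<in>J. (cmod (u y))\<^sup>2)"
    using assms by (intro mult_right_mono power_mono sum_nonneg) auto
  then show "(\<Sum>x\<in>I. (cmod (\<Sum>y\<in>J. Y x y * u y))\<^sup>2) \<le> D\<^sup>2 * (\<Sum>y\<in>J. (cmod (u y))\<^sup>2)"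
    using assms(1) unfolding op_bound_def by (meson order_trans)
qed

text \<open>The Schur test: the Cauchy-Schwarz inequality in each row with the weights \<open>cmod (Y x y)\<close>, then exchange of the
  two sums.\<close>

lemma op_bound_Schur:
  assumes fin: "finite I" "finite J"
    and rows: "\<And>x. x \<in> I \<Longrightarrow> (\<Sum>y\<in>J. cmod (Y x y)) \<le> C"
    and cols: "\<And>y. y \<in> J \<Longrightarrow> (\<Sum>x\<in>I. cmod (Y x y)) \<le> C"
  shows "op_bound I J Y C"
  unfolding op_bound_def
proof
  fix u
  let ?m = "\<lambda>x y. cmod (Y x y)"
  have a: "(cmod (\<Sum>y\<in>J. Y x y * u y))\<^sup>2 \<le> C * (\<Sum>y\<in>J. ?m x y * (cmod (u y))\<^sup>2)" if "x \<in> I" for x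
  proof -
    have "cmod (\<Sum>y\<in>J. Y x y * u y) \<le> (\<Sum>y\<in>J. sqrt (?m x y) * (sqrt (?m x y) * cmod (u y)))"
      using norm_sum[of "\<lambda>y. Y x y * u y" J] by (simp add: norm_mult flip: mult.assoc)
    then have "(cmod (\<Sum>y\<in>J. Y x y * u y))\<^sup>2 \<le> (\<Sum>y\<in>J. sqrt (?m x y) * (sqrt (?m x y) * cmod (u y)))\<^sup>2"
      by (intro power_mono) auto
    also have "\<dots> \<le> (\<Sum>y\<in>J. (sqrt (?m x y))\<^sup>2) * (\<Sum>y\<in>J. (sqrt (?m x y) * cmod (u y))\<^sup>2)"
      by (rule Cauchy_Schwarz_ineq_sum)
    also have "\<dots> = (\<Sum>y\<in>J. ?m x y) * (\<Sum>y\<in>J. ?m x y * (cmod (u y))\<^sup>2)"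
      by (simp add: power_mult_distrib)
    also have "\<dots> \<le> C * (\<Sum>y\<in>J. ?m x y * (cmod (u y))\<^sup>2)"
      by (intro mult_right_mono rows that sum_nonneg) auto
    finally show ?thesis .
  qed
  show "(\<Sum>x\<in>I. (cmod (\<Sum>y\<in>J. Y x y * u y))\<^sup>2) \<le> C\<^sup>2 * (\<Sum>y\<in>J. (cmod (u y))\<^sup>2)"
  proof (cases "I = {}")
    case True
    then show ?thesis by (simp add: sum_nonneg)
  next
    case False
    then obtain x0 where "x0 \<in> I" by blast
    then have C: "0 \<le> C" using rows[of x0] sum_nonneg[of J "\<lambda>y. ?m x0 y"] by auto
    have "(\<Sum>x\<in>I. (cmod (\<Sum>y\<in>J. Y x y * u y))\<^sup>2) \<le> (\<Sum>x\<in>I. C * (\<Sum>y\<in>J. ?m x y * (cmod (u y))\<^sup>2))"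
      by (rule sum_mono) (rule a)
    also have "\<dots> = C * (\<Sum>y\<in>J. (\<Sum>x\<in>I. ?m x y) * (cmod (u y))\<^sup>2)"
      by (subst sum_distrib_left[symmetric], subst sum.swap) (simp add: sum_distrib_right)
    also have "\<dots> \<le> C * (\<Sum>y\<in>J. C * (cmod (u y))\<^sup>2)"
      using C by (intro mult_left_mono sum_mono mult_right_mono cols) auto
    finally show ?thesis by (simp add: sum_distrib_left power2_eq_square mult.assoc)
  qed
qed

subsection \<open>The norm of a matrix\<close>

lemma Re_scalar_prod_conjugate:
  "Re (v \<bullet>c v) = (\<Sum>x<dim_vec v. (cmod (v $ x))\<^sup>2)"
proof -
  have "Re (z * cnj z) = (cmod z)\<^sup>2" for z
    by (metis Re_complex_of_real complex_norm_square)
  then show ?thesis by (simp add: scalar_prod_def atLeast0LessThan del: times_complex.sel)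
qed

lemma Re_scalar_prod_mult_vec:
  assumes "M \<in> carrier_mat d e" "v \<in> carrier_vec e"
  shows "Re ((M *\<^sub>v v) \<bullet>c (M *\<^sub>v v)) = (\<Sum>x<d. (cmod (\<Sum>y<e. M $$ (x, y) * v $ y))\<^sup>2)"
  unfolding Re_scalar_prod_conjugate using assms
  by (auto intro!: sum.cong simp: scalar_prod_def atLeast0LessThan)

lemma mat_norm_le:
  assumes M: "M \<in> carrier_mat d d" and b: "op_bound {..<d} {..<d} (\<lambda>x y. M $$ (x, y)) C" and C: "0 \<le> C"
  shows "mat_norm M \<le> C"
  unfolding mat_norm_def
proof (rule cSUP_least)
  show "{v \<in> carrier_vec (dim_col M). Re (v \<bullet>c v) \<le> 1} \<noteq> {}"
    by (auto intro!: exI[of _ "0\<^sub>v (dim_col M)"] simp: Re_scalar_prod_conjugate)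
  fix v assume "v \<in> {v \<in> carrier_vec (dim_col M). Re (v \<bullet>c v) \<le> 1}"
  then have v: "v \<in> carrier_vec d" "(\<Sum>x<d. (cmod (v $ x))\<^sup>2) \<le> 1"
    using M by (auto simp: Re_scalar_prod_conjugate)
  have "(\<Sum>x<d. (cmod (\<Sum>y<d. M $$ (x, y) * v $ y))\<^sup>2) \<le> C\<^sup>2 * (\<Sum>y<d. (cmod (v $ y))\<^sup>2)"
    using b unfolding op_bound_def by blast
  also have "\<dots> \<le> C\<^sup>2" using v(2) by (simp add: mult_left_le)
  finally show "sqrt (Re ((M *\<^sub>v v) \<bullet>c (M *\<^sub>v v))) \<le> C"
    unfolding Re_scalar_prod_mult_vec[OF M v(1)] using C real_le_lsqrt by blast
qed

lemma bdd_above_mat_norm: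
  assumes M: "M \<in> carrier_mat d d"
  shows "bdd_above ((\<lambda>v. sqrt (Re ((M *\<^sub>v v) \<bullet>c (M *\<^sub>v v)))) ` {v \<in> carrier_vec (dim_col M). Re (v \<bullet>c v) \<le> 1})"
proof -
  define B where "B = (\<Sum>x<d. \<Sum>y<d. cmod (M $$ (x, y)))"
  have B: "cmod (M $$ (x, y)) \<le> B" if "x < d" "y < d" for x y
  proof -
    have "cmod (M $$ (x, y)) \<le> (\<Sum>y<d. cmod (M $$ (x, y)))"
      using that by (intro member_le_sum) auto
    also have "\<dots> \<le> B" unfolding B_def using that
      by (intro member_le_sum[where f = "\<lambda>x. \<Sum>y<d. cmod (M $$ (x, y))"]) (auto intro: sum_nonneg)
    finally show ?thesis .
  qed
  have B0: "0 \<le> B" unfolding B_def by (intro sum_nonneg) auto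
  let ?C = "real (card {..<d}) * real (card {..<d}) * B"
  have o: "op_bound {..<d} {..<d} (\<lambda>x y. M $$ (x, y)) ?C"
    by (rule op_bound_entries) (use B B0 in auto)
  show ?thesis
  proof (rule bdd_aboveI2)
    fix v assume "v \<in> {v \<in> carrier_vec (dim_col M). Re (v \<bullet>c v) \<le> 1}"
    then have v: "v \<in> carrier_vec d" "(\<Sum>x<d. (cmod (v $ x))\<^sup>2) \<le> 1"
      using M by (auto simp: Re_scalar_prod_conjugate)
    have "(\<Sum>x<d. (cmod (\<Sum>y<d. M $$ (x, y) * v $ y))\<^sup>2) \<le> ?C\<^sup>2 * (\<Sum>y<d. (cmod (v $ y))\<^sup>2)"
      using o unfolding op_bound_def by blast
    also have "\<dots> \<le> ?C\<^sup>2" using v(2) by (simp add: mult_left_le)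
    finally show "sqrt (Re ((M *\<^sub>v v) \<bullet>c (M *\<^sub>v v))) \<le> ?C"
      unfolding Re_scalar_prod_mult_vec[OF M v(1)] using B0 by (intro real_le_lsqrt) auto
  qed
qed

lemma mat_norm_nonneg: "M \<in> carrier_mat d d \<Longrightarrow> 0 \<le> mat_norm M"
  unfolding mat_norm_def
  by (rule cSUP_upper2[OF bdd_above_mat_norm, of _ _ "0\<^sub>v (dim_col M)"])
     (auto simp: Re_scalar_prod_conjugate)

lemma op_bound_mat_norm:
  assumes M: "M \<in> carrier_mat d d"
  shows "op_bound {..<d} {..<d} (\<lambda>x y. M $$ (x, y)) (mat_norm M)"
  unfolding op_bound_def
proof
  fix u :: "nat \<Rightarrow> complex"
  define S where "S = (\<Sum>y<d. (cmod (u y))\<^sup>2)"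
  have S0: "0 \<le> S" unfolding S_def by (intro sum_nonneg) auto
  show "(\<Sum>x<d. (cmod (\<Sum>y<d. M $$ (x, y) * u y))\<^sup>2) \<le> (mat_norm M)\<^sup>2 * (\<Sum>y<d. (cmod (u y))\<^sup>2)"
  proof (cases "S = 0")
    case True
    then have "u y = 0" if "y < d" for y
      using that unfolding S_def by (subst (asm) sum_nonneg_eq_0_iff) auto
    then show ?thesis using M by (simp add: sum_nonneg)
  next
    case False
    define v where "v = vec d (\<lambda>y. u y / complex_of_real (sqrt S))"
    have v: "v \<in> carrier_vec d" by (simp add: v_def)
    have n: "Re (v \<bullet>c v) = (\<Sum>y<d. (cmod (u y))\<^sup>2 / S)"
      using S0 by (simp add: Re_scalar_prod_conjugate v_def norm_divide power_divide)
    also have "\<dots> = 1" using False by (simp add: S_def flip: sum_divide_distrib)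
    finally have n: "Re (v \<bullet>c v) = 1" .
    have "sqrt (Re ((M *\<^sub>v v) \<bullet>c (M *\<^sub>v v))) \<le> mat_norm M"
      unfolding mat_norm_def
      by (rule cSUP_upper2[OF bdd_above_mat_norm[OF M], of v]) (use M v n in auto)
    then have "Re ((M *\<^sub>v v) \<bullet>c (M *\<^sub>v v)) \<le> (mat_norm M)\<^sup>2" by (rule sqrt_le_D)
    moreover have "Re ((M *\<^sub>v v) \<bullet>c (M *\<^sub>v v)) = (\<Sum>x<d. (cmod (\<Sum>y<d. M $$ (x, y) * u y))\<^sup>2) / S"
    proof -
      have "(\<Sum>y<d. M $$ (x, y) * v $ y) = (\<Sum>y<d. M $$ (x, y) * u y) / complex_of_real (sqrt S)" for x
        by (simp add: v_def sum_divide_distrib)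
      then show ?thesis unfolding Re_scalar_prod_mult_vec[OF M v] using S0
        by (simp add: norm_divide power_divide flip: sum_divide_distrib)
    qed
    ultimately show ?thesis using S0 False by (simp add: divide_le_eq flip: S_def)
  qed
qed

section \<open>Matrix functions in the inductive limit\<close>

definition cont_loop :: "nat \<Rightarrow> (real \<Rightarrow> nat \<Rightarrow> nat \<Rightarrow> complex) \<Rightarrow> bool" where
  "cont_loop d X \<longleftrightarrow> (\<forall>x<d. \<forall>y<d. continuous_on {0..1} (\<lambda>t. X t x y) \<and> X 0 x y = X 1 x y)"

lemma mat_fun_carrier: "cont_loop d X \<Longrightarrow> mat_fun d X \<in> carrier (circle_algebra d)"
proof -
  assume X: "cont_loop d X"
  have "continuous_on {0..1} (\<lambda>t. mat_fun d X t $$ (x, y))" if "x < d" "y < d" for x y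
  proof (rule continuous_on_eq)
    show "continuous_on {0..1} (\<lambda>t. X t x y)" using X that by (simp add: cont_loop_def)
  qed (use that in \<open>simp add: mat_fun_def\<close>)
  moreover have "mat_fun d X 0 = mat_fun d X 1"
    using X by (auto simp: mat_fun_def cont_loop_def intro!: cong_mat)
  ultimately show ?thesis by (auto simp: circle_algebra_def mat_fun_def)
qed

lemma carrier_mat_fun:
  assumes "f \<in> carrier (circle_algebra d)"
  obtains X where "cont_loop d X" "f = mat_fun d X"
proof
  show "cont_loop d (\<lambda>t x y. f t $$ (x, y))"
    using assms by (auto simp: cont_loop_def circle_algebra_def)
  show "f = mat_fun d (\<lambda>t x y. f t $$ (x, y))"
  proof
    fix t
    show "f t = mat_fun d (\<lambda>t x y. f t $$ (x, y)) t"
    proof (cases "t \<in> {0..1}")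
      case True
      then have "f t \<in> carrier_mat d d" using assms by (auto simp: circle_algebra_def)
      then show ?thesis using True by (auto simp: mat_fun_def intro!: eq_matI)
    next
      case False
      moreover have "f \<in> extensional {0..1}" using assms by (auto simp: circle_algebra_def PiE_def)
      ultimately have "f t = undefined" by (metis extensional_arb)
      then show ?thesis using False by (simp only: mat_fun_def restrict_def if_False)
    qed
  qed
qed

lemma mat_fun_cong:
  "(\<And>t x y. t \<in> {0..1} \<Longrightarrow> x < d \<Longrightarrow> y < d \<Longrightarrow> X t x y = Y t x y) \<Longrightarrow> mat_fun d X = mat_fun d Y"
  unfolding mat_fun_def by (rule restrict_ext, rule cong_mat) auto

lemma circle_algebra_ops:
  "mat_fun d X \<oplus>\<^bsub>circle_algebra d\<^esub> mat_fun d Y = mat_fun d (\<lambda>t x y. X t x y + Y t x y)"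
  "mat_fun d X \<otimes>\<^bsub>circle_algebra d\<^esub> mat_fun d Y = mat_fun d (\<lambda>t x y. \<Sum>z<d. X t x z * Y t z y)"
  "adj (circle_algebra d) (mat_fun d X) = mat_fun d (\<lambda>t x y. cnj (X t y x))"
  "r \<odot>\<^bsub>circle_algebra d\<^esub> mat_fun d X = mat_fun d (\<lambda>t x y. r * X t x y)"
  "\<one>\<^bsub>circle_algebra d\<^esub> = mat_fun d (\<lambda>t x y. if x = y then 1 else 0)"
proof -
  show "adj (circle_algebra d) (mat_fun d X) = mat_fun d (\<lambda>t x y. cnj (X t y x))"
  proof -
    have "mat_adjoint (mat d d (\<lambda>(x, y). X t x y)) = mat d d (\<lambda>(x, y). cnj (X t y x))" for t
    proof (rule eq_matI)
      fix x y assume "x < dim_row (mat d d (\<lambda>(x, y). cnj (X t y x)))" "y < dim_col (mat d d (\<lambda>(x, y). cnj (X t y x)))"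
      then show "mat_adjoint (mat d d (\<lambda>(x, y). X t x y)) $$ (x, y) = mat d d (\<lambda>(x, y). cnj (X t y x)) $$ (x, y)"
        by (subst mat_adjoint_index[of _ d d]) auto
    qed (auto simp: mat_adjoint_def)
    then show ?thesis by (auto simp: circle_algebra_def mat_fun_def)
  qed
qed (auto simp: circle_algebra_def mat_fun_def scalar_prod_def atLeast0LessThan intro!: restrict_ext eq_matI)

lemma norm_of_le:
  assumes "\<And>t. t \<in> {0..1} \<Longrightarrow> op_bound {..<d} {..<d} (X t) C" "0 \<le> C"
  shows "norm_of (circle_algebra d) (mat_fun d X) \<le> C"
proof -
  have "(SUP t\<in>{0..1}. mat_norm (mat_fun d X t)) \<le> C"
  proof (rule cSUP_least)
    fix t :: real assume t: "t \<in> {0..1}"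
    show "mat_norm (mat_fun d X t) \<le> C"
    proof (rule mat_norm_le)
      show "mat_fun d X t \<in> carrier_mat d d" using t by (simp add: mat_fun_def)
      show "op_bound {..<d} {..<d} (\<lambda>x y. mat_fun d X t $$ (x, y)) C"
        using assms(1)[OF t] t by (simp add: mat_fun_def op_bound_def)
    qed (rule assms)
  qed auto
  then show ?thesis by (simp add: circle_algebra_def)
qed

text \<open>Continuity of the entries bounds the matrix norms on \<open>[0,1]\<close>, so that the supremum in
  \<open>norm_of\<close> is an upper bound.\<close>

lemma op_bound_norm_of:
  assumes X: "cont_loop d X" and t: "t \<in> {0..1}"
  shows "op_bound {..<d} {..<d} (X t) (norm_of (circle_algebra d) (mat_fun d X))"
proof -
  have c: "mat_fun d X t \<in> carrier_mat d d" if "t \<in> {0..1}" for t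
    using that by (simp add: mat_fun_def)
  have "\<exists>B. \<forall>t\<in>{0..1}. cmod (X t x y) \<le> B" if "x < d" "y < d" for x y
  proof -
    have "continuous_on {0..1} (\<lambda>t. X t x y)" using X that by (auto simp: cont_loop_def)
    then have "bounded ((\<lambda>t. X t x y) ` {0..1})"
      by (intro compact_imp_bounded compact_continuous_image) auto
    then show ?thesis unfolding bounded_iff by auto
  qed
  then obtain B where B: "\<And>x y t. x < d \<Longrightarrow> y < d \<Longrightarrow> t \<in> {0..1} \<Longrightarrow> cmod (X t x y) \<le> B x y"
    by metis
  define B' where "B' = (\<Sum>x<d. \<Sum>y<d. \<bar>B x y\<bar>)"
  have B': "cmod (X t x y) \<le> B'" if "x < d" "y < d" "t \<in> {0..1}" for x y t
  proof -
    have "cmod (X t x y) \<le> \<bar>B x y\<bar>" using B[OF that] by simp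
    also have "\<dots> \<le> (\<Sum>y<d. \<bar>B x y\<bar>)"
      using that by (intro member_le_sum) auto
    also have "\<dots> \<le> B'" unfolding B'_def using that
      by (intro member_le_sum[where f = "\<lambda>x. \<Sum>y<d. \<bar>B x y\<bar>"]) (auto intro: sum_nonneg)
    finally show ?thesis .
  qed
  have B0: "0 \<le> B'" unfolding B'_def by (intro sum_nonneg) auto
  have "bdd_above ((\<lambda>t. mat_norm (mat_fun d X t)) ` {0..1})"
  proof (rule bdd_aboveI2)
    fix t :: real assume t: "t \<in> {0..1}"
    show "mat_norm (mat_fun d X t) \<le> real (card {..<d}) * real (card {..<d}) * B'"
    proof (rule mat_norm_le[OF c[OF t] op_bound_entries])
      fix x y assume "x \<in> {..<d}" "y \<in> {..<d}"
      then show "cmod (mat_fun d X t $$ (x, y)) \<le> B'" using B'[OF _ _ t] t by (simp add: mat_fun_def)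
    qed (use B0 in auto)
  qed
  then have le: "mat_norm (mat_fun d X t) \<le> norm_of (circle_algebra d) (mat_fun d X)"
    unfolding circle_algebra_def using t by (auto intro!: cSUP_upper)
  have "op_bound {..<d} {..<d} (\<lambda>x y. mat_fun d X t $$ (x, y)) (mat_norm (mat_fun d X t))"
    by (rule op_bound_mat_norm[OF c[OF t]])
  then have "op_bound {..<d} {..<d} (X t) (mat_norm (mat_fun d X t))"
    using t by (simp add: mat_fun_def op_bound_def)
  then show ?thesis by (rule op_bound_mono[OF _ mat_norm_nonneg[OF c[OF t]] le])
qed

section \<open>Moving frames for the iterated connecting maps\<close>

lemma side_in: "t \<in> {0..1} \<Longrightarrow> side \<sigma> t \<in> {0..1}"
  by (auto simp: side_def)

lemma continuous_on_side [continuous_intros]: "continuous_on A (side \<sigma>)"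
  by (cases \<sigma>) (auto simp: side_def[abs_def] intro!: continuous_intros)

definition make_row :: "nat \<Rightarrow> bool \<Rightarrow> nat \<Rightarrow> nat \<Rightarrow> nat" where
  "make_row h \<sigma> p y = (if \<sigma> then y div h else 1 - y div h) * (4 * h) + (if \<sigma> then 0 else 2 * h) + p * h + y mod h"

lemma make_row:
  assumes "0 < h" "p < 2" "y < 2 * h"
  shows "make_row h \<sigma> p y < 8 * h" "plus_row h (make_row h \<sigma> p y) = \<sigma>"
    "path_row h (make_row h \<sigma> p y) = p" "source_row h (make_row h \<sigma> p y) = y"
proof -
  define r where "r = y mod h"
  have r: "r < h" using assms by (simp add: r_def)
  have y: "y = (y div h) * h + r" "y div h < 2"
    using assms by (auto simp: r_def less_mult_imp_div_less)
  define q where "q = p * h + r"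
  have p: "p = 0 \<or> p = 1" using assms by auto
  have q: "q < 2 * h" "q div h = p" "q mod h = r" using p r by (auto simp: q_def)
  have yd: "y div h = 0 \<or> y div h = 1" using y(2) by auto
  define x where "x = make_row h \<sigma> p y"
  have xe: "x = (if \<sigma> then y div h else 1 - y div h) * (4 * h) + (if \<sigma> then 0 else 2 * h) + q"
    by (simp add: x_def make_row_def q_def r_def)
  have "x < 8 * h \<and> plus_row h x = \<sigma> \<and> path_row h x = p \<and> source_row h x = y"
  proof (cases \<sigma>)
    case True
    show ?thesis
    proof (cases "y div h = 0")
      case y0: True
      have "x = q" using True y0 by (simp add: xe)
      then show ?thesis using row_decode(1)[of h x] q y y0 True assms(1) by simp
    next
      case False
      then have y1: "y div h = 1" using yd by simp
      have "x = 4 * h + q" using True y1 by (simp add: xe)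
      then show ?thesis using row_decode(3)[of h x] q y y1 True assms(1) by simp
    qed
  next
    case False
    show ?thesis
    proof (cases "y div h = 0")
      case y0: True
      have "x = 6 * h + q" using False y0 by (simp add: xe)
      then show ?thesis using row_decode(4)[of h x] q y y0 False assms(1) by simp
    next
      case False
      then have y1: "y div h = 1" using yd by simp
      have "x = 2 * h + q" using \<open>\<not> \<sigma>\<close> y1 by (simp add: xe)
      then show ?thesis using row_decode(2)[of h x] q y y1 \<open>\<not> \<sigma>\<close> assms(1) by simp
    qed
  qed
  then show "make_row h \<sigma> p y < 8 * h" "plus_row h (make_row h \<sigma> p y) = \<sigma>"
    "path_row h (make_row h \<sigma> p y) = p" "source_row h (make_row h \<sigma> p y) = y"
    unfolding x_def by auto
qed

lemma row_parts:
  assumes "0 < h" "x < 8 * h"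
  shows "path_row h x < 2" "source_row h x < 2 * h"
    "make_row h (plus_row h x) (path_row h x) (source_row h x) = x"
proof -
  have four: "x < 2 * h \<or> 2 * h \<le> x \<and> x < 4 * h \<or> 4 * h \<le> x \<and> x < 6 * h \<or> 6 * h \<le> x" by linarith
  have m: "z mod h < h" "(z div h) * h + z mod h = z" for z using assms by auto
  have m': "h + z mod h < 2 * h" "z mod h < 2 * h" for z using m(1)[of z] by auto
  note R = row_decode[OF assms]
  show "path_row h x < 2" unfolding path_row_def by simp
  show "source_row h x < 2 * h" using four R m' by (elim disjE conjE) simp_all
  show "make_row h (plus_row h x) (path_row h x) (source_row h x) = x"
    using four
  proof (elim disjE conjE)
    assume a: "x < 2 * h"
    then show ?thesis using R(1)[OF a] m(2)[of x] assms(1) by (simp add: make_row_def)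
  next
    assume a: "2 * h \<le> x" "x < 4 * h"
    then show ?thesis using R(2)[OF a] m(2)[of "x - 2 * h"] assms(1) by (simp add: make_row_def)
  next
    assume a: "4 * h \<le> x" "x < 6 * h"
    then show ?thesis using R(3)[OF a] m(2)[of "x - 4 * h"] assms(1) by (simp add: make_row_def)
  next
    assume a: "6 * h \<le> x"
    then show ?thesis using R(4)[OF a] m(2)[of "x - 6 * h"] assms(1) by (simp add: make_row_def)
  qed
qed

lemma sum_rows:
  assumes "0 < h"
  shows "(\<Sum>x<8 * h. g x) = (\<Sum>\<sigma>\<in>UNIV. \<Sum>p<2. \<Sum>y<2 * h. g (make_row h \<sigma> p y))"
proof -
  have "(\<Sum>x<8 * h. g x) = (\<Sum>(\<sigma>, p, y)\<in>UNIV \<times> {..<2} \<times> {..<2 * h}. g (make_row h \<sigma> p y))"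
    by (rule sum.reindex_bij_witness[where i = "\<lambda>(\<sigma>, p, y). make_row h \<sigma> p y"
          and j = "\<lambda>x. (plus_row h x, path_row h x, source_row h x)"])
       (use assms in \<open>auto simp: make_row row_parts\<close>)
  then show ?thesis by (simp add: sum.cartesian_product split_def)
qed

text \<open>A word of signs records, the last map first, whether \<open>\<phi>\<^sup>+\<close>
  (\<open>True\<close>) or \<open>\<phi>\<^sup>-\<close> is used; its sign is the product, that is, the parity
  of the copy.\<close>

primrec sgn_word :: "bool list \<Rightarrow> bool" where
  "sgn_word [] = True"
| "sgn_word (\<sigma> # \<epsilon>) = (\<sigma> = sgn_word \<epsilon>)"

text \<open>Given a word, the \<open>2\<^sup>k\<close> choices of preimages under doubling are numbered by
  \<open>j\<close> such that the copy \<open>j\<close> evaluates at \<open>(t + j) / 2\<^sup>k\<close>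
  or, for an odd word, at \<open>(1 - t + j) / 2\<^sup>k\<close>. Then the preimage chosen for the last map is the lowest digit of
  \<open>j\<close>, complemented if the rest of the word reverses the circle.\<close>

definition digit :: "bool list \<Rightarrow> nat \<Rightarrow> nat" where
  "digit \<epsilon> j = (if sgn_word \<epsilon> then j mod 2 else 1 - j mod 2)"

definition point :: "bool list \<Rightarrow> nat \<Rightarrow> real \<Rightarrow> real" where
  "point \<epsilon> j t = (side (sgn_word \<epsilon>) t + real j) / 2 ^ length \<epsilon>"

text \<open>The vectors \<open>l < 4 ^ n\<close> of the copy \<open>(\<epsilon>, j)\<close> of
  \<open>A\<^sub>n\<close> inside the \<open>length \<epsilon>\<close>-fold image.\<close>

primrec frame :: "(real \<Rightarrow> complex mat) \<Rightarrow> nat \<Rightarrow> bool list \<Rightarrow> nat \<Rightarrow> nat \<Rightarrow> real \<Rightarrow> nat \<Rightarrow> complex" where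
  "frame c n [] j l t x = (if x = l then 1 else 0)"
| "frame c n (\<sigma> # \<epsilon>) j l t x =
     (let h = 4 ^ (n + length \<epsilon>) div 2; s = side \<sigma> t in
      if plus_row h x = \<sigma>
      then c s $$ (path_row h x, digit \<epsilon> j) *
           frame c n \<epsilon> (j div 2) l ((s + real (digit \<epsilon> j)) / 2) (source_row h x)
      else 0)"

primrec iterate :: "(real \<Rightarrow> complex mat) \<Rightarrow> nat \<Rightarrow> nat \<Rightarrow> (real \<Rightarrow> nat \<Rightarrow> nat \<Rightarrow> complex) \<Rightarrow>
    real \<Rightarrow> nat \<Rightarrow> nat \<Rightarrow> complex" where
  "iterate c n 0 X = X"
| "iterate c n (Suc k) X = step_entry c (4 ^ (n + k) div 2) (iterate c n k X)"

definition words :: "nat \<Rightarrow> bool list set" where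
  "words k = {\<epsilon>. length \<epsilon> = k}"

lemma finite_words [simp]: "finite (words k)"
  using finite_lists_length_eq[of "UNIV::bool set" k] by (simp add: words_def)

lemma words_0 [simp]: "words 0 = {[]}" by (auto simp: words_def)

lemma words_length: "\<epsilon> \<in> words k \<Longrightarrow> length \<epsilon> = k" by (simp add: words_def)

lemma sum_words_Suc: "(\<Sum>\<epsilon>\<in>words (Suc k). g \<epsilon>) = (\<Sum>\<sigma>\<in>UNIV. \<Sum>\<epsilon>\<in>words k. g (\<sigma> # \<epsilon>))"
proof -
  have "(\<Sum>\<epsilon>\<in>words (Suc k). g \<epsilon>) = (\<Sum>(\<sigma>, \<epsilon>)\<in>UNIV \<times> words k. g (\<sigma> # \<epsilon>))"
    by (rule sum.reindex_bij_witness[where i = "\<lambda>(\<sigma>, \<epsilon>). \<sigma> # \<epsilon>" and j = "\<lambda>\<epsilon>. (hd \<epsilon>, tl \<epsilon>)"])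
       (auto simp: words_def length_Suc_conv)
  then show ?thesis by (simp add: sum.cartesian_product)
qed

lemma digit_less_2 [simp]: "digit \<epsilon> j < 2"
  by (auto simp: digit_def)

lemma digit_inject: "digit \<epsilon> j = digit \<epsilon> j' \<Longrightarrow> j div 2 = j' div 2 \<Longrightarrow> j = j'"
proof -
  assume "digit \<epsilon> j = digit \<epsilon> j'" "j div 2 = j' div 2"
  then have "j mod 2 = j' mod 2" by (auto simp: digit_def split: if_splits)
  with \<open>j div 2 = j' div 2\<close> show "j = j'" by (metis div_mult_mod_eq)
qed

lemma sum_digit:
  "(\<Sum>j<2 ^ Suc k. g (digit \<epsilon> j) (j div 2)) = (\<Sum>i<2. \<Sum>j<2 ^ k. g i j)"
proof -
  have "(\<Sum>j<2 ^ k * 2. g (digit \<epsilon> j) (j div 2)) = (\<Sum>q<2 ^ k. \<Sum>j\<in>{q * 2..<q * 2 + 2}. g (digit \<epsilon> j) (j div 2))"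
    by (rule sum.nat_group[symmetric])
  also have "\<dots> = (\<Sum>q<2 ^ k. \<Sum>i<2. g i q)"
  proof (rule sum.cong[OF refl])
    fix q :: nat
    have s: "{q * 2..<q * 2 + 2} = {q * 2, q * 2 + 1}" "{..<2::nat} = {0, 1}" by auto
    have d: "(q * 2) mod 2 = 0" "(q * 2) div 2 = q" "(q * 2 + 1) mod 2 = 1" "(q * 2 + 1) div 2 = q"
      by presburger+
    show "(\<Sum>j\<in>{q * 2..<q * 2 + 2}. g (digit \<epsilon> j) (j div 2)) = (\<Sum>i<2. g i q)"
      unfolding s by (simp add: digit_def d add.commute del: One_nat_def)
  qed
  also have "\<dots> = (\<Sum>i<2. \<Sum>j<2 ^ k. g i j)" by (rule sum.swap)
  finally show ?thesis by (simp add: mult.commute)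
qed

text \<open>This recursion dictates the complement in \<open>digit\<close>: a reversing word turns
  \<open>s\<close> into \<open>1 - s\<close>.\<close>

lemma point_Cons:
  "point (\<sigma> # \<epsilon>) j t = point \<epsilon> (j div 2) ((side \<sigma> t + real (digit \<epsilon> j)) / 2)"
proof -
  define q r where "q = j div 2" and "r = j mod 2"
  have j: "real j = 2 * real q + real r" unfolding q_def r_def
    by (metis div_mult_mod_eq mult.commute of_nat_add of_nat_mult of_nat_numeral)
  have r: "r = 0 \<or> r = 1" unfolding r_def by auto
  show ?thesis
    using r unfolding point_def digit_def sgn_word.simps length_Cons q_def[symmetric] r_def[symmetric] j
    by (cases \<sigma>; cases "sgn_word \<epsilon>") (auto simp: side_def field_simps)
qed

lemma point_in:
  assumes "t \<in> {0..1}" "j < 2 ^ length \<epsilon>"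
  shows "point \<epsilon> j t \<in> {0..1}"
proof -
  have "real j + 1 \<le> 2 ^ length \<epsilon>" using assms(2)
    by (metis Suc_leI add.commute of_nat_Suc of_nat_le_iff of_nat_numeral of_nat_power)
  moreover have "side (sgn_word \<epsilon>) t \<in> {0..1}" using side_in[OF assms(1)] .
  ultimately show ?thesis by (auto simp: point_def field_simps)
qed

lemma side_digit_in: "t \<in> {0..1} \<Longrightarrow> i < 2 \<Longrightarrow> (side \<sigma> t + real i) / 2 \<in> {0..1}"
  using side_in[of t \<sigma>] by auto

lemma half_power: "n \<ge> 1 \<Longrightarrow> 4 ^ n = 2 * (4 ^ n div 2 :: nat)" "n \<ge> 1 \<Longrightarrow> 0 < (4 ^ n div 2 :: nat)"
  by (cases n; simp)+

text \<open>The frame diagonalizes the iterated map: in it \<open>\<psi>\<^sup>k(X)(t)\<close> is the block diagonal matrix of the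
  values of \<open>X\<close> at the points \<open>(t + j) / 2\<^sup>k\<close> and \<open>(1 - t + j) / 2\<^sup>k\<close>.\<close>

lemma iterate_eq_frame:
  assumes n: "n \<ge> 1" and x: "x < 4 ^ (n + k)" and y: "y < 4 ^ (n + k)"
  shows "iterate c n k X t x y = (\<Sum>\<epsilon>\<in>words k. \<Sum>j<2 ^ k. \<Sum>l<4 ^ n. \<Sum>l'<4 ^ n.
     frame c n \<epsilon> j l t x * X (point \<epsilon> j t) l l' * cnj (frame c n \<epsilon> j l' t y))"
  using x y
proof (induction k arbitrary: t x y)
  case 0
  have "(\<Sum>l'<4 ^ n. X t x l' * cnj (if y = l' then 1 else 0)) = (\<Sum>l'<4 ^ n. if y = l' then X t x l' else 0)"
    by (intro sum.cong) auto
  also have "\<dots> = X t x y" using 0 by simp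
  finally have 1: "(\<Sum>l'<4 ^ n. X t x l' * cnj (if y = l' then 1 else 0)) = X t x y" .
  have "(\<Sum>l<4 ^ n. \<Sum>l'<4 ^ n. (if x = l then 1 else 0) * X t l l' * cnj (if y = l' then 1 else 0)) =
     (\<Sum>l<4 ^ n. if x = l then (\<Sum>l'<4 ^ n. X t l l' * cnj (if y = l' then 1 else 0)) else 0)"
    by (intro sum.cong) auto
  also have "\<dots> = X t x y" using 0 1 by simp
  finally show ?case by (simp add: point_def side_def)
next
  case (Suc k)
  define h where "h = (4::nat) ^ (n + k) div 2"
  have h: "4 ^ (n + k) = 2 * h" "0 < h" using half_power[of "n + k"] n by (auto simp: h_def)
  have xy: "x < 8 * h" "y < 8 * h" using Suc.prems h by auto
  define \<sigma>0 where "\<sigma>0 = plus_row h x"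
  let ?T = "\<lambda>\<epsilon> j l l'. frame c n \<epsilon> j l t x * X (point \<epsilon> j t) l l' * cnj (frame c n \<epsilon> j l' t y)"
  have other: "?T (\<sigma> # \<epsilon>) j l l' = 0" if "\<sigma> \<noteq> plus_row h x \<or> \<sigma> \<noteq> plus_row h y" "\<epsilon> \<in> words k" for \<sigma> \<epsilon> j l l'
    using that by (auto simp: words_length h_def Let_def)
  show ?case
  proof (cases "plus_row h x = plus_row h y")
    case False
    have "(\<Sum>\<epsilon>\<in>words (Suc k). \<Sum>j<2 ^ Suc k. \<Sum>l<4 ^ n. \<Sum>l'<4 ^ n. ?T \<epsilon> j l l') = 0"
      unfolding sum_words_Suc
    proof (intro sum.neutral ballI)
      fix \<sigma> \<epsilon> j l l' assume "\<epsilon> \<in> words k"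
      then show "?T (\<sigma> # \<epsilon>) j l l' = 0" by (intro other) (use False in auto)
    qed
    then show ?thesis using False by (simp add: step_entry_def flip: h_def)
  next
    case True
    define s where "s = side \<sigma>0 t"
    let ?G = "\<lambda>\<epsilon> i j. \<Sum>l<4 ^ n. \<Sum>l'<4 ^ n. c s $$ (path_row h x, i) *
        (frame c n \<epsilon> j l ((s + real i) / 2) (source_row h x) * X (point \<epsilon> j ((s + real i) / 2)) l l' *
         cnj (frame c n \<epsilon> j l' ((s + real i) / 2) (source_row h y))) * cnj (c s $$ (path_row h y, i))"
    have src: "source_row h x < 4 ^ (n + k)" "source_row h y < 4 ^ (n + k)"
      using row_parts(2)[OF h(2) xy(1)] row_parts(2)[OF h(2) xy(2)] h(1) by auto
    have "(\<Sum>\<epsilon>\<in>words (Suc k). \<Sum>j<2 ^ Suc k. \<Sum>l<4 ^ n. \<Sum>l'<4 ^ n. ?T \<epsilon> j l l') =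
       (\<Sum>\<epsilon>\<in>words k. \<Sum>j<2 ^ Suc k. \<Sum>l<4 ^ n. \<Sum>l'<4 ^ n. ?T (\<sigma>0 # \<epsilon>) j l l')"
    proof -
      have z: "(\<Sum>\<epsilon>\<in>words k. \<Sum>j<2 ^ Suc k. \<Sum>l<4 ^ n. \<Sum>l'<4 ^ n. ?T (\<sigma> # \<epsilon>) j l l') = 0" if "\<sigma> \<noteq> \<sigma>0" for \<sigma>
      proof (intro sum.neutral ballI)
        fix \<epsilon> j l l' assume "\<epsilon> \<in> words k"
        then show "?T (\<sigma> # \<epsilon>) j l l' = 0" by (intro other) (use that in \<open>auto simp: \<sigma>0_def\<close>)
      qed
      show ?thesis unfolding sum_words_Suc UNIV_bool using z[of "\<not> \<sigma>0"] by (cases \<sigma>0) simp_all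
    qed
    also have "\<dots> = (\<Sum>\<epsilon>\<in>words k. \<Sum>j<2 ^ Suc k. ?G \<epsilon> (digit \<epsilon> j) (j div 2))"
      by (intro sum.cong refl)
         (simp add: words_length point_Cons Let_def True[symmetric] \<sigma>0_def s_def mult_ac flip: h_def)
    also have "\<dots> = (\<Sum>\<epsilon>\<in>words k. \<Sum>i<2. \<Sum>j<2 ^ k. ?G \<epsilon> i j)"
      by (intro sum.cong refl sum_digit)
    also have "\<dots> = (\<Sum>i<2. \<Sum>\<epsilon>\<in>words k. \<Sum>j<2 ^ k. ?G \<epsilon> i j)" by (rule sum.swap)
    also have "\<dots> = (\<Sum>i<2. c s $$ (path_row h x, i) * iterate c n k X ((s + real i) / 2) (source_row h x) (source_row h y)
            * cnj (c s $$ (path_row h y, i)))"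
      by (simp only: Suc.IH[OF src] sum_distrib_left sum_distrib_right)
    also have "\<dots> = iterate c n (Suc k) X t x y"
      using True by (simp add: step_entry_def s_def \<sigma>0_def Let_def flip: h_def)
    finally show ?thesis by simp
  qed
qed

definition row_sign :: "nat \<Rightarrow> nat \<Rightarrow> complex" where
  "row_sign n x = (if x < 4 ^ n div 2 then 1 else - 1)"

definition bool_sign :: "bool \<Rightarrow> complex" where
  "bool_sign b = (if b then 1 else - 1)"

text \<open>The sign on the left is that of \<open>u\<^bsub>n+1\<^esub>\<close>, those on the right are the
  parity of the copy and the sign of \<open>u\<^sub>n\<close>.\<close>

lemma row_sign_step:
  assumes "n \<ge> 1" "x < 4 ^ Suc n"
  shows "row_sign (Suc n) x = bool_sign (plus_row (4 ^ n div 2) x) * row_sign n (source_row (4 ^ n div 2) x)"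
proof -
  define h where "h = (4::nat) ^ n div 2"
  have h: "4 ^ n = 2 * h" "0 < h" using half_power[of n] assms by (auto simp: h_def)
  have x: "x < 8 * h" using assms h by simp
  have four: "x < 2 * h \<or> 2 * h \<le> x \<and> x < 4 * h \<or> 4 * h \<le> x \<and> x < 6 * h \<or> 6 * h \<le> x" by linarith
  show ?thesis unfolding row_sign_def bool_sign_def h_def[symmetric]
    using four row_decode[OF h(2) x] h by (elim disjE conjE) (simp_all add: h(1))
qed

lemma frame_sign:
  assumes "n \<ge> 1" "x < 4 ^ (n + length \<epsilon>)" "l < 4 ^ n"
  shows "row_sign (n + length \<epsilon>) x * frame c n \<epsilon> j l t x =
     bool_sign (sgn_word \<epsilon>) * row_sign n l * frame c n \<epsilon> j l t x"
  using assms(2)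
proof (induction \<epsilon> arbitrary: j t x)
  case Nil
  then show ?case by (simp add: bool_sign_def)
next
  case (Cons \<sigma> \<epsilon>)
  define h where "h = (4::nat) ^ (n + length \<epsilon>) div 2"
  have h: "4 ^ (n + length \<epsilon>) = 2 * h" "0 < h" using half_power[of "n + length \<epsilon>"] assms by (auto simp: h_def)
  have x: "x < 8 * h" using Cons.prems h by simp
  have src: "source_row h x < 4 ^ (n + length \<epsilon>)" using row_parts(2)[OF h(2) x] h by simp
  have r: "row_sign (n + length (\<sigma> # \<epsilon>)) x = bool_sign (plus_row h x) * row_sign (n + length \<epsilon>) (source_row h x)"
    using row_sign_step[of "n + length \<epsilon>" x] assms Cons.prems by (simp add: h_def)
  show ?case
  proof (cases "plus_row h x = \<sigma>")
    case True
    let ?i = "digit \<epsilon> j" let ?s = "side \<sigma> t"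
    have f: "frame c n (\<sigma> # \<epsilon>) j l t x = c ?s $$ (path_row h x, ?i) * frame c n \<epsilon> (j div 2) l ((?s + real ?i) / 2) (source_row h x)"
      using True by (simp add: Let_def flip: h_def)
    have "row_sign (n + length (\<sigma> # \<epsilon>)) x * frame c n (\<sigma> # \<epsilon>) j l t x = bool_sign \<sigma> * c ?s $$ (path_row h x, ?i) *
       (row_sign (n + length \<epsilon>) (source_row h x) * frame c n \<epsilon> (j div 2) l ((?s + real ?i) / 2) (source_row h x))"
      unfolding r f True by (simp add: mult_ac)
    also have "\<dots> = bool_sign \<sigma> * c ?s $$ (path_row h x, ?i) *
       (bool_sign (sgn_word \<epsilon>) * row_sign n l * frame c n \<epsilon> (j div 2) l ((?s + real ?i) / 2) (source_row h x))"
      unfolding Cons.IH[OF src] ..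
    also have "\<dots> = bool_sign \<sigma> * bool_sign (sgn_word \<epsilon>) * row_sign n l * frame c n (\<sigma> # \<epsilon>) j l t x"
      unfolding f by (simp add: mult_ac)
    also have "bool_sign \<sigma> * bool_sign (sgn_word \<epsilon>) = bool_sign (sgn_word (\<sigma> # \<epsilon>))"
      by (auto simp: bool_sign_def)
    finally show ?thesis .
  next
    case False
    then show ?thesis by (simp add: Let_def flip: h_def)
  qed
qed

locale swap_path_locale =
  fixes c :: "real \<Rightarrow> complex mat"
  assumes swap_path: "swap_path c"
begin

lemma c_carrier: "t \<in> {0..1} \<Longrightarrow> c t \<in> carrier_mat 2 2"
  using swap_path by (auto simp: swap_path_def)

lemma c_unitary:
  assumes t: "t \<in> {0..1}" and i: "i < 2" "i' < 2"
  shows "(\<Sum>p<2. c t $$ (p, i) * cnj (c t $$ (p, i'))) = (if i = i' then 1 else 0)"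
proof -
  have u: "mat_adjoint (c t) * c t = 1\<^sub>m 2"
    using swap_path t by (auto simp: swap_path_def)
  note C = c_carrier[OF t] mat_adjoint_carrier[OF c_carrier[OF t]]
  have "(mat_adjoint (c t) * c t) $$ (i', i) = (\<Sum>p<2. c t $$ (p, i) * cnj (c t $$ (p, i')))"
    using C i by (auto simp: scalar_prod_def atLeast0LessThan mat_adjoint_index[OF C(1)] intro!: sum.cong)
  then show "(\<Sum>p<2. c t $$ (p, i) * cnj (c t $$ (p, i'))) = (if i = i' then 1 else 0)"
    unfolding u using i by auto
qed

lemma c_swap: "p < 2 \<Longrightarrow> i < 2 \<Longrightarrow> c 1 $$ (p, i) = c 0 $$ (p, 1 - i)"
proof -
  assume "p < 2" "i < 2"
  then have "p = 0 \<or> p = 1" "i = 0 \<or> i = 1" by auto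
  moreover have "c 0 = 1\<^sub>m 2" "c 1 = mat_of_rows_list 2 [[0, 1], [1, 0]]"
    using swap_path by (auto simp: swap_path_def)
  ultimately show ?thesis by (auto simp: mat_of_rows_list_def)
qed

lemma c_continuous: "p < 2 \<Longrightarrow> i < 2 \<Longrightarrow> continuous_on {0..1} (\<lambda>t. c t $$ (p, i))"
  using swap_path by (auto simp: swap_path_def)

lemma c_continuous_side: "p < 2 \<Longrightarrow> i < 2 \<Longrightarrow> continuous_on {0..1} (\<lambda>t. c (side \<sigma> t) $$ (p, i))"
  by (rule continuous_on_compose2[OF c_continuous[of p i]])
     (use side_in in \<open>auto intro!: continuous_intros\<close>)

lemma frame_orthonormal:
  assumes n: "n \<ge> 1" and "length \<epsilon> = k" "length \<epsilon>' = k" "l < 4 ^ n" "l' < 4 ^ n" "t \<in> {0..1}"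
    "j < 2 ^ k" "j' < 2 ^ k"
  shows "(\<Sum>x<4 ^ (n + k). frame c n \<epsilon> j l t x * cnj (frame c n \<epsilon>' j' l' t x)) =
     (if \<epsilon> = \<epsilon>' \<and> j = j' \<and> l = l' then 1 else 0)"
  using assms(2,3,6-)
proof (induction k arbitrary: \<epsilon> \<epsilon>' j j' t)
  case 0
  have "(\<Sum>x<4 ^ n. (if x = l then 1 else 0) * cnj (if x = l' then 1 else 0)) = (\<Sum>x<4 ^ n. if x = l then (if l = l' then 1 else (0::complex)) else 0)"
    by (intro sum.cong) auto
  then show ?case using 0 assms(4) by (simp add: sum.delta')
next
  case (Suc k)
  obtain \<sigma> \<epsilon>1 \<sigma>' \<epsilon>1' where e: "\<epsilon> = \<sigma> # \<epsilon>1" "\<epsilon>' = \<sigma>' # \<epsilon>1'" "length \<epsilon>1 = k" "length \<epsilon>1' = k"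
    using Suc.prems by (auto simp: length_Suc_conv)
  define h where "h = (4::nat) ^ (n + k) div 2"
  have h: "4 ^ (n + k) = 2 * h" "0 < h" using half_power[of "n + k"] n by (auto simp: h_def)
  define i i' where "i = digit \<epsilon>1 j" and "i' = digit \<epsilon>1' j'"
  have i: "i < 2" "i' < 2" by (simp_all add: i_def i'_def)
  define s where "s = side \<sigma> t"
  have s: "s \<in> {0..1}" using side_in Suc.prems by (simp add: s_def)
  show ?case
  proof (cases "\<sigma> = \<sigma>'")
    case False
    then have "(\<Sum>x<4 ^ (n + Suc k). frame c n \<epsilon> j l t x * cnj (frame c n \<epsilon>' j' l' t x)) = 0"
      by (intro sum.neutral) (auto simp: e Let_def simp flip: h_def)
    then show ?thesis using False e by auto
  next
    case True
    let ?F = "\<lambda>y. frame c n \<epsilon>1 (j div 2) l ((s + real i) / 2) y * cnj (frame c n \<epsilon>1' (j' div 2) l' ((s + real i') / 2) y)"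
    have "(\<Sum>x<4 ^ (n + Suc k). frame c n \<epsilon> j l t x * cnj (frame c n \<epsilon>' j' l' t x)) =
       (\<Sum>\<tau>\<in>UNIV. \<Sum>p<2. \<Sum>y<2 * h. frame c n \<epsilon> j l t (make_row h \<tau> p y) * cnj (frame c n \<epsilon>' j' l' t (make_row h \<tau> p y)))"
      using sum_rows[OF h(2)] h(1) by simp
    also have "\<dots> = (\<Sum>\<tau>\<in>UNIV. if \<tau> = \<sigma> then (\<Sum>p<2. \<Sum>y<2 * h. c s $$ (p, i) * cnj (c s $$ (p, i')) * ?F y) else 0)"
    proof (rule sum.cong[OF refl])
      fix \<tau> :: bool
      have "frame c n \<epsilon> j l t (make_row h \<tau> p y) * cnj (frame c n \<epsilon>' j' l' t (make_row h \<tau> p y)) =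
         (if \<tau> = \<sigma> then c s $$ (p, i) * cnj (c s $$ (p, i')) * ?F y else 0)" if "p < 2" "y < 2 * h" for p y
      proof (cases "\<tau> = \<sigma>")
        case t: True
        show ?thesis unfolding t using make_row[OF h(2) that, of \<sigma>] True e
          by (simp add: Let_def i_def i'_def s_def mult_ac flip: h_def)
      next
        case False
        then show ?thesis using make_row[OF h(2) that, of \<tau>] True e
          by (simp add: Let_def flip: h_def)
      qed
      then show "(\<Sum>p<2. \<Sum>y<2 * h. frame c n \<epsilon> j l t (make_row h \<tau> p y) * cnj (frame c n \<epsilon>' j' l' t (make_row h \<tau> p y))) =
        (if \<tau> = \<sigma> then (\<Sum>p<2. \<Sum>y<2 * h. c s $$ (p, i) * cnj (c s $$ (p, i')) * ?F y) else 0)"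
        by simp
    qed
    also have "\<dots> = (\<Sum>p<2. \<Sum>y<2 * h. c s $$ (p, i) * cnj (c s $$ (p, i')) * ?F y)" by (simp add: sum.delta')
    also have "\<dots> = (\<Sum>p<2. c s $$ (p, i) * cnj (c s $$ (p, i'))) * (\<Sum>y<2 * h. ?F y)"
      by (simp add: sum_product)
    also have "\<dots> = (if i = i' then (\<Sum>y<4 ^ (n + k). ?F y) else 0)"
      unfolding c_unitary[OF s i] h(1) by simp
    also have "\<dots> = (if i = i' \<and> \<epsilon>1 = \<epsilon>1' \<and> j div 2 = j' div 2 \<and> l = l' then 1 else 0)"
    proof (cases "i = i'")
      case ii: True
      have jj: "j div 2 < 2 ^ k" "j' div 2 < 2 ^ k" using Suc.prems by (auto simp: less_mult_imp_div_less)
      have "(s + real i) / 2 \<in> {0..1}" using s i by auto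
      from Suc.IH[OF e(3,4) this jj] show ?thesis using ii by simp
    qed simp
    also have "(i = i' \<and> \<epsilon>1 = \<epsilon>1' \<and> j div 2 = j' div 2 \<and> l = l') = (\<epsilon> = \<epsilon>' \<and> j = j' \<and> l = l')"
      using True e digit_inject[of \<epsilon>1 j j'] by (auto simp: i_def i'_def)
    finally show ?thesis .
  qed
qed

text \<open>Adding \<open>1\<close> to \<open>j\<close> is addition with carry. If the lowest digit does not
  overflow, the end of one half of the circle is the beginning of the other half, and \<open>c\<close> swaps
  the two blocks; an overflow is carried to the shorter word.\<close>

lemma frame_monodromy:
  assumes n: "n \<ge> 1" and "length \<epsilon> = k" "j < 2 ^ k" "x < 4 ^ (n + k)"
  shows "frame c n \<epsilon> j l (side (sgn_word \<epsilon>) 1) x = frame c n \<epsilon> ((j + 1) mod 2 ^ k) l (side (sgn_word \<epsilon>) 0) x"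
  using assms(2-)
proof (induction k arbitrary: \<epsilon> j x)
  case (Suc k)
  obtain \<sigma> \<epsilon>1 where e: "\<epsilon> = \<sigma> # \<epsilon>1" "length \<epsilon>1 = k"
    using Suc.prems by (auto simp: length_Suc_conv)
  define h where "h = (4::nat) ^ (n + k) div 2"
  have h: "4 ^ (n + k) = 2 * h" "0 < h" using half_power[of "n + k"] n by (auto simp: h_def)
  have x: "x < 8 * h" using Suc.prems h by simp
  define p where "p = path_row h x"
  define y where "y = source_row h x"
  have y: "y < 4 ^ (n + k)" using row_parts(2)[OF h(2) x] h by (simp add: y_def)
  have p: "p < 2" unfolding p_def by (rule row_parts(1)[OF h(2) x])
  define P where "P = sgn_word \<epsilon>1"
  have s: "side \<sigma> (side (sgn_word \<epsilon>) t) = side P t" for t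
    by (cases \<sigma>; cases "sgn_word \<epsilon>1") (auto simp: e P_def side_def)
  define j' where "j' = (j + 1) mod 2 ^ Suc k"
  have F: "frame c n \<epsilon> j l (side (sgn_word \<epsilon>) t) x = (if plus_row h x = \<sigma> then c (side P t) $$ (p, digit \<epsilon>1 j) *
       frame c n \<epsilon>1 (j div 2) l ((side P t + real (digit \<epsilon>1 j)) / 2) y else 0)" for j t
    using s[of t] by (simp add: e Let_def p_def y_def flip: h_def)
  have IH: "frame c n \<epsilon>1 i l (side P 1) y = frame c n \<epsilon>1 ((i + 1) mod 2 ^ k) l (side P 0) y" if "i < 2 ^ k" for i
    using Suc.IH[OF e(2) that y] by (simp add: P_def)
  have "c (side P 1) $$ (p, digit \<epsilon>1 j) * frame c n \<epsilon>1 (j div 2) l ((side P 1 + real (digit \<epsilon>1 j)) / 2) y =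
     c (side P 0) $$ (p, digit \<epsilon>1 j') * frame c n \<epsilon>1 (j' div 2) l ((side P 0 + real (digit \<epsilon>1 j')) / 2) y"
  proof (cases "even j")
    case True
    have "j + 1 < 2 ^ Suc k" using True Suc.prems
      by (metis Suc_eq_plus1 Suc_lessI even_Suc even_power even_numeral zero_less_Suc)
    then have j': "j' = j + 1" by (simp add: j'_def)
    have "j' div 2 = j div 2" "j' mod 2 = 1" "j mod 2 = 0" using True by (auto simp: j' even_iff_mod_2_eq_zero)
    then show ?thesis using c_swap[OF p, of 0] c_swap[OF p, of 1]
      by (cases P) (simp_all add: digit_def side_def flip: P_def)
  next
    case False
    have m: "j mod 2 = 1" using False by (simp add: odd_iff_mod_2_eq_one)
    have j1: "j div 2 < 2 ^ k" using Suc.prems by (auto simp: less_mult_imp_div_less)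
    have j2: "j + 1 = (j div 2 + 1) * 2" using m by (metis add_mult_distrib add.assoc div_mult_mod_eq mult_1 one_add_one)
    have "j' = ((j div 2 + 1) mod 2 ^ k) * 2" unfolding j'_def j2
      by (simp only: power_Suc2 mult_mod_left)
    then have "j' div 2 = (j div 2 + 1) mod 2 ^ k" "j' mod 2 = 0" by auto
    then show ?thesis using c_swap[OF p, of 0] c_swap[OF p, of 1] IH[OF j1] m
      by (cases P) (simp_all add: digit_def side_def flip: P_def)
  qed
  then show ?case unfolding F j'_def[symmetric] by simp
qed simp

lemma frame_continuous:
  assumes n: "n \<ge> 1" and "x < 4 ^ (n + length \<epsilon>)"
  shows "continuous_on {0..1} (\<lambda>t. frame c n \<epsilon> j l t x)"
  using assms(2)
proof (induction \<epsilon> arbitrary: j x)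
  case (Cons \<sigma> \<epsilon>)
  define h where "h = (4::nat) ^ (n + length \<epsilon>) div 2"
  have h: "4 ^ (n + length \<epsilon>) = 2 * h" "0 < h" using half_power[of "n + length \<epsilon>"] assms by (auto simp: h_def)
  have x: "x < 8 * h" using Cons.prems h by simp
  have src: "source_row h x < 4 ^ (n + length \<epsilon>)" using row_parts(2)[OF h(2) x] h by simp
  have "continuous_on {0..1} (\<lambda>t. frame c n \<epsilon> (j div 2) l ((side \<sigma> t + real (digit \<epsilon> j)) / 2) (source_row h x))"
    by (rule continuous_on_compose2[OF Cons.IH[OF src]])
       (use side_digit_in in \<open>auto intro!: continuous_intros simp del: atLeastAtMost_iff\<close>)
  moreover have "continuous_on {0..1} (\<lambda>t. c (side \<sigma> t) $$ (path_row h x, digit \<epsilon> j))"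
    by (rule c_continuous_side) (use row_parts[OF h(2) x] in auto)
  ultimately show ?case
    by (cases "plus_row h x = \<sigma>") (auto simp: Let_def h_def[symmetric] intro!: continuous_intros)
qed simp

lemma step_entry_loop:
  assumes n: "n \<ge> 1" and X: "cont_loop (4 ^ n) X"
  shows "cont_loop (4 ^ Suc n) (step_entry c (4 ^ n div 2) X)"
proof -
  define h where "h = (4::nat) ^ n div 2"
  have h: "4 ^ n = 2 * h" "0 < h" using half_power[of n] n by (auto simp: h_def)
  have "continuous_on {0..1} (\<lambda>t. step_entry c h X t x y) \<and> step_entry c h X 0 x y = step_entry c h X 1 x y"
    if x: "x < 8 * h" and y: "y < 8 * h" for x y
  proof
    note rx = row_parts(1,2)[OF h(2) x] note ry = row_parts(1,2)[OF h(2) y]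
    have Xc: "continuous_on {0..1} (\<lambda>t. X t (source_row h x) (source_row h y))"
      and X01: "X 0 (source_row h x) (source_row h y) = X 1 (source_row h x) (source_row h y)"
      using X rx ry h by (auto simp: cont_loop_def)
    have "continuous_on {0..1} (\<lambda>t. X ((side \<sigma> t + real i) / 2) (source_row h x) (source_row h y))" if "i < 2" for \<sigma> i
      by (rule continuous_on_compose2[OF Xc])
         (use that side_digit_in in \<open>auto intro!: continuous_intros simp del: atLeastAtMost_iff\<close>)
    then show "continuous_on {0..1} (\<lambda>t. step_entry c h X t x y)"
      unfolding step_entry_def Let_def
      by (cases "plus_row h x = plus_row h y")
         (auto intro!: continuous_intros c_continuous_side rx ry)
    show "step_entry c h X 0 x y = step_entry c h X 1 x y"
      using c_swap[OF rx(1), of 0] c_swap[OF rx(1), of 1] c_swap[OF ry(1), of 0] c_swap[OF ry(1), of 1] X01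
      by (auto simp: step_entry_def Let_def side_def lessThan_nat_numeral eval_nat_numeral)
  qed
  moreover have "4 ^ Suc n = 8 * h" using h(1) by simp
  ultimately show ?thesis unfolding cont_loop_def by (simp only: flip: h_def) blast
qed

end

section \<open>Orthonormal families\<close>

definition orthonormal :: "'i set \<Rightarrow> 'x set \<Rightarrow> ('i \<Rightarrow> 'x \<Rightarrow> complex) \<Rightarrow> bool" where
  "orthonormal I J U \<longleftrightarrow> (\<forall>\<mu>\<in>I. \<forall>\<nu>\<in>I. (\<Sum>x\<in>J. U \<mu> x * cnj (U \<nu> x)) = (if \<mu> = \<nu> then 1 else 0))"

text \<open>As many orthonormal vectors as dimensions form a basis; in terms of matrices, left inverses of
  square matrices are right inverses.\<close>

lemma square_orthonormal_complete:
  assumes "finite I" "finite J" "card I = card J" "orthonormal I J U" "x \<in> J" "y \<in> J"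
  shows "(\<Sum>\<mu>\<in>I. U \<mu> x * cnj (U \<mu> y)) = (if x = y then 1 else 0)"
proof -
  define d where "d = card J"
  obtain f where f: "bij_betw f {..<d} I" using assms by (metis d_def ex_bij_betw_nat_finite atLeast0LessThan)
  obtain g where g: "bij_betw g {..<d} J" using assms by (metis d_def ex_bij_betw_nat_finite atLeast0LessThan)
  define A where "A = mat d d (\<lambda>(a, b). U (f a) (g b))"
  define B where "B = mat d d (\<lambda>(a, b). cnj (U (f b) (g a)))"
  have AB: "A \<in> carrier_mat d d" "B \<in> carrier_mat d d" by (auto simp: A_def B_def)
  have fI: "f a \<in> I" if "a < d" for a using f that by (auto simp: bij_betw_def)
  have fi: "f a = f b \<longleftrightarrow> a = b" if "a < d" "b < d" for a b using f that by (auto simp: bij_betw_def inj_on_def)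
  have gi: "g a = g b \<longleftrightarrow> a = b" if "a < d" "b < d" for a b using g that by (auto simp: bij_betw_def inj_on_def)
  have "A * B = 1\<^sub>m d"
  proof (rule eq_matI)
    fix a b assume "a < dim_row (1\<^sub>m d :: complex mat)" "b < dim_col (1\<^sub>m d :: complex mat)"
    then have ab: "a < d" "b < d" by auto
    have "(A * B) $$ (a, b) = (\<Sum>k<d. U (f a) (g k) * cnj (U (f b) (g k)))"
      using ab by (simp add: A_def B_def scalar_prod_def atLeast0LessThan)
    also have "\<dots> = (\<Sum>x\<in>J. U (f a) x * cnj (U (f b) x))" by (rule sum.reindex_bij_betw[OF g])
    also have "\<dots> = (if f a = f b then 1 else 0)" using assms(4) fI ab by (simp add: orthonormal_def)
    finally show "(A * B) $$ (a, b) = 1\<^sub>m d $$ (a, b)" using ab by (simp add: fi)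
  qed (auto simp: A_def B_def)
  then have BA: "B * A = 1\<^sub>m d" using mat_mult_left_right_inverse AB by blast
  obtain a b where ab: "a < d" "b < d" "g a = x" "g b = y" using g assms(5,6) by (auto simp: bij_betw_def image_iff)
  have "(\<Sum>\<mu>\<in>I. U \<mu> x * cnj (U \<mu> y)) = (\<Sum>k<d. U (f k) x * cnj (U (f k) y))"
    by (rule sum.reindex_bij_betw[OF f, symmetric])
  also have "\<dots> = (B * A) $$ (b, a)"
    using ab by (simp add: A_def B_def scalar_prod_def atLeast0LessThan mult.commute)
  also have "\<dots> = (if x = y then 1 else 0)" unfolding BA using ab gi[of a b] by auto
  finally show ?thesis .
qed

lemma isometry_norm:
  assumes "\<And>y y'. y \<in> J \<Longrightarrow> y' \<in> J \<Longrightarrow> (\<Sum>x\<in>I. A x y * cnj (A x y')) = (if y = y' then 1 else 0)"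
    "finite J"
  shows "(\<Sum>x\<in>I. (cmod (\<Sum>y\<in>J. A x y * u y))\<^sup>2) = (\<Sum>y\<in>J. (cmod (u y))\<^sup>2)"
proof -
  have "complex_of_real (\<Sum>x\<in>I. (cmod (\<Sum>y\<in>J. A x y * u y))\<^sup>2) =
      (\<Sum>x\<in>I. (\<Sum>y\<in>J. A x y * u y) * (\<Sum>y'\<in>J. cnj (A x y') * cnj (u y')))"
    by (simp only: of_real_sum complex_norm_square cnj_sum complex_cnj_mult)
  also have "\<dots> = (\<Sum>x\<in>I. \<Sum>y\<in>J. \<Sum>y'\<in>J. u y * cnj (u y') * (A x y * cnj (A x y')))"
    by (simp add: sum_product mult_ac)
  also have "\<dots> = (\<Sum>y\<in>J. \<Sum>x\<in>I. \<Sum>y'\<in>J. u y * cnj (u y') * (A x y * cnj (A x y')))"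
    by (rule sum.swap)
  also have "\<dots> = (\<Sum>y\<in>J. \<Sum>y'\<in>J. u y * cnj (u y') * (\<Sum>x\<in>I. A x y * cnj (A x y')))"
    by (subst sum.swap) (simp add: sum_distrib_left)
  also have "\<dots> = (\<Sum>y\<in>J. \<Sum>y'\<in>J. if y = y' then u y * cnj (u y') else 0)"
    by (intro sum.cong refl) (simp add: assms(1))
  also have "\<dots> = (\<Sum>y\<in>J. u y * cnj (u y))" using assms(2) by simp
  also have "\<dots> = complex_of_real (\<Sum>y\<in>J. (cmod (u y))\<^sup>2)"
    by (simp only: of_real_sum complex_norm_square)
  finally show ?thesis by (simp only: of_real_eq_iff)
qed

text \<open>The matrix \<open>U Y W\<^sup>*\<close>, with the vectors \<open>U \<rho>\<close> and \<open>W
  \<mu>\<close> as columns.\<close>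

definition sandwich :: "'i set \<Rightarrow> ('i \<Rightarrow> 'x \<Rightarrow> complex) \<Rightarrow> ('i \<Rightarrow> 'i \<Rightarrow> complex) \<Rightarrow> ('i \<Rightarrow> 'x \<Rightarrow> complex) \<Rightarrow> 'x \<Rightarrow> 'x \<Rightarrow> complex" where
  "sandwich I U Y W x y = (\<Sum>\<rho>\<in>I. \<Sum>\<mu>\<in>I. U \<rho> x * Y \<rho> \<mu> * cnj (W \<mu> y))"

lemma op_bound_sandwich:
  assumes fin: "finite I" "finite J" and U: "orthonormal I J U" and W: "orthonormal I J W"
    and card: "card I = card J" and Y: "op_bound I I Y C"
  shows "op_bound J J (sandwich I U Y W) C"
  unfolding op_bound_def
proof
  fix v
  define b where "b \<mu> = (\<Sum>y\<in>J. cnj (W \<mu> y) * v y)" for \<mu>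
  have "(\<Sum>y\<in>J. sandwich I U Y W x y * v y) = (\<Sum>\<rho>\<in>I. U \<rho> x * (\<Sum>\<mu>\<in>I. Y \<rho> \<mu> * b \<mu>))" for x
  proof -
    have "(\<Sum>y\<in>J. sandwich I U Y W x y * v y) = (\<Sum>y\<in>J. \<Sum>\<rho>\<in>I. \<Sum>\<mu>\<in>I. U \<rho> x * (Y \<rho> \<mu> * (cnj (W \<mu> y) * v y)))"
      by (simp add: sandwich_def sum_distrib_right mult.assoc)
    also have "\<dots> = (\<Sum>\<rho>\<in>I. \<Sum>y\<in>J. \<Sum>\<mu>\<in>I. U \<rho> x * (Y \<rho> \<mu> * (cnj (W \<mu> y) * v y)))" by (rule sum.swap)
    also have "\<dots> = (\<Sum>\<rho>\<in>I. \<Sum>\<mu>\<in>I. \<Sum>y\<in>J. U \<rho> x * (Y \<rho> \<mu> * (cnj (W \<mu> y) * v y)))"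
      by (intro sum.cong refl sum.swap)
    finally show ?thesis by (simp add: b_def sum_distrib_left)
  qed
  then have "(\<Sum>x\<in>J. (cmod (\<Sum>y\<in>J. sandwich I U Y W x y * v y))\<^sup>2) =
     (\<Sum>x\<in>J. (cmod (\<Sum>\<rho>\<in>I. U \<rho> x * (\<Sum>\<mu>\<in>I. Y \<rho> \<mu> * b \<mu>)))\<^sup>2)" by simp
  also have "\<dots> = (\<Sum>\<rho>\<in>I. (cmod (\<Sum>\<mu>\<in>I. Y \<rho> \<mu> * b \<mu>))\<^sup>2)"
    by (rule isometry_norm) (use U fin in \<open>auto simp: orthonormal_def\<close>)
  also have "\<dots> \<le> C\<^sup>2 * (\<Sum>\<mu>\<in>I. (cmod (b \<mu>))\<^sup>2)" using Y by (simp add: op_bound_def)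
  also have "(\<Sum>\<mu>\<in>I. (cmod (b \<mu>))\<^sup>2) = (\<Sum>y\<in>J. (cmod (v y))\<^sup>2)" unfolding b_def
  proof (rule isometry_norm)
    fix y y' assume y: "y \<in> J" "y' \<in> J"
    have "(\<Sum>\<mu>\<in>I. cnj (W \<mu> y) * cnj (cnj (W \<mu> y'))) = cnj (\<Sum>\<mu>\<in>I. W \<mu> y * cnj (W \<mu> y'))" by (simp add: cnj_sum)
    then show "(\<Sum>\<mu>\<in>I. cnj (W \<mu> y) * cnj (cnj (W \<mu> y'))) = (if y = y' then 1 else 0)"
      using square_orthonormal_complete[OF fin card W y] by simp
  qed (rule fin)
  finally show "(\<Sum>x\<in>J. (cmod (\<Sum>y\<in>J. sandwich I U Y W x y * v y))\<^sup>2) \<le> C\<^sup>2 * (\<Sum>y\<in>J. (cmod (v y))\<^sup>2)" .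
qed

lemma sandwich_mult:
  assumes "finite I" "orthonormal I J V"
  shows "(\<Sum>z\<in>J. sandwich I U Y V x z * sandwich I V Z W z y) =
    sandwich I U (\<lambda>\<rho> \<mu>. \<Sum>\<nu>\<in>I. Y \<rho> \<nu> * Z \<nu> \<mu>) W x y"
proof -
  define a b where "a \<nu> = (\<Sum>\<rho>\<in>I. U \<rho> x * Y \<rho> \<nu>)" and "b \<nu> = (\<Sum>\<mu>\<in>I. Z \<nu> \<mu> * cnj (W \<mu> y))" for \<nu>
  have 1: "sandwich I U Y V x z = (\<Sum>\<nu>\<in>I. a \<nu> * cnj (V \<nu> z))" for z
    unfolding sandwich_def a_def by (subst sum.swap) (simp add: sum_distrib_right)
  have 2: "sandwich I V Z W z y = (\<Sum>\<nu>\<in>I. b \<nu> * V \<nu> z)" for z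
    unfolding sandwich_def b_def by (simp add: sum_distrib_left sum_distrib_right mult_ac)
  have "(\<Sum>z\<in>J. sandwich I U Y V x z * sandwich I V Z W z y) =
     (\<Sum>z\<in>J. \<Sum>\<nu>\<in>I. \<Sum>\<nu>'\<in>I. a \<nu> * b \<nu>' * (V \<nu>' z * cnj (V \<nu> z)))"
    unfolding 1 2 sum_product by (simp add: mult_ac)
  also have "\<dots> = (\<Sum>\<nu>\<in>I. \<Sum>z\<in>J. \<Sum>\<nu>'\<in>I. a \<nu> * b \<nu>' * (V \<nu>' z * cnj (V \<nu> z)))"
    by (rule sum.swap)
  also have "\<dots> = (\<Sum>\<nu>\<in>I. \<Sum>\<nu>'\<in>I. a \<nu> * b \<nu>' * (\<Sum>z\<in>J. V \<nu>' z * cnj (V \<nu> z)))"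
    by (subst sum.swap) (simp add: sum_distrib_left)
  also have "\<dots> = (\<Sum>\<nu>\<in>I. \<Sum>\<nu>'\<in>I. if \<nu>' = \<nu> then a \<nu> * b \<nu>' else 0)"
    using assms(2) by (intro sum.cong refl) (simp add: orthonormal_def)
  also have "\<dots> = (\<Sum>\<nu>\<in>I. a \<nu> * b \<nu>)" using assms(1) by simp
  also have "\<dots> = (\<Sum>\<nu>\<in>I. \<Sum>\<rho>\<in>I. \<Sum>\<mu>\<in>I. U \<rho> x * (Y \<rho> \<nu> * Z \<nu> \<mu>) * cnj (W \<mu> y))"
    by (simp add: a_def b_def sum_product mult.assoc)
  also have "\<dots> = (\<Sum>\<rho>\<in>I. \<Sum>\<nu>\<in>I. \<Sum>\<mu>\<in>I. U \<rho> x * (Y \<rho> \<nu> * Z \<nu> \<mu>) * cnj (W \<mu> y))" by (rule sum.swap)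
  also have "\<dots> = (\<Sum>\<rho>\<in>I. \<Sum>\<mu>\<in>I. \<Sum>\<nu>\<in>I. U \<rho> x * (Y \<rho> \<nu> * Z \<nu> \<mu>) * cnj (W \<mu> y))"
    by (intro sum.cong refl sum.swap)
  finally show ?thesis by (simp add: sandwich_def sum_distrib_left sum_distrib_right)
qed

section \<open>A rotation through nearest neighbours\<close>

text \<open>The time \<open>[0,1]\<close> is divided into \<open>K - 1\<close> stages. In the stage \<open>i
  \<ge> 1\<close> the angle of the \<open>i\<close>-th vector increases from \<open>0\<close> to
  \<open>\<pi>/2\<close>, while the earlier angles are complete and the later ones vanish. The values at
  \<open>i = 0\<close> and \<open>i = K\<close> make the formula for the hole uniform.\<close>

definition ramp :: "nat \<Rightarrow> nat \<Rightarrow> real \<Rightarrow> real" where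
  "ramp K i \<tau> = max 0 (min 1 ((real K - 1) * \<tau> - (real i - 1)))"

definition rcos :: "nat \<Rightarrow> nat \<Rightarrow> real \<Rightarrow> real" where
  "rcos K i \<tau> = cos (pi / 2 * ramp K i \<tau>)"

definition rsin :: "nat \<Rightarrow> nat \<Rightarrow> real \<Rightarrow> real" where
  "rsin K i \<tau> = sin (pi / 2 * ramp K i \<tau>)"

text \<open>The \<open>i\<close>-th column, \<open>i \<ge> 1\<close>, rotates from the basis vector
  \<open>i\<close> to the basis vector \<open>i - 1\<close>, which the previous stage has left free. The
  column \<open>0\<close> is the remaining vector, the hole: it travels from \<open>0\<close> to \<open>K -
  1\<close>. A cyclic shift of even length has determinant \<open>-1\<close>, so a path of real rotations
  cannot end there; the phase \<open>cis (\<pi> \<tau>)\<close> repairs the sign.\<close>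

definition rot :: "nat \<Rightarrow> real \<Rightarrow> nat \<Rightarrow> nat \<Rightarrow> complex" where
  "rot K \<tau> j i = (if i = 0 then cis (pi * \<tau>) * (- 1) ^ j * of_real (rsin K j \<tau> * rcos K (Suc j) \<tau>)
     else if j = i then of_real (rcos K i \<tau>) else if Suc j = i then of_real (rsin K i \<tau>) else 0)"

lemma rcos_rsin_sq: "(rcos K i \<tau>)\<^sup>2 + (rsin K i \<tau>)\<^sup>2 = 1"
  by (simp add: rcos_def rsin_def)

lemma rsin_after:
  assumes "i < i'" "rsin K i' \<tau> \<noteq> 0" shows "rcos K i \<tau> = 0" "rsin K i \<tau> = 1"
proof -
  have "ramp K i' \<tau> \<noteq> 0" using assms(2) by (auto simp: rsin_def)
  then have "ramp K i \<tau> = 1" using assms(1) by (auto simp: ramp_def max_def min_def split: if_splits)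
  then show "rcos K i \<tau> = 0" "rsin K i \<tau> = 1" by (simp_all add: rcos_def rsin_def)
qed

lemma rcos_before:
  assumes "i < i'" "rcos K i \<tau> \<noteq> 0" shows "rsin K i' \<tau> = 0" "rcos K i' \<tau> = 1"
proof -
  have "ramp K i \<tau> \<noteq> 1" using assms(2) by (auto simp: rcos_def)
  then have "ramp K i' \<tau> = 0" using assms(1) by (auto simp: ramp_def max_def min_def split: if_splits)
  then show "rsin K i' \<tau> = 0" "rcos K i' \<tau> = 1" by (simp_all add: rcos_def rsin_def)
qed

lemma ramp_first: "0 \<le> \<tau> \<Longrightarrow> 1 \<le> K \<Longrightarrow> ramp K 0 \<tau> = 1"
  by (simp add: ramp_def)

lemma ramp_last: "\<tau> \<le> 1 \<Longrightarrow> 1 \<le> K \<Longrightarrow> ramp K K \<tau> = 0"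
  using mult_left_mono[of \<tau> 1 "real K - 1"] by (simp add: ramp_def)

lemma sum_rot:
  assumes "1 \<le> i" "i < K"
  shows "(\<Sum>j<K. g j * rot K \<tau> j i) = g i * of_real (rcos K i \<tau>) + g (i - 1) * of_real (rsin K i \<tau>)"
proof -
  have "(\<Sum>j<K. g j * rot K \<tau> j i) = (\<Sum>j<K. (if j = i then g j * of_real (rcos K i \<tau>) else 0) +
      (if j = i - 1 then g j * of_real (rsin K i \<tau>) else 0))"
    using assms(1) by (intro sum.cong refl) (auto simp: rot_def)
  then show ?thesis using assms by (simp add: sum.distrib)
qed

text \<open>The scalar products vanish because at any time at most one angle differs from \<open>0\<close> and
  \<open>\<pi>/2\<close>. The norm of the hole is a telescoping sum.\<close>

lemma rot_columns:
  assumes K: "1 \<le> K" and \<tau>: "\<tau> \<in> {0..1}" and i: "i < K" "i' < K"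
  shows "(\<Sum>j<K. rot K \<tau> j i * cnj (rot K \<tau> j i')) = (if i = i' then 1 else 0)"
proof -
  have hole: "(\<Sum>j<K. rot K \<tau> j 0 * cnj (rot K \<tau> j 0)) = 1"
  proof -
    have "rot K \<tau> j 0 * cnj (rot K \<tau> j 0) = of_real ((rsin K j \<tau>)\<^sup>2 - (rsin K (Suc j) \<tau>)\<^sup>2)" for j
    proof -
      have "rot K \<tau> j 0 * cnj (rot K \<tau> j 0) = of_real ((cmod (rot K \<tau> j 0))\<^sup>2)" by (simp only: complex_norm_square)
      also have "(cmod (rot K \<tau> j 0))\<^sup>2 = (rsin K j \<tau>)\<^sup>2 * (rcos K (Suc j) \<tau>)\<^sup>2"
        by (simp add: rot_def norm_mult norm_power power_mult_distrib abs_mult)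
      also have "\<dots> = (rsin K j \<tau>)\<^sup>2 - (rsin K j \<tau>)\<^sup>2 * (rsin K (Suc j) \<tau>)\<^sup>2"
      proof -
        have "(rcos K (Suc j) \<tau>)\<^sup>2 = 1 - (rsin K (Suc j) \<tau>)\<^sup>2" using rcos_rsin_sq[of K "Suc j" \<tau>] by linarith
        then show ?thesis by (simp add: right_diff_distrib)
      qed
      also have "(rsin K j \<tau>)\<^sup>2 * (rsin K (Suc j) \<tau>)\<^sup>2 = (rsin K (Suc j) \<tau>)\<^sup>2"
        using rsin_after(2)[of j "Suc j" K \<tau>] by (cases "rsin K (Suc j) \<tau> = 0") auto
      finally show ?thesis .
    qed
    then have "(\<Sum>j<K. rot K \<tau> j 0 * cnj (rot K \<tau> j 0)) = of_real (\<Sum>j<K. (rsin K j \<tau>)\<^sup>2 - (rsin K (Suc j) \<tau>)\<^sup>2)"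
      by simp
    also have "(\<Sum>j<K. (rsin K j \<tau>)\<^sup>2 - (rsin K (Suc j) \<tau>)\<^sup>2) = (rsin K 0 \<tau>)\<^sup>2 - (rsin K K \<tau>)\<^sup>2"
      by (rule sum_lessThan_telescope')
    also have "\<dots> = 1" using ramp_first[of \<tau> K] ramp_last[of \<tau> K] K \<tau> by (simp add: rsin_def)
    finally show ?thesis by simp
  qed
  have cross: "(\<Sum>j<K. rot K \<tau> j i * cnj (rot K \<tau> j i')) = (if i = i' then 1 else 0)"
    if i: "i < K" "i' < K" "1 \<le> i" for i i'
  proof -
    let ?c = "\<lambda>i. complex_of_real (rcos K i \<tau>)" and ?s = "\<lambda>i. complex_of_real (rsin K i \<tau>)"
    have cs: "?c a * ?s b = 0" if "a < b" for a b
      using rsin_after(1)[OF that, of K \<tau>] by (cases "rsin K b \<tau> = 0") auto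
    have "(\<Sum>j<K. rot K \<tau> j i * cnj (rot K \<tau> j i')) = (\<Sum>j<K. cnj (rot K \<tau> j i') * rot K \<tau> j i)"
      by (simp add: mult.commute)
    also have "\<dots> = cnj (rot K \<tau> i i') * ?c i + cnj (rot K \<tau> (i - 1) i') * ?s i"
      by (rule sum_rot) (use i in auto)
    also have "\<dots> = (if i = i' then 1 else 0)"
    proof (cases "i' = 0")
      case True
      obtain m where m: "i = Suc m" using i by (cases i) auto
      have "?s i * ?c (Suc i) * ?c i - ?s m * ?c i * ?s i = 0"
      proof (cases "rcos K i \<tau> = 0 \<or> rsin K i \<tau> = 0")
        case False
        then have "rcos K (Suc i) \<tau> = 1" "rsin K m \<tau> = 1"
          using rcos_before(2)[of i "Suc i" K \<tau>] rsin_after(2)[of m i K \<tau>] m by auto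
        then show ?thesis by simp
      qed auto
      then have "cis (- pi * \<tau>) * (- 1) ^ i * (?s i * ?c (Suc i) * ?c i - ?s m * ?c i * ?s i) = 0" by simp
      then show ?thesis using True i m by (simp add: rot_def cis_cnj algebra_simps)
    next
      case False
      consider "i = i'" | "i' = Suc i" | "i = Suc i'" | "i \<noteq> i'" "i' \<noteq> Suc i" "i \<noteq> Suc i'" by blast
      then show ?thesis
      proof cases
        case 1
        have "?c i * ?c i + ?s i * ?s i = of_real ((rcos K i \<tau>)\<^sup>2 + (rsin K i \<tau>)\<^sup>2)"
          by (simp add: power2_eq_square)
        then show ?thesis using 1 False i by (simp add: rot_def rcos_rsin_sq)
      next
        case 2
        then show ?thesis using cs[of i i'] i by (auto simp: rot_def mult.commute)
      next
        case 3
        then show ?thesis using cs[of i' i] i False by (auto simp: rot_def)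
      next
        case 4
        then show ?thesis using i False by (auto simp: rot_def)
      qed
    qed
    finally show ?thesis .
  qed
  consider "1 \<le> i" | "i = 0" "1 \<le> i'" | "i = 0" "i' = 0" by linarith
  then show ?thesis
  proof cases
    case 1
    then show ?thesis using cross i by blast
  next
    case 2
    have "(\<Sum>j<K. rot K \<tau> j i * cnj (rot K \<tau> j i')) = cnj (\<Sum>j<K. rot K \<tau> j i' * cnj (rot K \<tau> j i))"
      by (simp add: mult.commute)
    also have "\<dots> = 0" using cross[of i' i] i 2 by simp
    finally show ?thesis using 2 by simp
  next
    case 3
    then show ?thesis using hole by simp
  qed
qed

lemma rot_start:
  assumes "1 \<le> K" "j < K"
  shows "rot K 0 j i = (if j = i then 1 else 0)"
proof -
  have "ramp K i 0 = (if i = 0 then 1 else 0)" for i by (auto simp: ramp_def)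
  then show ?thesis by (auto simp: rot_def rcos_def rsin_def)
qed

lemma rot_end:
  assumes "even K" "2 \<le> K" "j < K" "i < K"
  shows "rot K 1 j i = (if (j + 1) mod K = i then 1 else 0)"
proof -
  have r: "ramp K a 1 = (if a < K then 1 else 0)" if "a \<le> K" for a using that by (auto simp: ramp_def)
  have s: "rsin K a 1 = 1" "rcos K a 1 = 0" if "a < K" for a using r[of a] that by (auto simp: rsin_def rcos_def)
  have l: "rcos K K 1 = 1" using r[of K] by (simp add: rcos_def)
  show ?thesis
  proof (cases "Suc j = K")
    case True
    have o: "odd j" using True assms(1) by auto
    have "(j + 1) mod K = 0" using True by simp
    moreover have "rcos K (Suc j) 1 = 1" using l True by simp
    ultimately show ?thesis using True o s[of j] s[of i] assms by (auto simp: rot_def)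
  next
    case False
    then have "Suc j < K" using assms by simp
    then show ?thesis using s[of "Suc j"] s[of i] assms by (auto simp: rot_def)
  qed
qed

lemma rot_continuous: "continuous_on A (\<lambda>\<tau>. rot K \<tau> j i)"
  unfolding rot_def rcos_def rsin_def ramp_def
  by (cases "i = 0"; cases "j = i"; cases "Suc j = i") (auto intro!: continuous_intros simp: cis_conv_exp)

lemma norm_rot_le: "cmod (rot K \<tau> j i) \<le> 1"
proof -
  have "\<bar>rsin K j \<tau> * rcos K (Suc j) \<tau>\<bar> \<le> 1 * 1"
    unfolding abs_mult by (intro mult_mono) (auto simp: rsin_def rcos_def)
  then show ?thesis by (auto simp: rot_def norm_mult norm_power rsin_def rcos_def)
qed

section \<open>A closed frame\<close>

text \<open>An index \<open>(\<kappa>, s, i, l)\<close> consists of all signs of a word but the first one, the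
  first sign (in the raw frame) or the choice between sum and difference (in the closed frame), the position
  on the circle, and a column of \<open>A\<^sub>n\<close>.\<close>

type_synonym frame_index = "bool list \<times> bool \<times> nat \<times> nat"

definition frame_indices :: "nat \<Rightarrow> nat \<Rightarrow> frame_index set" where
  "frame_indices n k = words k \<times> UNIV \<times> {..<2 ^ Suc k} \<times> {..<4 ^ n}"

lemma finite_frame_indices [simp]: "finite (frame_indices n k)"
  by (simp add: frame_indices_def)

lemma card_frame_indices: "card (frame_indices n k) = 4 ^ (n + Suc k)"
proof -
  have "card (words k) = 2 ^ k"
    using card_lists_length_eq[of "UNIV::bool set" k] by (simp add: words_def)
  then have "card (frame_indices n k) = 2 ^ k * (2 * (2 ^ Suc k * 4 ^ n))"
    by (simp add: frame_indices_def card_cartesian_product)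
  also have "\<dots> = (2 * 2) ^ k * 4 * 4 ^ n" unfolding power_mult_distrib by simp
  finally show ?thesis by (simp add: power_add)
qed

lemma sum_frame_indices:
  "(\<Sum>\<rho>\<in>frame_indices n k. g \<rho>) = (\<Sum>\<kappa>\<in>words k. \<Sum>\<sigma>\<in>UNIV. \<Sum>j<2 ^ Suc k. \<Sum>l<4 ^ n. g (\<kappa>, \<sigma>, j, l))"
  by (simp add: frame_indices_def sum.cartesian_product split_def)

text \<open>Away from the hole, the two parities with the same \<open>\<kappa>\<close> are combined into sum
  and difference, which the grading exchanges. Holes are not combined.\<close>

definition hadamard :: "nat \<Rightarrow> bool \<Rightarrow> bool \<Rightarrow> complex" where
  "hadamard i s \<sigma> = (if i = 0 then (if s = \<sigma> then 1 else 0)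
     else of_real (1 / sqrt 2) * (if s \<or> \<sigma> then 1 else - 1))"

lemma hadamard_unitary: "(\<Sum>\<sigma>\<in>UNIV. hadamard i s \<sigma> * cnj (hadamard i s' \<sigma>)) = (if s = s' then 1 else 0)"
proof -
  have "complex_of_real (1 / sqrt 2) * complex_of_real (1 / sqrt 2) = 1 / 2"
    by (simp flip: of_real_mult)
  then show ?thesis
    by (cases s; cases s') (simp_all add: hadamard_def UNIV_bool)
qed

lemma norm_hadamard_le: "cmod (hadamard i s \<sigma>) \<le> 1"
  by (auto simp: hadamard_def norm_mult norm_divide)

lemma hadamard_sign: "i \<noteq> 0 \<Longrightarrow> bool_sign \<sigma> * hadamard i s \<sigma> = hadamard i (\<not> s) \<sigma>"
  by (cases s; cases \<sigma>) (auto simp: hadamard_def bool_sign_def)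

text \<open>The time of the rotation is reversed for odd words, because their monodromy decreases
  \<open>j\<close>.\<close>

definition mixing :: "nat \<Rightarrow> real \<Rightarrow> frame_index \<Rightarrow> frame_index \<Rightarrow> complex" where
  "mixing k t = (\<lambda>(\<kappa>, s, i, l) (\<kappa>', \<sigma>, j, l').
     if \<kappa> = \<kappa>' then hadamard i s \<sigma> * rot (2 ^ Suc k) (side (sgn_word (\<sigma> # \<kappa>)) t) j i else 0)"

definition same_column :: "frame_index \<Rightarrow> frame_index \<Rightarrow> complex" where
  "same_column = (\<lambda>(\<kappa>, s, i, l) (\<kappa>', \<sigma>, j, l'). if l = l' then 1 else 0)"

definition raw_frame :: "(real \<Rightarrow> complex mat) \<Rightarrow> nat \<Rightarrow> real \<Rightarrow> frame_index \<Rightarrow> nat \<Rightarrow> complex" where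
  "raw_frame c n t = (\<lambda>(\<kappa>, \<sigma>, j, l) x. frame c n (\<sigma> # \<kappa>) j l t x)"

text \<open>The rotation undoes the monodromy of the raw frame, so that the vectors are loops.\<close>

definition closed_frame :: "(real \<Rightarrow> complex mat) \<Rightarrow> nat \<Rightarrow> nat \<Rightarrow> real \<Rightarrow> frame_index \<Rightarrow> nat \<Rightarrow> complex" where
  "closed_frame c n k t \<mu> x =
     (\<Sum>\<rho>\<in>frame_indices n k. mixing k t \<mu> \<rho> * same_column \<mu> \<rho> * raw_frame c n t \<rho> x)"

definition index_point :: "real \<Rightarrow> frame_index \<Rightarrow> real" where
  "index_point t = (\<lambda>(\<kappa>, \<sigma>, j, l). point (\<sigma> # \<kappa>) j t)"

definition position :: "frame_index \<Rightarrow> nat" where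
  "position = (\<lambda>(\<kappa>, s, i, l). i)"

definition column :: "frame_index \<Rightarrow> nat" where
  "column = (\<lambda>(\<kappa>, s, i, l). l)"

definition with_column :: "frame_index \<Rightarrow> nat \<Rightarrow> frame_index" where
  "with_column = (\<lambda>(\<kappa>, s, i, l) l'. (\<kappa>, s, i, l'))"

definition flip_index :: "frame_index \<Rightarrow> frame_index" where
  "flip_index = (\<lambda>(\<kappa>, s, i, l). (\<kappa>, \<not> s, i, l))"

lemma sum_same_column:
  assumes "\<mu> \<in> frame_indices n k"
  shows "(\<Sum>\<rho>\<in>frame_indices n k. same_column \<mu> \<rho> * g \<rho>) =
    (\<Sum>\<kappa>\<in>words k. \<Sum>\<sigma>\<in>UNIV. \<Sum>j<2 ^ Suc k. g (\<kappa>, \<sigma>, j, column \<mu>))"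
proof -
  obtain \<kappa> s i l where \<mu>: "\<mu> = (\<kappa>, s, i, l)" by (cases \<mu>)
  have l: "l < 4 ^ n" using assms by (simp add: \<mu> frame_indices_def)
  have "(\<Sum>l'<4 ^ n. same_column \<mu> (\<kappa>', \<sigma>, j, l') * g (\<kappa>', \<sigma>, j, l')) = g (\<kappa>', \<sigma>, j, l)" for \<kappa>' \<sigma> j
  proof -
    have "(\<Sum>l'<4 ^ n. same_column \<mu> (\<kappa>', \<sigma>, j, l') * g (\<kappa>', \<sigma>, j, l')) =
      (\<Sum>l'<4 ^ n. if l = l' then g (\<kappa>', \<sigma>, j, l') else 0)"
      by (intro sum.cong) (auto simp: \<mu> same_column_def)
    then show ?thesis using l by simp
  qed
  then show ?thesis by (simp add: sum_frame_indices \<mu> column_def)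
qed

lemma closed_frame_eq:
  assumes "(\<kappa>, s, i, l) \<in> frame_indices n k"
  shows "closed_frame c n k t (\<kappa>, s, i, l) x = (\<Sum>\<sigma>\<in>UNIV. hadamard i s \<sigma> *
     (\<Sum>j<2 ^ Suc k. rot (2 ^ Suc k) (side (sgn_word (\<sigma> # \<kappa>)) t) j i * frame c n (\<sigma> # \<kappa>) j l t x))"
proof -
  let ?g = "\<lambda>\<kappa>'. \<Sum>\<sigma>\<in>UNIV. \<Sum>j<2 ^ Suc k. hadamard i s \<sigma> * rot (2 ^ Suc k) (side (sgn_word (\<sigma> # \<kappa>')) t) j i *
        frame c n (\<sigma> # \<kappa>') j l t x"
  have \<kappa>: "\<kappa> \<in> words k" using assms by (simp add: frame_indices_def)
  have "closed_frame c n k t (\<kappa>, s, i, l) x =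
    (\<Sum>\<rho>\<in>frame_indices n k. same_column (\<kappa>, s, i, l) \<rho> * (mixing k t (\<kappa>, s, i, l) \<rho> * raw_frame c n t \<rho> x))"
    by (simp add: closed_frame_def mult_ac)
  also have "\<dots> = (\<Sum>\<kappa>'\<in>words k. if \<kappa>' = \<kappa> then ?g \<kappa>' else 0)"
    unfolding sum_same_column[OF assms]
    by (intro sum.cong refl) (auto simp: mixing_def raw_frame_def column_def intro!: sum.neutral)
  also have "\<dots> = ?g \<kappa>" using \<kappa> by simp
  finally show ?thesis by (simp add: sum_distrib_left mult.assoc)
qed

lemma closed_frame_sign:
  assumes n: "n \<ge> 1" and \<mu>: "\<mu> \<in> frame_indices n k" "position \<mu> \<noteq> 0"
  obtains z where "z = 1 \<or> z = - 1" "\<And>t x. x < 4 ^ (n + Suc k) \<Longrightarrow>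
    row_sign (n + Suc k) x * closed_frame c n k t \<mu> x = z * closed_frame c n k t (flip_index \<mu>) x"
proof -
  obtain \<kappa> s i l where m: "\<mu> = (\<kappa>, s, i, l)" by (cases \<mu>)
  have i: "i \<noteq> 0" using \<mu> by (simp add: m position_def)
  have \<kappa>: "length \<kappa> = k" and l: "l < 4 ^ n" using \<mu> by (auto simp: m frame_indices_def words_def)
  have \<mu>': "(\<kappa>, \<not> s, i, l) \<in> frame_indices n k" using \<mu> by (auto simp: m frame_indices_def)
  define z where "z = bool_sign (sgn_word \<kappa>) * row_sign n l"
  show ?thesis
  proof (rule that)
    show "z = 1 \<or> z = - 1" by (auto simp: z_def bool_sign_def row_sign_def)
    fix t x assume x: "x < (4::nat) ^ (n + Suc k)"
    have b: "bool_sign (sgn_word (\<sigma> # \<kappa>)) = bool_sign \<sigma> * bool_sign (sgn_word \<kappa>)" for \<sigma>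
      by (auto simp: bool_sign_def)
    have f: "row_sign (n + Suc k) x * frame c n (\<sigma> # \<kappa>) j l t x = bool_sign \<sigma> * z * frame c n (\<sigma> # \<kappa>) j l t x" for \<sigma> j
      using frame_sign[OF n, of x "\<sigma> # \<kappa>" l c j t] x l \<kappa> unfolding b by (simp add: z_def mult_ac)
    let ?R = "\<lambda>\<sigma> j. rot (2 ^ Suc k) (side (sgn_word (\<sigma> # \<kappa>)) t) j i"
    have "row_sign (n + Suc k) x * closed_frame c n k t \<mu> x = (\<Sum>\<sigma>\<in>UNIV. hadamard i s \<sigma> *
       (\<Sum>j<2 ^ Suc k. ?R \<sigma> j * (row_sign (n + Suc k) x * frame c n (\<sigma> # \<kappa>) j l t x)))"
      unfolding m closed_frame_eq[OF \<mu>(1)[unfolded m]] by (simp add: sum_distrib_left mult_ac)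
    also have "\<dots> = z * (\<Sum>\<sigma>\<in>UNIV. (bool_sign \<sigma> * hadamard i s \<sigma>) * (\<Sum>j<2 ^ Suc k. ?R \<sigma> j * frame c n (\<sigma> # \<kappa>) j l t x))"
      unfolding f by (simp add: sum_distrib_left mult_ac)
    also have "\<dots> = z * closed_frame c n k t (flip_index \<mu>) x"
      unfolding hadamard_sign[OF i] m flip_index_def prod.case closed_frame_eq[OF \<mu>'] ..
    finally show "row_sign (n + Suc k) x * closed_frame c n k t \<mu> x = z * closed_frame c n k t (flip_index \<mu>) x" .
  qed
qed

context swap_path_locale
begin

lemma raw_frame_orthonormal:
  assumes "n \<ge> 1" "t \<in> {0..1}"
  shows "orthonormal (frame_indices n k) {..<4 ^ (n + Suc k)} (raw_frame c n t)"
  unfolding orthonormal_def raw_frame_def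
proof clarify
  fix \<kappa> \<sigma> j l \<kappa>' \<sigma>' j' l' assume a: "(\<kappa>, \<sigma>, j, l) \<in> frame_indices n k" "(\<kappa>', \<sigma>', j', l') \<in> frame_indices n k"
  show "(\<Sum>x<4 ^ (n + Suc k). frame c n (\<sigma> # \<kappa>) j l t x * cnj (frame c n (\<sigma>' # \<kappa>') j' l' t x)) =
     (if (\<kappa>, \<sigma>, j, l) = (\<kappa>', \<sigma>', j', l') then 1 else 0)"
    by (subst frame_orthonormal) (use a assms in \<open>auto simp: frame_indices_def words_def\<close>)
qed

lemma closed_frame_orthonormal:
  assumes n: "n \<ge> 1" and t: "t \<in> {0..1}"
  shows "orthonormal (frame_indices n k) {..<4 ^ (n + Suc k)} (closed_frame c n k t)"
  unfolding orthonormal_def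
proof (intro ballI)
  fix \<mu> \<nu> assume \<mu>: "\<mu> \<in> frame_indices n k" and \<nu>: "\<nu> \<in> frame_indices n k"
  let ?I = "frame_indices n k" and ?J = "{..<(4::nat) ^ (n + Suc k)}"
  let ?C = "\<lambda>\<mu> \<rho>. mixing k t \<mu> \<rho> * same_column \<mu> \<rho>" and ?r = "raw_frame c n t"
  obtain \<kappa> s i l where m: "\<mu> = (\<kappa>, s, i, l)" by (cases \<mu>)
  obtain \<kappa>' s' i' l' where m': "\<nu> = (\<kappa>', s', i', l')" by (cases \<nu>)
  have i: "i < 2 ^ Suc k" "i' < 2 ^ Suc k" "\<kappa> \<in> words k" using \<mu> \<nu> by (auto simp: m m' frame_indices_def)
  have "(\<Sum>x\<in>?J. closed_frame c n k t \<mu> x * cnj (closed_frame c n k t \<nu> x)) =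
     (\<Sum>x\<in>?J. \<Sum>\<rho>\<in>?I. \<Sum>\<rho>'\<in>?I. ?C \<mu> \<rho> * cnj (?C \<nu> \<rho>') * (?r \<rho> x * cnj (?r \<rho>' x)))"
    unfolding closed_frame_def cnj_sum sum_product by (simp add: mult_ac)
  also have "\<dots> = (\<Sum>\<rho>\<in>?I. \<Sum>x\<in>?J. \<Sum>\<rho>'\<in>?I. ?C \<mu> \<rho> * cnj (?C \<nu> \<rho>') * (?r \<rho> x * cnj (?r \<rho>' x)))"
    by (rule sum.swap)
  also have "\<dots> = (\<Sum>\<rho>\<in>?I. \<Sum>\<rho>'\<in>?I. ?C \<mu> \<rho> * cnj (?C \<nu> \<rho>') * (\<Sum>x\<in>?J. ?r \<rho> x * cnj (?r \<rho>' x)))"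
    by (subst sum.swap) (simp add: sum_distrib_left)
  also have "\<dots> = (\<Sum>\<rho>\<in>?I. \<Sum>\<rho>'\<in>?I. if \<rho> = \<rho>' then ?C \<mu> \<rho> * cnj (?C \<nu> \<rho>') else 0)"
    using raw_frame_orthonormal[OF n t, of k] by (intro sum.cong refl) (simp add: orthonormal_def)
  also have "\<dots> = (\<Sum>\<rho>\<in>?I. same_column \<mu> \<rho> * (cnj (same_column \<nu> \<rho>) * mixing k t \<mu> \<rho> * cnj (mixing k t \<nu> \<rho>)))"
    by (simp add: mult_ac)
  also have "\<dots> = (\<Sum>\<tau>\<in>words k. \<Sum>\<sigma>\<in>UNIV. \<Sum>j<2 ^ Suc k. (if l = l' then 1 else 0) * mixing k t \<mu> (\<tau>, \<sigma>, j, l) * cnj (mixing k t \<nu> (\<tau>, \<sigma>, j, l)))"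
    unfolding sum_same_column[OF \<mu>] by (simp add: same_column_def column_def m m')
  also have "\<dots> = (\<Sum>\<tau>\<in>words k. if \<tau> = \<kappa> then (if \<kappa> = \<kappa>' \<and> l = l' then
      (\<Sum>\<sigma>\<in>UNIV. hadamard i s \<sigma> * cnj (hadamard i' s' \<sigma>) * (\<Sum>j<2 ^ Suc k. rot (2 ^ Suc k) (side (sgn_word (\<sigma> # \<kappa>)) t) j i *
        cnj (rot (2 ^ Suc k) (side (sgn_word (\<sigma> # \<kappa>)) t) j i'))) else 0) else 0)"
  proof (rule sum.cong[OF refl])
    fix \<tau>
    show "(\<Sum>\<sigma>\<in>UNIV. \<Sum>j<2 ^ Suc k. (if l = l' then 1 else 0) * mixing k t \<mu> (\<tau>, \<sigma>, j, l) * cnj (mixing k t \<nu> (\<tau>, \<sigma>, j, l))) =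
      (if \<tau> = \<kappa> then (if \<kappa> = \<kappa>' \<and> l = l' then
      (\<Sum>\<sigma>\<in>UNIV. hadamard i s \<sigma> * cnj (hadamard i' s' \<sigma>) * (\<Sum>j<2 ^ Suc k. rot (2 ^ Suc k) (side (sgn_word (\<sigma> # \<kappa>)) t) j i *
        cnj (rot (2 ^ Suc k) (side (sgn_word (\<sigma> # \<kappa>)) t) j i'))) else 0) else 0)"
    proof (cases "\<tau> = \<kappa> \<and> \<kappa> = \<kappa>' \<and> l = l'")
      case True
      then show ?thesis by (simp add: m m' mixing_def sum_distrib_left mult_ac)
    next
      case False
      then show ?thesis by (auto simp: m m' mixing_def)
    qed
  qed
  also have "\<dots> = (if \<kappa> = \<kappa>' \<and> l = l' then (\<Sum>\<sigma>\<in>UNIV. hadamard i s \<sigma> * cnj (hadamard i' s' \<sigma>) * (if i = i' then 1 else 0)) else 0)"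
    using i rot_columns[OF _ side_in[OF t] i(1,2)] by simp
  also have "\<dots> = (if \<mu> = \<nu> then 1 else 0)"
    using hadamard_unitary[of i s s'] by (cases "i = i'") (auto simp: m m')
  finally show "(\<Sum>x\<in>?J. closed_frame c n k t \<mu> x * cnj (closed_frame c n k t \<nu> x)) = (if \<mu> = \<nu> then 1 else 0)" .
qed

lemma closed_frame_closed:
  assumes n: "n \<ge> 1" and \<mu>: "\<mu> \<in> frame_indices n k" and x: "x < 4 ^ (n + Suc k)"
  shows "closed_frame c n k 0 \<mu> x = closed_frame c n k 1 \<mu> x"
proof -
  obtain \<kappa> s i l where m: "\<mu> = (\<kappa>, s, i, l)" by (cases \<mu>)
  have \<kappa>: "length \<kappa> = k" and i: "i < 2 ^ Suc k" using \<mu> by (auto simp: m frame_indices_def words_def)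
  let ?K = "(2::nat) ^ Suc k"
  have "(\<Sum>j<?K. rot ?K (side P 0) j i * frame c n (\<sigma> # \<kappa>) j l 0 x) = (\<Sum>j<?K. rot ?K (side P 1) j i * frame c n (\<sigma> # \<kappa>) j l 1 x)"
    if P: "P = sgn_word (\<sigma> # \<kappa>)" for \<sigma> P
  proof -
    let ?F = "\<lambda>j t. frame c n (\<sigma> # \<kappa>) j l (side P t) x"
    have "(\<Sum>j<?K. rot ?K 0 j i * ?F j 0) = (\<Sum>j<?K. if j = i then ?F j 0 else 0)"
      by (intro sum.cong refl) (simp add: rot_start del: frame.simps)
    then have 0: "(\<Sum>j<?K. rot ?K 0 j i * ?F j 0) = ?F i 0" using i by simp
    define p where "p = (if i = 0 then ?K - 1 else i - 1)"
    have p: "p < ?K" "(p + 1) mod ?K = i" using i by (auto simp: p_def)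
    have pu: "j = p" if "j < ?K" "(j + 1) mod ?K = i" for j
    proof (cases "j + 1 = ?K")
      case True
      then have "i = 0" using that(2) by (metis mod_self)
      then show ?thesis using True by (simp add: p_def)
    next
      case False
      then have "j + 1 < ?K" using that(1) by linarith
      then have "i = j + 1" using that(2) by (metis mod_less)
      then show ?thesis by (simp add: p_def)
    qed
    have "(\<Sum>j<?K. rot ?K 1 j i * ?F j 1) = (\<Sum>j<?K. if j = p then ?F j 1 else 0)"
    proof (rule sum.cong[OF refl])
      fix j assume "j \<in> {..<?K}"
      then have j: "j < ?K" by blast
      have K: "even ?K" "2 \<le> ?K" by simp_all
      have "(j + 1) mod ?K = i \<longleftrightarrow> j = p" using pu[OF j] p(2) by blast
      then have "rot ?K 1 j i = (if j = p then 1 else 0)" using rot_end[OF K j i] by (simp only:)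
      then show "rot ?K 1 j i * ?F j 1 = (if j = p then ?F j 1 else 0)"
        by (simp only: if_distrib[of "\<lambda>z. z * _"] mult_1 mult_zero_left)
    qed
    also have "\<dots> = ?F p 1" using p by simp
    also have "\<dots> = ?F ((p + 1) mod ?K) 0"
      unfolding P by (rule frame_monodromy[OF n]) (use \<kappa> p x in auto)
    finally have 1: "(\<Sum>j<?K. rot ?K 1 j i * ?F j 1) = ?F i 0" unfolding p(2) .
    show ?thesis
    proof (cases P)
      case True
      then show ?thesis using 0 1 by (simp add: side_def)
    next
      case False
      then show ?thesis using 0 1 by (simp add: side_def)
    qed
  qed
  then show ?thesis unfolding m closed_frame_eq[OF \<mu>[unfolded m]] by simp
qed

lemma closed_frame_continuous:
  assumes n: "n \<ge> 1" and \<mu>: "\<mu> \<in> frame_indices n k" and x: "x < 4 ^ (n + Suc k)"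
  shows "continuous_on {0..1} (\<lambda>t. closed_frame c n k t \<mu> x)"
proof -
  obtain \<kappa> s i l where m: "\<mu> = (\<kappa>, s, i, l)" by (cases \<mu>)
  have \<kappa>: "length \<kappa> = k" using \<mu> by (auto simp: m frame_indices_def words_def)
  have "continuous_on {0..1} (\<lambda>t. rot K (side P t) j i)" for K P j
    by (rule continuous_on_compose2[OF rot_continuous[of UNIV]]) (auto intro: continuous_intros)
  moreover have "continuous_on {0..1} (\<lambda>t. frame c n (\<sigma> # \<kappa>) j l t x)" for \<sigma> j
    by (rule frame_continuous[OF n]) (use x \<kappa> in simp)
  ultimately show ?thesis unfolding m closed_frame_eq[OF \<mu>[unfolded m]]
    by (intro continuous_intros)
qed

text \<open>The coordinates in the raw frame of the image of a closed frame vector under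
  \<open>\<psi>\<^sup>k(X)(t)\<close>: each raw vector contributes with the value of \<open>X\<close> at its
  own point.\<close>

lemma iterate_closed_frame:
  assumes n: "n \<ge> 1" and t: "t \<in> {0..1}" and \<mu>: "\<mu> \<in> frame_indices n k" and x: "x < 4 ^ (n + Suc k)"
  shows "(\<Sum>z<4 ^ (n + Suc k). iterate c n (Suc k) X t x z * closed_frame c n k t \<mu> z) =
    (\<Sum>\<rho>\<in>frame_indices n k. raw_frame c n t \<rho> x * (mixing k t \<mu> \<rho> * X (index_point t \<rho>) (column \<rho>) (column \<mu>)))"
proof -
  let ?I = "frame_indices n k" and ?J = "{..<(4::nat) ^ (n + Suc k)}"
  let ?r = "raw_frame c n t"
  have l: "column \<mu> < 4 ^ n" using \<mu> by (auto simp: column_def frame_indices_def)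
  have proj: "(\<Sum>z\<in>?J. cnj (?r \<rho> z) * closed_frame c n k t \<mu> z) = mixing k t \<mu> \<rho> * same_column \<mu> \<rho>"
    if \<rho>: "\<rho> \<in> ?I" for \<rho>
  proof -
    have "(\<Sum>z\<in>?J. cnj (?r \<rho> z) * closed_frame c n k t \<mu> z) =
       (\<Sum>z\<in>?J. \<Sum>\<rho>'\<in>?I. mixing k t \<mu> \<rho>' * same_column \<mu> \<rho>' * (?r \<rho>' z * cnj (?r \<rho> z)))"
      by (simp add: closed_frame_def sum_distrib_left mult_ac)
    also have "\<dots> = (\<Sum>\<rho>'\<in>?I. mixing k t \<mu> \<rho>' * same_column \<mu> \<rho>' * (\<Sum>z\<in>?J. ?r \<rho>' z * cnj (?r \<rho> z)))"
      by (subst sum.swap) (simp add: sum_distrib_left)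
    also have "\<dots> = (\<Sum>\<rho>'\<in>?I. if \<rho>' = \<rho> then mixing k t \<mu> \<rho>' * same_column \<mu> \<rho>' else 0)"
      using raw_frame_orthonormal[OF n t, of k] \<rho> by (intro sum.cong refl) (simp add: orthonormal_def)
    also have "\<dots> = mixing k t \<mu> \<rho> * same_column \<mu> \<rho>" using \<rho> by simp
    finally show ?thesis .
  qed
  have it: "iterate c n (Suc k) X t x z = (\<Sum>\<rho>\<in>?I. \<Sum>l'<4 ^ n. ?r \<rho> x * X (index_point t \<rho>) (column \<rho>) l' * cnj (?r (with_column \<rho> l') z))"
    if "z < 4 ^ (n + Suc k)" for z
    unfolding iterate_eq_frame[OF n x that] sum_words_Suc sum_frame_indices
    by (subst sum.swap) (simp add: raw_frame_def index_point_def column_def with_column_def)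
  have "(\<Sum>z\<in>?J. iterate c n (Suc k) X t x z * closed_frame c n k t \<mu> z) =
    (\<Sum>z\<in>?J. \<Sum>\<rho>\<in>?I. \<Sum>l'<4 ^ n. ?r \<rho> x * X (index_point t \<rho>) (column \<rho>) l' * (cnj (?r (with_column \<rho> l') z) * closed_frame c n k t \<mu> z))"
    by (intro sum.cong refl) (simp add: it sum_distrib_left sum_distrib_right mult_ac del: iterate.simps power_Suc add_Suc_right)
  also have "\<dots> = (\<Sum>\<rho>\<in>?I. \<Sum>z\<in>?J. \<Sum>l'<4 ^ n. ?r \<rho> x * X (index_point t \<rho>) (column \<rho>) l' * (cnj (?r (with_column \<rho> l') z) * closed_frame c n k t \<mu> z))"
    by (rule sum.swap)
  also have "\<dots> = (\<Sum>\<rho>\<in>?I. \<Sum>l'<4 ^ n. ?r \<rho> x * X (index_point t \<rho>) (column \<rho>) l' * (\<Sum>z\<in>?J. cnj (?r (with_column \<rho> l') z) * closed_frame c n k t \<mu> z))"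
    by (subst sum.swap) (simp add: sum_distrib_left)
  also have "\<dots> = (\<Sum>\<rho>\<in>?I. ?r \<rho> x * (mixing k t \<mu> \<rho> * X (index_point t \<rho>) (column \<rho>) (column \<mu>)))"
  proof (rule sum.cong[OF refl])
    fix \<rho> assume \<rho>: "\<rho> \<in> ?I"
    obtain \<kappa> \<sigma> j l0 where r: "\<rho> = (\<kappa>, \<sigma>, j, l0)" by (cases \<rho>)
    obtain \<kappa>' s i l1 where m: "\<mu> = (\<kappa>', s, i, l1)" by (cases \<mu>)
    have "(\<Sum>l'<4 ^ n. ?r \<rho> x * X (index_point t \<rho>) (column \<rho>) l' * (\<Sum>z\<in>?J. cnj (?r (with_column \<rho> l') z) * closed_frame c n k t \<mu> z)) =
      (\<Sum>l'<4 ^ n. if l' = column \<mu> then ?r \<rho> x * X (index_point t \<rho>) (column \<rho>) l' * mixing k t \<mu> \<rho> else 0)"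
    proof (rule sum.cong[OF refl])
      fix l' :: nat assume "l' \<in> {..<4 ^ n}"
      then have "with_column \<rho> l' \<in> ?I" using \<rho> by (auto simp: r with_column_def frame_indices_def)
      from proj[OF this] show "?r \<rho> x * X (index_point t \<rho>) (column \<rho>) l' * (\<Sum>z\<in>?J. cnj (?r (with_column \<rho> l') z) * closed_frame c n k t \<mu> z) =
        (if l' = column \<mu> then ?r \<rho> x * X (index_point t \<rho>) (column \<rho>) l' * mixing k t \<mu> \<rho> else 0)"
        by (auto simp: r m with_column_def mixing_def same_column_def column_def)
    qed
    then show "(\<Sum>l'<4 ^ n. ?r \<rho> x * X (index_point t \<rho>) (column \<rho>) l' * (\<Sum>z\<in>?J. cnj (?r (with_column \<rho> l') z) * closed_frame c n k t \<mu> z)) =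
       ?r \<rho> x * (mixing k t \<mu> \<rho> * X (index_point t \<rho>) (column \<rho>) (column \<mu>))"
      using l by (simp add: mult_ac)
  qed
  finally show ?thesis .
qed

end

section \<open>Constant matrices over a closed frame\<close>

lemma cont_loop_algebra:
  assumes "cont_loop d X" "cont_loop d Y"
  shows "cont_loop d (\<lambda>t x y. X t x y + Y t x y)"
    and "cont_loop d (\<lambda>t x y. r * X t x y)"
    and "cont_loop d (\<lambda>t x y. \<Sum>z<d. X t x z * Y t z y)"
    and "cont_loop d (\<lambda>t x y. cnj (X t y x))"
  using assms unfolding cont_loop_def by (auto intro!: continuous_intros)

lemma cont_loop_const: "cont_loop d (\<lambda>t x y. A x y)"
  unfolding cont_loop_def by auto

lemma sum_le_card_mult:
  fixes f :: "'a \<Rightarrow> real"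
  assumes "finite A" "finite S" "\<And>x. x \<in> A \<Longrightarrow> x \<notin> S \<Longrightarrow> f x = 0" "\<And>x. x \<in> A \<Longrightarrow> f x \<le> w" "0 \<le> w"
    "card S \<le> N"
  shows "sum f A \<le> real N * w"
proof -
  have "sum f A = sum f (A \<inter> S)" using assms by (intro sum.mono_neutral_right) auto
  also have "\<dots> \<le> real (card (A \<inter> S)) * w" using assms by (intro sum_bounded_above) auto
  also have "\<dots> \<le> real N * w"
    using assms card_mono[of S "A \<inter> S"] by (intro mult_right_mono) auto
  finally show ?thesis .
qed

definition diag_fun :: "(frame_index \<Rightarrow> complex) \<Rightarrow> frame_index \<Rightarrow> frame_index \<Rightarrow> complex" where
  "diag_fun \<theta> \<rho> \<mu> = (if \<rho> = \<mu> then \<theta> \<rho> else 0)"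

definition not_hole :: "frame_index \<Rightarrow> complex" where
  "not_hole \<mu> = (if position \<mu> = 0 then 0 else 1)"

text \<open>The constant matrix which imitates \<open>X\<close> over the closed frame: the moving points of evaluation are frozen at the positions, and the hole is omitted.\<close>

definition sample :: "nat \<Rightarrow> (real \<Rightarrow> nat \<Rightarrow> nat \<Rightarrow> complex) \<Rightarrow> frame_index \<Rightarrow> frame_index \<Rightarrow> complex" where
  "sample k X \<rho> \<mu> = (if position \<mu> \<noteq> 0 \<and> \<rho> = with_column \<mu> (column \<rho>)
     then X (real (position \<mu>) / 2 ^ Suc k) (column \<rho>) (column \<mu>) else 0)"

lemma sum_with_column:
  assumes "\<mu> \<in> frame_indices n k"
  shows "(\<Sum>\<nu>\<in>frame_indices n k. if \<nu> = with_column \<mu> (column \<nu>) then g \<nu> else 0) =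
    (\<Sum>l<4 ^ n. g (with_column \<mu> l))"
proof -
  have "(\<Sum>\<nu>\<in>frame_indices n k. if \<nu> = with_column \<mu> (column \<nu>) then g \<nu> else 0) =
      sum g {\<nu> \<in> frame_indices n k. \<nu> = with_column \<mu> (column \<nu>)}"
    by (rule sum.inter_filter[symmetric]) simp
  also have "{\<nu> \<in> frame_indices n k. \<nu> = with_column \<mu> (column \<nu>)} = with_column \<mu> ` {..<4 ^ n}"
    using assms by (auto simp: with_column_def column_def frame_indices_def image_iff split: prod.splits)
  also have "sum g \<dots> = (\<Sum>l<4 ^ n. g (with_column \<mu> l))"
    by (subst sum.reindex) (auto simp: inj_on_def with_column_def split: prod.splits)
  finally show ?thesis .
qed

locale blackadar_limit = swap_path_locale c for c +
  fixes \<iota> :: "nat \<Rightarrow> (real \<Rightarrow> complex mat) \<Rightarrow> 'a::unital_cstar_algebra" and \<alpha> :: "'a \<Rightarrow> 'a"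
  assumes limit: "inductive_limit blackadar_algebra (blackadar_map c) \<iota>"
    and automorphism: "blackadar_automorphism \<iota> \<alpha>"
begin

definition emb :: "nat \<Rightarrow> (real \<Rightarrow> nat \<Rightarrow> nat \<Rightarrow> complex) \<Rightarrow> 'a" where
  "emb n X = \<iota> n (mat_fun (4 ^ n) X)"

lemma in_carrier: "cont_loop (4 ^ n) X \<Longrightarrow> mat_fun (4 ^ n) X \<in> carrier (blackadar_algebra n)"
  unfolding blackadar_algebra_def by (rule mat_fun_carrier)

lemma level_hom: "n \<ge> 1 \<Longrightarrow> unital_star_hom (blackadar_algebra n) (\<iota> n)"
  using limit by (auto simp: inductive_limit_def)

lemma emb_cong:
  "(\<And>t x y. t \<in> {0..1} \<Longrightarrow> x < 4 ^ n \<Longrightarrow> y < 4 ^ n \<Longrightarrow> X t x y = Y t x y) \<Longrightarrow> emb n X = emb n Y"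
  unfolding emb_def by (subst mat_fun_cong[of "4 ^ n" X Y]) auto

lemma emb_add:
  assumes "n \<ge> 1" "cont_loop (4 ^ n) X" "cont_loop (4 ^ n) Y"
  shows "emb n (\<lambda>t x y. X t x y + Y t x y) = emb n X + emb n Y"
  using level_hom[OF assms(1)] in_carrier[OF assms(2)] in_carrier[OF assms(3)]
  unfolding unital_star_hom_def emb_def blackadar_algebra_def circle_algebra_ops[symmetric] by blast

lemma emb_mult:
  assumes "n \<ge> 1" "cont_loop (4 ^ n) X" "cont_loop (4 ^ n) Y"
  shows "emb n (\<lambda>t x y. \<Sum>z<4 ^ n. X t x z * Y t z y) = emb n X * emb n Y"
  using level_hom[OF assms(1)] in_carrier[OF assms(2)] in_carrier[OF assms(3)]
  unfolding unital_star_hom_def emb_def blackadar_algebra_def circle_algebra_ops[symmetric] by blast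

lemma emb_scale:
  assumes "n \<ge> 1" "cont_loop (4 ^ n) X"
  shows "emb n (\<lambda>t x y. r * X t x y) = r *\<^sub>C emb n X"
  using level_hom[OF assms(1)] in_carrier[OF assms(2)]
  unfolding unital_star_hom_def emb_def blackadar_algebra_def circle_algebra_ops[symmetric] by blast

lemma emb_star:
  assumes "n \<ge> 1" "cont_loop (4 ^ n) X"
  shows "emb n (\<lambda>t x y. cnj (X t y x)) = star (emb n X)"
  using level_hom[OF assms(1)] in_carrier[OF assms(2)]
  unfolding unital_star_hom_def emb_def blackadar_algebra_def circle_algebra_ops[symmetric] by blast

lemma emb_one:
  assumes "n \<ge> 1"
  shows "emb n (\<lambda>t x y. if x = y then 1 else 0) = 1"
  using level_hom[OF assms(1)]
  unfolding unital_star_hom_def emb_def blackadar_algebra_def circle_algebra_ops[symmetric] by blast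

lemma emb_diff:
  assumes "n \<ge> 1" "cont_loop (4 ^ n) X" "cont_loop (4 ^ n) Y"
  shows "emb n (\<lambda>t x y. X t x y - Y t x y) = emb n X - emb n Y"
proof -
  have "emb n (\<lambda>t x y. X t x y + (-1) * Y t x y) = emb n X + (-1) *\<^sub>C emb n Y"
    using assms by (simp only: emb_add emb_scale cont_loop_algebra(2))
  then show ?thesis by (simp add: scaleC_minus_one)
qed

lemma iterate_loop:
  assumes "n \<ge> 1" "cont_loop (4 ^ n) X"
  shows "cont_loop (4 ^ (n + k)) (iterate c n k X)"
proof (induction k)
  case (Suc k)
  then show ?case using step_entry_loop[of "n + k" "iterate c n k X"] assms(1) by simp
qed (use assms in simp)

lemma step_mat_fun:
  assumes "n \<ge> 1"
  shows "blackadar_map c n (mat_fun (4 ^ n) X) = mat_fun (4 ^ Suc n) (step_entry c (4 ^ n div 2) X)"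
  by (rule blackadar_map_mat_fun[OF assms c_carrier])

lemma emb_iterate:
  assumes "n \<ge> 1" "cont_loop (4 ^ n) X"
  shows "emb (n + k) (iterate c n k X) = emb n X"
proof (induction k)
  case (Suc k)
  have nk: "n + k \<ge> 1" using assms(1) by simp
  have "\<iota> (Suc (n + k)) (blackadar_map c (n + k) (mat_fun (4 ^ (n + k)) (iterate c n k X))) = emb (n + k) (iterate c n k X)"
    using limit nk in_carrier[OF iterate_loop[OF assms]] unfolding inductive_limit_def emb_def by blast
  then show ?case unfolding step_mat_fun[OF nk] using Suc by (simp add: emb_def)
qed simp

lemma transition_mat_fun:
  assumes "n \<ge> 1"
  shows "transition (blackadar_map c) n k (mat_fun (4 ^ n) X) = mat_fun (4 ^ (n + k)) (iterate c n k X)"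
proof (induction k)
  case (Suc k)
  then show ?case using step_mat_fun[of "n + k" "iterate c n k X"] assms by simp
qed simp

lemma norm_limit:
  assumes "n \<ge> 1" "cont_loop (4 ^ n) X"
  shows "(\<lambda>k. norm_of (circle_algebra (4 ^ (n + k))) (mat_fun (4 ^ (n + k)) (iterate c n k X))) \<longlonglongrightarrow> norm (emb n X)"
proof -
  have "(\<lambda>k. norm_of (blackadar_algebra (n + k)) (transition (blackadar_map c) n k (mat_fun (4 ^ n) X))) \<longlonglongrightarrow> norm (\<iota> n (mat_fun (4 ^ n) X))"
    using limit assms(1) in_carrier[OF assms(2)] unfolding inductive_limit_def by blast
  then show ?thesis unfolding transition_mat_fun[OF assms(1)] by (simp add: emb_def blackadar_algebra_def)
qed

lemma iterate_sandwich:
  assumes n: "n \<ge> 1" and x: "x < 4 ^ (n + Suc k)" and y: "y < 4 ^ (n + Suc k)"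
  shows "iterate c n (Suc k) X t x y = sandwich (frame_indices n k) (raw_frame c n t)
    (\<lambda>\<rho> \<mu>. if \<mu> = with_column \<rho> (column \<mu>) then X (index_point t \<rho>) (column \<rho>) (column \<mu>) else 0) (raw_frame c n t) x y"
proof -
  let ?I = "frame_indices n k" and ?r = "raw_frame c n t"
  have "iterate c n (Suc k) X t x y = (\<Sum>\<rho>\<in>?I. \<Sum>l'<4 ^ n. ?r \<rho> x * X (index_point t \<rho>) (column \<rho>) l' * cnj (?r (with_column \<rho> l') y))"
    unfolding iterate_eq_frame[OF n x y] sum_words_Suc sum_frame_indices
    by (subst sum.swap) (simp add: raw_frame_def index_point_def column_def with_column_def del: frame.simps)
  also have "\<dots> = (\<Sum>\<rho>\<in>?I. \<Sum>\<mu>\<in>?I. if \<mu> = with_column \<rho> (column \<mu>) then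
     ?r \<rho> x * X (index_point t \<rho>) (column \<rho>) (column \<mu>) * cnj (?r \<mu> y) else 0)"
    by (intro sum.cong refl, subst sum_with_column) (auto simp: column_def with_column_def split: prod.splits)
  finally show ?thesis unfolding sandwich_def
    by (simp only: if_distrib[of "\<lambda>z. _ * z"] if_distrib[of "\<lambda>z. z * _"] mult_zero_left mult_zero_right)
qed

text \<open>In the raw frame the iterated image is block diagonal, with values of \<open>X\<close> as
  blocks.\<close>

lemma op_bound_iterate:
  assumes n: "n \<ge> 1" and t: "t \<in> {0..1}"
    and X: "\<And>t. t \<in> {0..1} \<Longrightarrow> op_bound {..<4 ^ n} {..<4 ^ n} (X t) C"
  shows "op_bound {..<4 ^ (n + Suc k)} {..<4 ^ (n + Suc k)} (iterate c n (Suc k) X t) C"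
proof -
  let ?I = "frame_indices n k" and ?J = "{..<(4::nat) ^ (n + Suc k)}" and ?r = "raw_frame c n t"
  let ?Y = "\<lambda>\<rho> \<mu>. if \<mu> = with_column \<rho> (column \<mu>) then X (index_point t \<rho>) (column \<rho>) (column \<mu>) else 0"
  have "op_bound ?I ?I ?Y C"
    unfolding op_bound_def
  proof
    fix u
    have "(\<Sum>\<rho>\<in>?I. (cmod (\<Sum>\<mu>\<in>?I. ?Y \<rho> \<mu> * u \<mu>))\<^sup>2) =
        (\<Sum>\<rho>\<in>?I. (cmod (\<Sum>l'<4 ^ n. X (index_point t \<rho>) (column \<rho>) l' * u (with_column \<rho> l')))\<^sup>2)"
    proof (rule sum.cong[OF refl])
      fix \<rho> assume \<rho>: "\<rho> \<in> ?I"
      have "(\<Sum>\<mu>\<in>?I. ?Y \<rho> \<mu> * u \<mu>) = (\<Sum>\<mu>\<in>?I. if \<mu> = with_column \<rho> (column \<mu>) then X (index_point t \<rho>) (column \<rho>) (column \<mu>) * u \<mu> else 0)"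
        by (intro sum.cong) auto
      also have "\<dots> = (\<Sum>l'<4 ^ n. X (index_point t \<rho>) (column \<rho>) l' * u (with_column \<rho> l'))"
        unfolding sum_with_column[OF \<rho>] by (simp add: column_def with_column_def split: prod.splits)
      finally show "(cmod (\<Sum>\<mu>\<in>?I. ?Y \<rho> \<mu> * u \<mu>))\<^sup>2 =
        (cmod (\<Sum>l'<4 ^ n. X (index_point t \<rho>) (column \<rho>) l' * u (with_column \<rho> l')))\<^sup>2" by simp
    qed
    also have "\<dots> = (\<Sum>\<kappa>\<in>words k. \<Sum>\<sigma>\<in>UNIV. \<Sum>j<2 ^ Suc k. \<Sum>l<4 ^ n.
        (cmod (\<Sum>l'<4 ^ n. X (point (\<sigma> # \<kappa>) j t) l l' * u (\<kappa>, \<sigma>, j, l')))\<^sup>2)"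
      unfolding sum_frame_indices by (simp add: index_point_def column_def with_column_def)
    also have "\<dots> \<le> (\<Sum>\<kappa>\<in>words k. \<Sum>\<sigma>\<in>UNIV. \<Sum>j<2 ^ Suc k. C\<^sup>2 * (\<Sum>l<4 ^ n. (cmod (u (\<kappa>, \<sigma>, j, l)))\<^sup>2))"
    proof (intro sum_mono)
      fix \<kappa> \<sigma> j assume "\<kappa> \<in> words k" "j \<in> {..<(2::nat) ^ Suc k}"
      then have "point (\<sigma> # \<kappa>) j t \<in> {0..1}" using t by (intro point_in) (auto simp: words_def)
      from X[OF this] show "(\<Sum>l<4 ^ n. (cmod (\<Sum>l'<4 ^ n. X (point (\<sigma> # \<kappa>) j t) l l' * u (\<kappa>, \<sigma>, j, l')))\<^sup>2)
        \<le> C\<^sup>2 * (\<Sum>l<4 ^ n. (cmod (u (\<kappa>, \<sigma>, j, l)))\<^sup>2)"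
        unfolding op_bound_def by (rule spec[where x = "\<lambda>l. u (\<kappa>, \<sigma>, j, l)"])
    qed
    also have "\<dots> = C\<^sup>2 * (\<Sum>\<mu>\<in>?I. (cmod (u \<mu>))\<^sup>2)"
      unfolding sum_frame_indices by (simp only: sum_distrib_left)
    finally show "(\<Sum>\<rho>\<in>?I. (cmod (\<Sum>\<mu>\<in>?I. ?Y \<rho> \<mu> * u \<mu>))\<^sup>2) \<le> C\<^sup>2 * (\<Sum>\<mu>\<in>?I. (cmod (u \<mu>))\<^sup>2)" .
  qed
  then have "op_bound ?J ?J (sandwich ?I ?r ?Y ?r) C"
    by (intro op_bound_sandwich raw_frame_orthonormal[OF n t]) (auto simp: card_frame_indices)
  then show ?thesis unfolding op_bound_def
    by (simp add: iterate_sandwich[OF n] del: iterate.simps power_Suc add_Suc_right)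
qed

lemma norm_emb_le:
  assumes n: "n \<ge> 1" and X: "cont_loop (4 ^ n) X" and C: "0 \<le> C"
    and b: "\<And>t. t \<in> {0..1} \<Longrightarrow> op_bound {..<4 ^ n} {..<4 ^ n} (X t) C"
  shows "norm (emb n X) \<le> C"
proof (rule LIMSEQ_le_const2[OF norm_limit[OF n X]], intro exI[of _ 1] allI impI)
  fix k :: nat assume "1 \<le> k"
  then obtain k' where k: "k = Suc k'" by (cases k) auto
  show "norm_of (circle_algebra (4 ^ (n + k))) (mat_fun (4 ^ (n + k)) (iterate c n k X)) \<le> C"
    unfolding k by (rule norm_of_le[OF op_bound_iterate[OF n _ b] C])
qed

lemma alpha_emb:
  assumes n: "n \<ge> 1" and X: "cont_loop (4 ^ n) X"
  shows "\<alpha> (emb n X) = emb n (\<lambda>t x y. row_sign n x * X t x y * row_sign n y)"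
proof -
  let ?d = "(4::nat) ^ n" let ?h = "(4::nat) ^ n div 2"
  let ?D = "\<lambda>t x y. if x = y then row_sign n x else 0"
  have h: "?d = 2 * ?h" by (rule half_power(1)[OF n])
  have "blackadar_unitary n = mat_fun ?d ?D"
    unfolding blackadar_unitary_def mat_fun_def
  proof (rule restrict_ext)
    fix t :: real
    show "block_diag (1\<^sub>m ?h) (- 1\<^sub>m ?h) = mat ?d ?d (\<lambda>(x, y). ?D t x y)"
      by (rule eq_matI) (use h in \<open>auto simp: block_diag_def row_sign_def\<close>)
  qed
  then have "Ad (blackadar_algebra n) (blackadar_unitary n) (mat_fun ?d X) =
      mat_fun ?d (\<lambda>t x y. \<Sum>z<?d. (\<Sum>w<?d. ?D t x w * X t w z) * cnj (?D t y z))"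
    unfolding Ad_def blackadar_algebra_def by (simp only: circle_algebra_ops)
  also have "\<dots> = mat_fun ?d (\<lambda>t x y. row_sign n x * X t x y * row_sign n y)"
  proof (rule mat_fun_cong)
    fix t x y assume xy: "x < ?d" "y < ?d"
    have 1: "(\<Sum>w<?d. ?D t x w * X t w z) = row_sign n x * X t x z" for z
    proof -
      have "(\<Sum>w<?d. ?D t x w * X t w z) = (\<Sum>w<?d. if x = w then row_sign n x * X t w z else 0)"
        by (intro sum.cong) auto
      then show ?thesis using xy by simp
    qed
    have "(\<Sum>z<?d. row_sign n x * X t x z * cnj (?D t y z)) = (\<Sum>z<?d. if y = z then row_sign n x * X t x z * row_sign n y else 0)"
      by (intro sum.cong) (auto simp: row_sign_def)
    then show "(\<Sum>z<?d. (\<Sum>w<?d. ?D t x w * X t w z) * cnj (?D t y z)) = row_sign n x * X t x y * row_sign n y"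
      unfolding 1 using xy by simp
  qed
  finally show ?thesis using automorphism n in_carrier[OF X] unfolding blackadar_automorphism_def emb_def by simp
qed

text \<open>The constant matrices over the closed frame. The frame consists of loops, so these are elements of
  the algebra of level \<open>n + k + 1\<close>.\<close>

definition rep :: "nat \<Rightarrow> nat \<Rightarrow> (frame_index \<Rightarrow> frame_index \<Rightarrow> complex) \<Rightarrow> 'a" where
  "rep n k Y = emb (n + Suc k) (\<lambda>t. sandwich (frame_indices n k) (closed_frame c n k t) Y (closed_frame c n k t))"

lemma sandwich_loop:
  assumes "n \<ge> 1"
  shows "cont_loop (4 ^ (n + Suc k)) (\<lambda>t. sandwich (frame_indices n k) (closed_frame c n k t) Y (closed_frame c n k t))"
  using closed_frame_closed[OF assms] closed_frame_continuous[OF assms]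
  unfolding cont_loop_def sandwich_def by (auto intro!: continuous_intros)

lemma rep_cong:
  "(\<And>\<rho> \<mu>. \<rho> \<in> frame_indices n k \<Longrightarrow> \<mu> \<in> frame_indices n k \<Longrightarrow> Y \<rho> \<mu> = Z \<rho> \<mu>) \<Longrightarrow> rep n k Y = rep n k Z"
  unfolding rep_def sandwich_def by (auto intro!: emb_cong sum.cong)

lemma rep_add:
  assumes "n \<ge> 1"
  shows "rep n k (\<lambda>\<rho> \<mu>. Y \<rho> \<mu> + Z \<rho> \<mu>) = rep n k Y + rep n k Z"
proof -
  have n': "n + Suc k \<ge> 1" by simp
  show ?thesis unfolding rep_def emb_add[OF n' sandwich_loop[OF assms] sandwich_loop[OF assms], symmetric]
    by (rule emb_cong) (simp add: sandwich_def algebra_simps sum.distrib)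
qed

lemma rep_scale:
  assumes "n \<ge> 1"
  shows "rep n k (\<lambda>\<rho> \<mu>. r * Y \<rho> \<mu>) = r *\<^sub>C rep n k Y"
proof -
  have n': "n + Suc k \<ge> 1" by simp
  show ?thesis unfolding rep_def emb_scale[OF n' sandwich_loop[OF assms], symmetric]
    by (rule emb_cong) (simp add: sandwich_def sum_distrib_left mult_ac)
qed

lemma rep_star:
  assumes "n \<ge> 1"
  shows "rep n k (\<lambda>\<rho> \<mu>. cnj (Y \<mu> \<rho>)) = star (rep n k Y)"
proof -
  have n': "n + Suc k \<ge> 1" by simp
  show ?thesis unfolding rep_def emb_star[OF n' sandwich_loop[OF assms], symmetric]
  proof (rule emb_cong)
    fix t x y
    show "sandwich (frame_indices n k) (closed_frame c n k t) (\<lambda>\<rho> \<mu>. cnj (Y \<mu> \<rho>)) (closed_frame c n k t) x y =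
       cnj (sandwich (frame_indices n k) (closed_frame c n k t) Y (closed_frame c n k t) y x)"
      unfolding sandwich_def by (subst sum.swap) (simp add: cnj_sum mult_ac)
  qed
qed

lemma rep_mult:
  assumes "n \<ge> 1"
  shows "rep n k Y * rep n k Z = rep n k (\<lambda>\<rho> \<mu>. \<Sum>\<nu>\<in>frame_indices n k. Y \<rho> \<nu> * Z \<nu> \<mu>)"
proof -
  have n': "n + Suc k \<ge> 1" by simp
  show ?thesis unfolding rep_def emb_mult[OF n' sandwich_loop[OF assms] sandwich_loop[OF assms], symmetric]
  proof (rule emb_cong)
    fix t :: real and x y :: nat assume t: "t \<in> {0..1}"
    let ?s = "sandwich (frame_indices n k) (closed_frame c n k t)" and ?F = "closed_frame c n k t"
    show "(\<Sum>z<4 ^ (n + Suc k). ?s Y ?F x z * ?s Z ?F z y) = ?s (\<lambda>\<rho> \<mu>. \<Sum>\<nu>\<in>frame_indices n k. Y \<rho> \<nu> * Z \<nu> \<mu>) ?F x y"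
      by (rule sandwich_mult) (use closed_frame_orthonormal[OF assms t] in auto)
  qed
qed

lemma sandwich_diag:
  assumes "finite I"
  shows "sandwich I U (diag_fun \<theta>) W x y = (\<Sum>\<mu>\<in>I. \<theta> \<mu> * U \<mu> x * cnj (W \<mu> y))"
  unfolding sandwich_def
proof (rule sum.cong[OF refl])
  fix \<rho> assume \<rho>: "\<rho> \<in> I"
  have "(\<Sum>\<mu>\<in>I. U \<rho> x * diag_fun \<theta> \<rho> \<mu> * cnj (W \<mu> y)) =
     (\<Sum>\<mu>\<in>I. if \<rho> = \<mu> then \<theta> \<rho> * U \<rho> x * cnj (W \<rho> y) else 0)"
    by (intro sum.cong refl) (simp add: diag_fun_def)
  then show "(\<Sum>\<mu>\<in>I. U \<rho> x * diag_fun \<theta> \<rho> \<mu> * cnj (W \<mu> y)) = \<theta> \<rho> * U \<rho> x * cnj (W \<rho> y)"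
    using assms \<rho> by simp
qed

lemma rep_one:
  assumes "n \<ge> 1"
  shows "rep n k (diag_fun (\<lambda>_. 1)) = 1"
proof -
  have n': "n + Suc k \<ge> 1" by simp
  show ?thesis unfolding rep_def emb_one[OF n', symmetric]
  proof (rule emb_cong)
    fix t :: real and x y :: nat assume t: "t \<in> {0..1}" "x < 4 ^ (n + Suc k)" "y < 4 ^ (n + Suc k)"
    show "sandwich (frame_indices n k) (closed_frame c n k t) (diag_fun (\<lambda>_. 1)) (closed_frame c n k t) x y = (if x = y then 1 else 0)"
      using square_orthonormal_complete[OF _ _ _ closed_frame_orthonormal[OF assms t(1), of k], of x y] t
      by (simp add: sandwich_diag card_frame_indices)
  qed
qed

lemma norm_rep_le:
  assumes "n \<ge> 1" "0 \<le> C" "op_bound (frame_indices n k) (frame_indices n k) Y C"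
  shows "norm (rep n k Y) \<le> C"
  unfolding rep_def
  by (rule norm_emb_le[OF _ sandwich_loop[OF assms(1)] assms(2)], simp,
      rule op_bound_sandwich[OF _ _ closed_frame_orthonormal[OF assms(1)] closed_frame_orthonormal[OF assms(1)] _ assms(3)])
     (auto simp: card_frame_indices)

text \<open>The grading sends a vector which is not a hole, up to a sign, to the vector with sum and
  difference exchanged; the sign cancels in rank one projections.\<close>

lemma alpha_rep_diag:
  assumes n: "n \<ge> 1" and \<theta>: "\<And>\<mu>. position \<mu> = 0 \<Longrightarrow> \<theta> \<mu> = 0"
  shows "\<alpha> (rep n k (diag_fun \<theta>)) = rep n k (diag_fun (\<theta> \<circ> flip_index))"
proof -
  have n': "n + Suc k \<ge> 1" by simp
  show ?thesis unfolding rep_def alpha_emb[OF n' sandwich_loop[OF n]]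
  proof (rule emb_cong)
    fix t :: real and x y :: nat assume xy: "x < 4 ^ (n + Suc k)" "y < 4 ^ (n + Suc k)"
    let ?I = "frame_indices n k" let ?B = "closed_frame c n k t" let ?e = "row_sign (n + Suc k)"
    have "?e x * (\<Sum>\<mu>\<in>?I. \<theta> \<mu> * ?B \<mu> x * cnj (?B \<mu> y)) * ?e y = (\<Sum>\<mu>\<in>?I. \<theta> \<mu> * ((?e x * ?B \<mu> x) * cnj (?e y * ?B \<mu> y)))"
    proof -
      have "cnj (?e y) = ?e y" by (simp add: row_sign_def)
      then show ?thesis by (simp add: sum_distrib_left sum_distrib_right mult_ac)
    qed
    also have "\<dots> = (\<Sum>\<mu>\<in>?I. \<theta> \<mu> * ?B (flip_index \<mu>) x * cnj (?B (flip_index \<mu>) y))"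
    proof (rule sum.cong[OF refl])
      fix \<mu> assume \<mu>: "\<mu> \<in> ?I"
      show "\<theta> \<mu> * ((?e x * ?B \<mu> x) * cnj (?e y * ?B \<mu> y)) = \<theta> \<mu> * ?B (flip_index \<mu>) x * cnj (?B (flip_index \<mu>) y)"
      proof (cases "position \<mu> = 0")
        case False
        obtain z where z: "z = 1 \<or> z = - 1" "\<And>t x. x < 4 ^ (n + Suc k) \<Longrightarrow>
           ?e x * closed_frame c n k t \<mu> x = z * closed_frame c n k t (flip_index \<mu>) x"
          using closed_frame_sign[OF n \<mu> False] by blast
        show ?thesis unfolding z(2)[OF xy(1)] z(2)[OF xy(2)] using z(1) by auto
      qed (simp add: \<theta>)
    qed
    also have "\<dots> = (\<Sum>\<mu>\<in>?I. (\<theta> \<circ> flip_index) \<mu> * ?B \<mu> x * cnj (?B \<mu> y))"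
      by (rule sum.reindex_bij_witness[where i = flip_index and j = flip_index])
         (auto simp: flip_index_def frame_indices_def)
    finally show "?e x * sandwich ?I ?B (diag_fun \<theta>) ?B x y * ?e y = sandwich ?I ?B (diag_fun (\<theta> \<circ> flip_index)) ?B x y"
      by (simp add: sandwich_diag)
  qed
qed

lemma mixing_near:
  assumes "mixing k t \<mu> \<rho> \<noteq> 0" "position \<mu> \<noteq> 0"
  shows "fst \<mu> = fst \<rho>" "position \<rho> = position \<mu> \<or> Suc (position \<rho>) = position \<mu>"
  using assms by (auto simp: mixing_def position_def rot_def split: prod.splits if_splits)

lemma index_point_near:
  assumes \<rho>: "\<rho> \<in> frame_indices n k" and t: "t \<in> {0..1}"
    and p: "position \<rho> = i \<or> Suc (position \<rho>) = i"
  shows "\<bar>index_point t \<rho> - real i / 2 ^ Suc k\<bar> \<le> 1 / 2 ^ Suc k"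
proof -
  obtain \<kappa> \<sigma> j l where r: "\<rho> = (\<kappa>, \<sigma>, j, l)" by (cases \<rho>)
  have \<kappa>: "length \<kappa> = k" using \<rho> by (simp add: r frame_indices_def words_def)
  define s where "s = side (sgn_word (\<sigma> # \<kappa>)) t"
  have s: "0 \<le> s" "s \<le> 1" using side_in[OF t, of "sgn_word (\<sigma> # \<kappa>)"] by (auto simp: s_def)
  have "index_point t \<rho> - real i / 2 ^ Suc k = (s + real j - real i) / 2 ^ Suc k"
    by (simp add: r index_point_def point_def \<kappa> s_def diff_divide_distrib del: sgn_word.simps)
  moreover have "\<bar>s + real j - real i\<bar> \<le> 1" using p s by (auto simp: r position_def)
  ultimately show ?thesis by (simp add: divide_right_mono abs_div_pos[symmetric] del: power_Suc)
qed

lemma norm_mixing_le: "cmod (mixing k t \<mu> \<rho>) \<le> 1"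
proof -
  have "cmod (hadamard i s \<sigma> * rot K \<tau> j i') \<le> 1 * 1" for i s \<sigma> K \<tau> j i'
    unfolding norm_mult by (intro mult_mono norm_hadamard_le norm_rot_le) auto
  then show ?thesis by (auto simp: mixing_def split: prod.splits)
qed

text \<open>A vector at position \<open>i \<ge> 1\<close> is a combination of raw vectors whose points are within \<open>1 / 2 ^ Suc k\<close> of \<open>i / 2 ^ Suc k\<close>. In the raw frame on the left and the closed frame on the
  right the error is a band matrix: every row and every column has at most \<open>4 \<cdot> 4\<^sup>n\<close> nonzero entries, a number which does not grow with \<open>k\<close>. The Schur test gives the bound.\<close>

lemma emb_close_to_sample:
  assumes n: "n \<ge> 1" and X: "cont_loop (4 ^ n) X" and w: "0 \<le> w"
    and mod: "\<And>s s' l l'. s \<in> {0..1} \<Longrightarrow> s' \<in> {0..1} \<Longrightarrow> \<bar>s - s'\<bar> \<le> 1 / 2 ^ Suc k \<Longrightarrow> l < 4 ^ n \<Longrightarrow> l' < 4 ^ n \<Longrightarrow>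
       cmod (X s l l' - X s' l l') \<le> w"
  shows "norm (emb n X * rep n k (diag_fun not_hole) - rep n k (sample k X)) \<le> real (4 * 4 ^ n) * w"
proof -
  let ?I = "frame_indices n k" and ?m = "n + Suc k" and ?J = "{..<(4::nat) ^ (n + Suc k)}"
  let ?B = "closed_frame c n k" and ?r = "raw_frame c n"
  define Y where "Y t \<rho> \<mu> = not_hole \<mu> * mixing k t \<mu> \<rho> *
     (X (index_point t \<rho>) (column \<rho>) (column \<mu>) - X (real (position \<mu>) / 2 ^ Suc k) (column \<rho>) (column \<mu>))" for t \<rho> \<mu>
  define E where "E t = sandwich ?I (?r t) (Y t) (?B t)" for t
  define M where "M t x y = (\<Sum>z<4 ^ ?m. iterate c n (Suc k) X t x z * sandwich ?I (?B t) (diag_fun not_hole) (?B t) z y)" for t x y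
  define S where "S t = sandwich ?I (?B t) (sample k X) (?B t)" for t
  have m: "?m \<ge> 1" by simp
  note il = iterate_loop[OF n X, of "Suc k"] sandwich_loop[OF n, of k]
  have loops: "cont_loop (4 ^ ?m) M" "cont_loop (4 ^ ?m) S"
    unfolding M_def S_def by (rule cont_loop_algebra(3)[OF il], rule il(2))
  have el: "emb n X * rep n k (diag_fun not_hole) - rep n k (sample k X) = emb ?m (\<lambda>t x y. M t x y - S t x y)"
  proof -
    have "emb ?m M = emb n X * rep n k (diag_fun not_hole)"
      unfolding M_def rep_def emb_iterate[OF n X, of "Suc k", symmetric] by (rule emb_mult[OF m il])
    moreover have "emb ?m S = rep n k (sample k X)" unfolding S_def rep_def ..
    ultimately show ?thesis using emb_diff[OF m loops] by simp
  qed
  have pt: "M t x y - S t x y = E t x y" if t: "t \<in> {0..1}" and x: "x < 4 ^ ?m" for t x y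
  proof -
    have "M t x y = (\<Sum>z<4 ^ ?m. \<Sum>\<mu>\<in>?I. not_hole \<mu> * cnj (?B t \<mu> y) * (iterate c n (Suc k) X t x z * ?B t \<mu> z))"
      unfolding M_def by (simp add: sandwich_diag sum_distrib_left mult_ac del: iterate.simps power_Suc add_Suc_right)
    also have "\<dots> = (\<Sum>\<mu>\<in>?I. not_hole \<mu> * cnj (?B t \<mu> y) * (\<Sum>z<4 ^ ?m. iterate c n (Suc k) X t x z * ?B t \<mu> z))"
      by (subst sum.swap) (simp add: sum_distrib_left del: iterate.simps power_Suc add_Suc_right)
    also have "\<dots> = (\<Sum>\<mu>\<in>?I. not_hole \<mu> * cnj (?B t \<mu> y) *
       (\<Sum>\<rho>\<in>?I. ?r t \<rho> x * (mixing k t \<mu> \<rho> * X (index_point t \<rho>) (column \<rho>) (column \<mu>))))"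
      by (intro sum.cong refl) (simp only: iterate_closed_frame[OF n t _ x])
    finally have 1: "M t x y = (\<Sum>\<mu>\<in>?I. not_hole \<mu> * cnj (?B t \<mu> y) *
       (\<Sum>\<rho>\<in>?I. ?r t \<rho> x * (mixing k t \<mu> \<rho> * X (index_point t \<rho>) (column \<rho>) (column \<mu>))))" .
    have "S t x y = (\<Sum>\<mu>\<in>?I. (\<Sum>\<nu>\<in>?I. ?B t \<nu> x * sample k X \<nu> \<mu>) * cnj (?B t \<mu> y))"
      unfolding S_def sandwich_def by (subst sum.swap) (simp add: sum_distrib_right)
    also have "\<dots> = (\<Sum>\<mu>\<in>?I. not_hole \<mu> * cnj (?B t \<mu> y) *
       (\<Sum>\<rho>\<in>?I. ?r t \<rho> x * (mixing k t \<mu> \<rho> * X (real (position \<mu>) / 2 ^ Suc k) (column \<rho>) (column \<mu>))))"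
    proof (rule sum.cong[OF refl])
      fix \<mu> assume \<mu>: "\<mu> \<in> ?I"
      let ?x = "real (position \<mu>) / 2 ^ Suc k"
      have "(\<Sum>\<nu>\<in>?I. ?B t \<nu> x * sample k X \<nu> \<mu>) =
         (\<Sum>\<nu>\<in>?I. if \<nu> = with_column \<mu> (column \<nu>) then not_hole \<mu> * ?B t \<nu> x * X ?x (column \<nu>) (column \<mu>) else 0)"
        by (intro sum.cong refl) (auto simp: sample_def not_hole_def)
      also have "\<dots> = (\<Sum>l<4 ^ n. not_hole \<mu> * ?B t (with_column \<mu> l) x * X ?x l (column \<mu>))"
        unfolding sum_with_column[OF \<mu>] by (simp add: column_def with_column_def split: prod.splits)
      also have "\<dots> = (\<Sum>l<4 ^ n. \<Sum>\<rho>\<in>?I. (if column \<rho> = l then not_hole \<mu> * mixing k t \<mu> \<rho> * ?r t \<rho> x * X ?x l (column \<mu>) else 0))"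
      proof (rule sum.cong[OF refl])
        fix l :: nat
        have wc: "mixing k t (with_column \<mu> l) \<rho> = mixing k t \<mu> \<rho>"
          "same_column (with_column \<mu> l) \<rho> = (if column \<rho> = l then 1 else 0)" for \<rho>
          by (auto simp: with_column_def mixing_def same_column_def column_def split: prod.splits)
        show "not_hole \<mu> * ?B t (with_column \<mu> l) x * X ?x l (column \<mu>) =
          (\<Sum>\<rho>\<in>?I. (if column \<rho> = l then not_hole \<mu> * mixing k t \<mu> \<rho> * ?r t \<rho> x * X ?x l (column \<mu>) else 0))"
          unfolding closed_frame_def wc sum_distrib_left sum_distrib_right
          by (intro sum.cong refl) auto
      qed
      also have "\<dots> = (\<Sum>\<rho>\<in>?I. \<Sum>l<4 ^ n. (if column \<rho> = l then not_hole \<mu> * mixing k t \<mu> \<rho> * ?r t \<rho> x * X ?x l (column \<mu>) else 0))"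
        by (rule sum.swap)
      also have "\<dots> = (\<Sum>\<rho>\<in>?I. not_hole \<mu> * mixing k t \<mu> \<rho> * ?r t \<rho> x * X ?x (column \<rho>) (column \<mu>))"
        by (intro sum.cong refl) (auto simp: frame_indices_def column_def)
      finally show "(\<Sum>\<nu>\<in>?I. ?B t \<nu> x * sample k X \<nu> \<mu>) * cnj (?B t \<mu> y) =
        not_hole \<mu> * cnj (?B t \<mu> y) * (\<Sum>\<rho>\<in>?I. ?r t \<rho> x * (mixing k t \<mu> \<rho> * X ?x (column \<rho>) (column \<mu>)))"
        by (simp add: sum_distrib_left mult_ac)
    qed
    finally have 2: "S t x y = (\<Sum>\<mu>\<in>?I. not_hole \<mu> * cnj (?B t \<mu> y) *
       (\<Sum>\<rho>\<in>?I. ?r t \<rho> x * (mixing k t \<mu> \<rho> * X (real (position \<mu>) / 2 ^ Suc k) (column \<rho>) (column \<mu>))))" .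
    have "E t x y = (\<Sum>\<mu>\<in>?I. \<Sum>\<rho>\<in>?I. ?r t \<rho> x * Y t \<rho> \<mu> * cnj (?B t \<mu> y))"
      unfolding E_def sandwich_def by (rule sum.swap)
    also have "\<dots> = M t x y - S t x y"
      unfolding 1 2 Y_def by (simp add: sum_subtractf[symmetric] sum_distrib_left algebra_simps)
    finally show ?thesis by simp
  qed
  have Yb: "cmod (Y t \<rho> \<mu>) \<le> w" if t: "t \<in> {0..1}" and \<rho>: "\<rho> \<in> ?I" and \<mu>: "\<mu> \<in> ?I" for t \<rho> \<mu>
  proof (cases "position \<mu> = 0 \<or> mixing k t \<mu> \<rho> = 0")
    case True
    then show ?thesis using w by (auto simp: Y_def not_hole_def)
  next
    case False
    have a: "index_point t \<rho> \<in> {0..1}" using \<rho> t point_in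
      by (auto simp: index_point_def frame_indices_def words_def simp del: atLeastAtMost_iff split: prod.splits)
    have "position \<mu> < 2 ^ Suc k" using \<mu> by (auto simp: position_def frame_indices_def)
    then have "real (position \<mu>) \<le> 2 ^ Suc k"
      by (metis less_imp_le of_nat_le_iff of_nat_numeral of_nat_power)
    then have b: "real (position \<mu>) / 2 ^ Suc k \<in> {0..1}" by simp
    have "\<bar>index_point t \<rho> - real (position \<mu>) / 2 ^ Suc k\<bar> \<le> 1 / 2 ^ Suc k"
      by (rule index_point_near[OF \<rho> t mixing_near(2)[of k t]]) (use False in auto)
    from mod[OF a b this] have d: "cmod (X (index_point t \<rho>) (column \<rho>) (column \<mu>) - X (real (position \<mu>) / 2 ^ Suc k) (column \<rho>) (column \<mu>)) \<le> w"
      using \<rho> \<mu> by (auto simp: column_def frame_indices_def)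
    have "cmod (Y t \<rho> \<mu>) \<le> 1 * w"
      using False mult_mono[OF norm_mixing_le d, of k t \<mu> \<rho>] by (simp add: Y_def not_hole_def norm_mult)
    then show ?thesis by simp
  qed
  have Y0: "Y t \<rho> \<mu> = 0" if "\<not> (fst \<mu> = fst \<rho> \<and> (position \<rho> = position \<mu> \<or> Suc (position \<rho>) = position \<mu>))" for t \<rho> \<mu>
    using that mixing_near[of k t \<mu> \<rho>] by (auto simp: Y_def not_hole_def)
  have Schur: "op_bound ?I ?I (Y t) (real (4 * 4 ^ n) * w)" if t: "t \<in> {0..1}" for t
  proof (rule op_bound_Schur)
    have card: "card ({\<kappa>} \<times> (UNIV::bool set) \<times> {a, b} \<times> {..<(4::nat) ^ n}) \<le> 4 * 4 ^ n" for \<kappa> :: "bool list" and a b :: nat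
    proof -
      have "card {a, b} \<le> 2" by (simp add: card_insert_if)
      then show ?thesis by (simp add: card_cartesian_product)
    qed
    fix \<rho> assume \<rho>: "\<rho> \<in> ?I"
    show "(\<Sum>\<mu>\<in>?I. cmod (Y t \<rho> \<mu>)) \<le> real (4 * 4 ^ n) * w"
    proof (rule sum_le_card_mult[where S = "{fst \<rho>} \<times> UNIV \<times> {position \<rho>, Suc (position \<rho>)} \<times> {..<4 ^ n}"])
      fix \<mu> assume \<mu>: "\<mu> \<in> ?I" "\<mu> \<notin> {fst \<rho>} \<times> UNIV \<times> {position \<rho>, Suc (position \<rho>)} \<times> {..<4 ^ n}"
      then have "Y t \<rho> \<mu> = 0" by (intro Y0) (auto simp: frame_indices_def position_def)
      then show "cmod (Y t \<rho> \<mu>) = 0" by simp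
    qed (use Yb[OF t \<rho>] w card in auto)
  next
    have card: "card ({\<kappa>} \<times> (UNIV::bool set) \<times> {a, b} \<times> {..<(4::nat) ^ n}) \<le> 4 * 4 ^ n" for \<kappa> :: "bool list" and a b :: nat
    proof -
      have "card {a, b} \<le> 2" by (simp add: card_insert_if)
      then show ?thesis by (simp add: card_cartesian_product)
    qed
    fix \<mu> assume \<mu>: "\<mu> \<in> ?I"
    show "(\<Sum>\<rho>\<in>?I. cmod (Y t \<rho> \<mu>)) \<le> real (4 * 4 ^ n) * w"
    proof (rule sum_le_card_mult[where S = "{fst \<mu>} \<times> UNIV \<times> {position \<mu>, position \<mu> - 1} \<times> {..<4 ^ n}"])
      fix \<rho> assume \<rho>: "\<rho> \<in> ?I" "\<rho> \<notin> {fst \<mu>} \<times> UNIV \<times> {position \<mu>, position \<mu> - 1} \<times> {..<4 ^ n}"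
      then have "Y t \<rho> \<mu> = 0" by (intro Y0) (auto simp: frame_indices_def position_def)
      then show "cmod (Y t \<rho> \<mu>) = 0" by simp
    qed (use Yb[OF t _ \<mu>] w card in auto)
  qed auto
  have "op_bound ?J ?J (E t) (real (4 * 4 ^ n) * w)" if t: "t \<in> {0..1}" for t
    unfolding E_def
    by (rule op_bound_sandwich[OF _ _ raw_frame_orthonormal[OF n t] closed_frame_orthonormal[OF n t] _ Schur[OF t]])
       (auto simp: card_frame_indices)
  then have ob: "op_bound ?J ?J (\<lambda>x y. M t x y - S t x y) (real (4 * 4 ^ n) * w)" if "t \<in> {0..1}" for t
    using that pt[OF that] unfolding op_bound_def by simp
  have "cont_loop (4 ^ ?m) (\<lambda>t x y. M t x y + (-1) * S t x y)"
    using loops by (intro cont_loop_algebra)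
  then have "cont_loop (4 ^ ?m) (\<lambda>t x y. M t x y - S t x y)" by simp
  then show ?thesis unfolding el by (intro norm_emb_le[OF m _ _ ob]) (use w in auto)
qed

end

section \<open>Diagonal projections and comparison\<close>

definition index_sign :: "frame_index \<Rightarrow> bool" where
  "index_sign = (\<lambda>(\<kappa>, s, i, l). s)"

definition hole :: "frame_index set" where
  "hole = {\<mu>. position \<mu> = 0}"

text \<open>With unit vectors \<open>w m\<close> and distinct positions \<open>g m\<close> this is a partial isometry from the hole to the vectors \<open>w m\<close> in the blocks \<open>(\<kappa>, s, g m)\<close>; the general form is closed
  under multiplication by block diagonal matrices.\<close>

definition hole_columns :: "(nat \<Rightarrow> nat) \<Rightarrow> (nat \<Rightarrow> nat \<Rightarrow> complex) \<Rightarrow> frame_index \<Rightarrow> frame_index \<Rightarrow> complex" where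
  "hole_columns g w \<rho> \<mu> = (if \<mu> \<in> hole \<and> fst \<rho> = fst \<mu> \<and> index_sign \<rho> = index_sign \<mu> \<and> position \<rho> = g (column \<mu>)
     then w (column \<mu>) (column \<rho>) else 0)"

lemma sum_hole_columns:
  assumes g: "\<And>m. m < 4 ^ n \<Longrightarrow> g m < 2 ^ Suc k" and \<mu>: "\<mu> \<in> frame_indices n k"
  shows "(\<Sum>\<nu>\<in>frame_indices n k. Z \<nu> * hole_columns g w \<nu> \<mu>) =
    (if \<mu> \<in> hole then \<Sum>l<4 ^ n. Z (fst \<mu>, index_sign \<mu>, g (column \<mu>), l) * w (column \<mu>) l else 0)"
proof (cases "\<mu> \<in> hole")
  case True
  obtain \<kappa> s i m where mu: "\<mu> = (\<kappa>, s, i, m)" by (cases \<mu>)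
  let ?\<mu> = "(\<kappa>, s, g m, 0)"
  have I: "?\<mu> \<in> frame_indices n k" using \<mu> g by (auto simp: mu frame_indices_def)
  have "(\<Sum>\<nu>\<in>frame_indices n k. Z \<nu> * hole_columns g w \<nu> \<mu>) =
    (\<Sum>\<nu>\<in>frame_indices n k. if \<nu> = with_column ?\<mu> (column \<nu>) then Z \<nu> * w m (column \<nu>) else 0)"
    using True by (intro sum.cong refl)
      (auto simp: hole_columns_def mu with_column_def column_def index_sign_def position_def split: prod.splits)
  then show ?thesis unfolding sum_with_column[OF I]
    using True by (simp add: mu with_column_def column_def index_sign_def)
qed (simp add: hole_columns_def)

lemma op_bound_diag:
  assumes "finite I" "0 \<le> C" "\<And>\<mu>. \<mu> \<in> I \<Longrightarrow> cmod (\<theta> \<mu>) \<le> C"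
  shows "op_bound I I (diag_fun \<theta>) C"
proof (rule op_bound_Schur)
  fix \<rho> assume \<rho>: "\<rho> \<in> I"
  have "(\<Sum>\<mu>\<in>I. cmod (diag_fun \<theta> \<rho> \<mu>)) = (\<Sum>\<mu>\<in>I. if \<rho> = \<mu> then cmod (\<theta> \<rho>) else 0)"
    by (intro sum.cong) (auto simp: diag_fun_def)
  then show "(\<Sum>\<mu>\<in>I. cmod (diag_fun \<theta> \<rho> \<mu>)) \<le> C" using assms \<rho> by simp
  have "(\<Sum>\<mu>\<in>I. cmod (diag_fun \<theta> \<mu> \<rho>)) = (\<Sum>\<mu>\<in>I. if \<mu> = \<rho> then cmod (\<theta> \<rho>) else 0)"
    by (intro sum.cong) (auto simp: diag_fun_def)
  then show "(\<Sum>\<mu>\<in>I. cmod (diag_fun \<theta> \<mu> \<rho>)) \<le> C" using assms \<rho> by simp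
qed (use assms in auto)

text \<open>Consecutive positions just above \<open>t K\<close>, shifted down if they would leave the range;
  position \<open>0\<close> is avoided because it is the hole.\<close>

lemma positions_near:
  assumes t: "t \<in> {0..1}" and K: "N + 1 \<le> K"
  obtains a where "\<And>m. m < N \<Longrightarrow> a + m < K \<and> 1 \<le> a \<and> \<bar>real (a + m) / real K - t\<bar> \<le> (real N + 1) / real K"
proof -
  define F where "F = nat \<lfloor>t * real K\<rfloor>"
  define b where "b = min F (K - N - 1)"
  have tK: "0 \<le> t * real K" "t * real K \<le> real K" using t by (auto simp: mult_left_le_one_le)
  have F: "real F \<le> t * real K" "t * real K < real F + 1"
    using tK(1) unfolding F_def by (auto simp: of_nat_nat)
  show ?thesis
  proof (rule that[of "b + 1"])
    fix m assume m: "m < N"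
    have bK: "b + 1 + m < K" using m K unfolding b_def by simp
    have "\<bar>real (b + 1 + m) - t * real K\<bar> \<le> real N + 1"
    proof (cases "F \<le> K - N - 1")
      case True
      then have "b = F" by (simp add: b_def)
      then show ?thesis using F m by simp
    next
      case False
      then have b: "b = K - N - 1" "K - N - 1 < F" by (auto simp: b_def)
      have "real K = real b + real N + 1" using b(1) K by simp
      moreover have "real b + 1 \<le> real F" "real (b + 1 + m) = real b + 1 + real m" "real m + 1 \<le> real N"
        using b m by auto
      ultimately show ?thesis using F tK by linarith
    qed
    then have "\<bar>real (b + 1 + m) - t * real K\<bar> / real K \<le> (real N + 1) / real K"
      by (intro divide_right_mono) auto
    moreover have "\<bar>real (b + 1 + m) - t * real K\<bar> / real K = \<bar>real (b + 1 + m) / real K - t\<bar>"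
    proof -
      have "real (b + 1 + m) / real K - t = (real (b + 1 + m) - t * real K) / real K"
        using K by (simp add: field_simps)
      then show ?thesis by (simp only: abs_divide abs_of_nat)
    qed
    ultimately show "b + 1 + m < K \<and> 1 \<le> b + 1 \<and> \<bar>real (b + 1 + m) / real K - t\<bar> \<le> (real N + 1) / real K"
      using bK by simp
  qed
qed

lemma eventually_modulus:
  assumes X: "cont_loop d X" and w: "0 < w"
  shows "eventually (\<lambda>k. \<forall>s\<in>{0..1}. \<forall>s'\<in>{0..1}. \<bar>s - s'\<bar> \<le> 1 / 2 ^ Suc k \<longrightarrow>
     (\<forall>l<d. \<forall>l'<d. cmod (X s l l' - X s' l l') \<le> w)) sequentially"
proof -
  have small: "eventually (\<lambda>k. 1 / 2 ^ Suc k < \<delta>) sequentially" if "0 < \<delta>" for \<delta> :: real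
  proof -
    have "(\<lambda>k. (1 / 2) ^ Suc k) \<longlonglongrightarrow> (0::real)" using LIMSEQ_Suc[OF LIMSEQ_realpow_zero[of "1/2::real"]] by simp
    then have "eventually (\<lambda>k. (1 / 2) ^ Suc k < \<delta>) sequentially" using that by (rule order_tendstoD)
    then show ?thesis by (simp add: power_one_over)
  qed
  have "eventually (\<lambda>k. \<forall>s\<in>{0..1}. \<forall>s'\<in>{0..1}. \<bar>s - s'\<bar> \<le> 1 / 2 ^ Suc k \<longrightarrow> cmod (X s l l' - X s' l l') \<le> w) sequentially"
    if l: "l < d" "l' < d" for l l'
  proof -
    have "uniformly_continuous_on {0..1} (\<lambda>t. X t l l')"
      using X l by (intro compact_uniformly_continuous) (auto simp: cont_loop_def)
    then obtain \<delta> where \<delta>: "\<delta> > 0" "\<And>s s'. s \<in> {0..1} \<Longrightarrow> s' \<in> {0..1} \<Longrightarrow> dist s' s < \<delta> \<Longrightarrow> dist (X s' l l') (X s l l') < w"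
      using w unfolding uniformly_continuous_on_def by metis
    show ?thesis using small[OF \<delta>(1)]
    proof eventually_elim
      case (elim k)
      show ?case
      proof (intro ballI impI)
        fix s s' :: real assume s: "s \<in> {0..1}" "s' \<in> {0..1}" "\<bar>s - s'\<bar> \<le> 1 / 2 ^ Suc k"
        then have "dist s s' < \<delta>" using elim by (simp add: dist_real_def)
        from \<delta>(2)[OF s(2,1) this] show "cmod (X s l l' - X s' l l') \<le> w" by (simp add: dist_norm)
      qed
    qed
  qed
  then have "eventually (\<lambda>k. \<forall>l\<in>{..<d}. \<forall>l'\<in>{..<d}. \<forall>s\<in>{0..1}. \<forall>s'\<in>{0..1}. \<bar>s - s'\<bar> \<le> 1 / 2 ^ Suc k \<longrightarrow> cmod (X s l l' - X s' l l') \<le> w) sequentially"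
    by (intro eventually_ball_finite[of "{..<d}"] ballI) auto
  then show ?thesis by eventually_elim auto
qed

lemma eventually_large_power: "eventually (\<lambda>k. B \<le> real (2 ^ Suc k)) sequentially"
proof -
  obtain m where m: "B < 2 ^ m" using real_arch_pow[of 2 B] by auto
  have "B \<le> real (2 ^ Suc k)" if "m \<le> k" for k
    using m power_increasing[of m "Suc k" "2::real"] that by simp
  then show ?thesis by (auto simp: eventually_sequentially)
qed

context blackadar_limit
begin

definition coord_proj :: "nat \<Rightarrow> nat \<Rightarrow> frame_index set \<Rightarrow> 'a" where
  "coord_proj n k A = rep n k (diag_fun (indicator A))"

lemma rep_diag_mult:
  assumes "n \<ge> 1"
  shows "rep n k (diag_fun \<theta>) * rep n k Y = rep n k (\<lambda>\<rho> \<mu>. \<theta> \<rho> * Y \<rho> \<mu>)"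
    "rep n k Y * rep n k (diag_fun \<theta>) = rep n k (\<lambda>\<rho> \<mu>. Y \<rho> \<mu> * \<theta> \<mu>)"
proof -
  have "(\<Sum>\<nu>\<in>frame_indices n k. diag_fun \<theta> \<rho> \<nu> * Y \<nu> \<mu>) = \<theta> \<rho> * Y \<rho> \<mu>" if "\<rho> \<in> frame_indices n k" for \<rho> \<mu>
  proof -
    have "(\<Sum>\<nu>\<in>frame_indices n k. diag_fun \<theta> \<rho> \<nu> * Y \<nu> \<mu>) = (\<Sum>\<nu>\<in>frame_indices n k. if \<rho> = \<nu> then \<theta> \<rho> * Y \<nu> \<mu> else 0)"
      by (intro sum.cong) (auto simp: diag_fun_def)
    then show ?thesis using that by simp
  qed
  then show "rep n k (diag_fun \<theta>) * rep n k Y = rep n k (\<lambda>\<rho> \<mu>. \<theta> \<rho> * Y \<rho> \<mu>)"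
    unfolding rep_mult[OF assms] by (intro rep_cong) auto
  have "(\<Sum>\<nu>\<in>frame_indices n k. Y \<rho> \<nu> * diag_fun \<theta> \<nu> \<mu>) = Y \<rho> \<mu> * \<theta> \<mu>" if "\<mu> \<in> frame_indices n k" for \<rho> \<mu>
  proof -
    have "(\<Sum>\<nu>\<in>frame_indices n k. Y \<rho> \<nu> * diag_fun \<theta> \<nu> \<mu>) = (\<Sum>\<nu>\<in>frame_indices n k. if \<nu> = \<mu> then Y \<rho> \<nu> * \<theta> \<mu> else 0)"
      by (intro sum.cong) (auto simp: diag_fun_def)
    then show ?thesis using that by simp
  qed
  then show "rep n k Y * rep n k (diag_fun \<theta>) = rep n k (\<lambda>\<rho> \<mu>. Y \<rho> \<mu> * \<theta> \<mu>)"
    unfolding rep_mult[OF assms] by (intro rep_cong) auto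
qed

lemma coord_proj_Int:
  assumes "n \<ge> 1" shows "coord_proj n k A * coord_proj n k B = coord_proj n k (A \<inter> B)"
  unfolding coord_proj_def rep_diag_mult(1)[OF assms]
  by (rule rep_cong) (auto simp: diag_fun_def indicator_def)

lemma coord_proj_star:
  assumes "n \<ge> 1" shows "star (coord_proj n k A) = coord_proj n k A"
  unfolding coord_proj_def rep_star[OF assms, symmetric]
  by (rule rep_cong) (auto simp: diag_fun_def indicator_def)

lemma projection_coord_proj: "n \<ge> 1 \<Longrightarrow> projection (coord_proj n k A)"
  by (simp add: projection_def coord_proj_Int coord_proj_star)

lemma coord_proj_UNIV: "n \<ge> 1 \<Longrightarrow> coord_proj n k UNIV = 1"
  using rep_one[of n k] by (simp add: coord_proj_def indicator_def)

lemma coord_proj_cong: "(\<And>\<mu>. \<mu> \<in> frame_indices n k \<Longrightarrow> \<mu> \<in> A \<longleftrightarrow> \<mu> \<in> B) \<Longrightarrow> coord_proj n k A = coord_proj n k B"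
  unfolding coord_proj_def by (rule rep_cong) (auto simp: diag_fun_def indicator_def)

lemma coord_proj_Un:
  assumes "n \<ge> 1" "A \<inter> B = {}"
  shows "coord_proj n k (A \<union> B) = coord_proj n k A + coord_proj n k B"
  unfolding coord_proj_def rep_add[OF assms(1), symmetric]
  by (rule rep_cong) (use assms(2) in \<open>auto simp: diag_fun_def indicator_def\<close>)

lemma coord_proj_empty: "n \<ge> 1 \<Longrightarrow> coord_proj n k {} = 0"
  using coord_proj_Un[of n "{}" "{}" k] by simp

lemma coord_proj_cle:
  assumes "n \<ge> 1" "A \<subseteq> B" shows "cle (coord_proj n k A) (coord_proj n k B)"
proof -
  have "coord_proj n k B = coord_proj n k A + coord_proj n k (B - A)"
    using coord_proj_Un[OF assms(1), of A "B - A" k] assms(2) by (simp add: Un_absorb1)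
  then show ?thesis unfolding cle_def cpositive_def
    using coord_proj_star[OF assms(1)] coord_proj_Int[OF assms(1)] by (metis Int_absorb add_diff_cancel_left')
qed

lemma coord_proj_mvn:
  assumes n: "n \<ge> 1" and f: "bij_betw f (A \<inter> frame_indices n k) (B \<inter> frame_indices n k)"
  shows "mvn_equiv (coord_proj n k A) (coord_proj n k B)"
proof -
  let ?I = "frame_indices n k"
  define V where "V \<rho> \<mu> = (if \<mu> \<in> A \<and> \<rho> = f \<mu> then 1 else (0::complex))" for \<rho> \<mu>
  have fI: "f \<mu> \<in> ?I" "f \<mu> \<in> B" if "\<mu> \<in> A" "\<mu> \<in> ?I" for \<mu> using f that by (auto simp: bij_betw_def)
  have inj: "f \<mu> = f \<rho> \<Longrightarrow> \<mu> = \<rho>" if "\<mu> \<in> A" "\<mu> \<in> ?I" "\<rho> \<in> A" "\<rho> \<in> ?I" for \<mu> \<rho>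
    using f that by (auto simp: bij_betw_def inj_on_def)
  have "star (rep n k V) * rep n k V = coord_proj n k A"
    unfolding coord_proj_def rep_star[OF n, symmetric] rep_mult[OF n]
  proof (rule rep_cong)
    fix \<rho> \<mu> assume i: "\<rho> \<in> ?I" "\<mu> \<in> ?I"
    have "(\<Sum>\<nu>\<in>?I. cnj (V \<nu> \<rho>) * V \<nu> \<mu>) = (\<Sum>\<nu>\<in>?I. if \<nu> = f \<mu> then diag_fun (indicator A) \<rho> \<mu> else 0)"
      by (intro sum.cong refl) (use i inj in \<open>auto simp: V_def diag_fun_def\<close>)
    also have "\<dots> = diag_fun (indicator A) \<rho> \<mu>"
      using fI[of \<mu>] i by (auto simp: diag_fun_def indicator_def)
    finally show "(\<Sum>\<nu>\<in>?I. cnj (V \<nu> \<rho>) * V \<nu> \<mu>) = diag_fun (indicator A) \<rho> \<mu>" .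
  qed
  moreover have "rep n k V * star (rep n k V) = coord_proj n k B"
    unfolding coord_proj_def rep_star[OF n, symmetric] rep_mult[OF n]
  proof (rule rep_cong)
    fix \<rho> \<mu> assume i: "\<rho> \<in> ?I" "\<mu> \<in> ?I"
    show "(\<Sum>\<nu>\<in>?I. V \<rho> \<nu> * cnj (V \<mu> \<nu>)) = diag_fun (indicator B) \<rho> \<mu>"
    proof (cases "\<rho> \<in> B")
      case False
      then have "V \<rho> \<nu> = 0" if "\<nu> \<in> ?I" for \<nu> using fI(2)[OF _ that] by (auto simp: V_def)
      then show ?thesis using False by (auto simp: diag_fun_def indicator_def)
    next
      case True
      then have "\<rho> \<in> f ` (A \<inter> ?I)" using f i by (simp add: bij_betw_def)
      then obtain \<nu>0 where 0: "\<nu>0 \<in> A" "\<nu>0 \<in> ?I" "f \<nu>0 = \<rho>" by blast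
      have "(\<Sum>\<nu>\<in>?I. V \<rho> \<nu> * cnj (V \<mu> \<nu>)) = (\<Sum>\<nu>\<in>?I. if \<nu> = \<nu>0 then diag_fun (indicator B) \<rho> \<mu> else 0)"
        by (intro sum.cong refl) (use 0 inj True in \<open>auto simp: V_def diag_fun_def\<close>)
      then show ?thesis using 0 by simp
    qed
  qed
  ultimately show ?thesis unfolding mvn_equiv_def by blast
qed

lemma not_hole_indicator: "not_hole = indicator (- hole)"
  by (auto simp: not_hole_def hole_def indicator_def)

text \<open>The hole has \<open>4\<^sup>n\<close> vectors for every pair \<open>(\<kappa>, s)\<close>, so
  \<open>4\<^sup>n\<close> positions near \<open>t0\<close> are needed; they exist for large \<open>k\<close>.
  The matrix \<open>y\<close> puts a copy of \<open>v\<close> in each of them. Different positions are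
  orthogonal and block diagonal matrices do not mix them, hence \<open>y\<^sup>* X y\<close> is almost
  diagonal with entries close to \<open>\<langle>X(t0) v, v\<rangle>\<close>.\<close>

lemma hole_projection_comparison:
  assumes n: "n \<ge> 1" and b: "b \<noteq> 0" and G: "cont_loop (4 ^ n) G" "norm (b - emb n G) < norm b / 8"
  shows "eventually (\<lambda>k. \<exists>z. star z * (b * star b) * z = coord_proj n k hole \<and> z * coord_proj n k hole = z) sequentially"
proof -
  define r where "r = norm b"
  have r: "r > 0" using b by (simp add: r_def)
  define d where "d = (4::nat) ^ n"
  have d: "d > 0" by (simp add: d_def)
  define Gs where "Gs t x y = cnj (G t y x)" for t x y
  have Gs: "cont_loop (4 ^ n) Gs" unfolding Gs_def by (rule cont_loop_algebra(4)[OF G(1) G(1)])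
  have eGs: "emb n Gs = star (emb n G)" unfolding Gs_def by (rule emb_star[OF n G(1)])
  define g where "g = emb n G"
  have bg: "norm (b - g) < r / 8" using G(2) by (simp add: g_def r_def)
  have ng: "norm g > 7 / 8 * r" "norm g < 9 / 8 * r"
    using bg norm_triangle_ineq2[of b g] norm_triangle_ineq2[of g b] by (auto simp: r_def norm_minus_commute)
  have "\<not> (\<forall>t\<in>{0..1}. op_bound {..<d} {..<d} (Gs t) (7 / 8 * r))"
  proof
    assume "\<forall>t\<in>{0..1}. op_bound {..<d} {..<d} (Gs t) (7 / 8 * r)"
    then have "norm (emb n Gs) \<le> 7 / 8 * r"
      unfolding d_def by (intro norm_emb_le[OF n Gs]) (use r in auto)
    then show False using ng(1) by (simp add: eGs g_def)
  qed
  then obtain t0 u where t0: "t0 \<in> {0..1}"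
    and u: "(\<Sum>x<d. (cmod (\<Sum>y<d. Gs t0 x y * u y))\<^sup>2) > (7 / 8 * r)\<^sup>2 * (\<Sum>y<d. (cmod (u y))\<^sup>2)"
    unfolding op_bound_def by (auto simp: not_le)
  define S where "S = (\<Sum>y<d. (cmod (u y))\<^sup>2)"
  have S: "S > 0"
  proof (rule ccontr)
    assume "\<not> S > 0"
    then have "S = 0" using sum_nonneg[of "{..<d}" "\<lambda>y. (cmod (u y))\<^sup>2"] by (simp add: S_def)
    then have "u y = 0" if "y < d" for y
      using that unfolding S_def by (subst (asm) sum_nonneg_eq_0_iff) auto
    then show False using u by simp
  qed
  define v where "v y = u y / complex_of_real (sqrt S)" for y
  have v1: "(\<Sum>y<d. (cmod (v y))\<^sup>2) = 1"
    using S by (simp add: v_def norm_divide power_divide S_def flip: sum_divide_distrib)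
  have vle: "cmod (v y) \<le> 1" if "y < d" for y
  proof -
    have "(cmod (v y))\<^sup>2 \<le> (\<Sum>y<d. (cmod (v y))\<^sup>2)" using that by (intro member_le_sum) auto
    then show ?thesis unfolding v1 by (simp add: power_le_one_iff)
  qed
  \<comment> \<open>the constants: \<open>g\<close> is within \<open>r/8\<close> of \<open>b\<close>, so \<open>lam\<close> exceeds
      \<open>(7r/8)\<^sup>2 = 49 r\<^sup>2/64\<close>, while the errors add up to \<open>(17 + 4 + 1) r\<^sup>2/64\<close>\<close>
  define lam where "lam = (\<Sum>x<d. (cmod (\<Sum>y<d. Gs t0 x y * v y))\<^sup>2)"
  have lam: "lam > 49 / 64 * r\<^sup>2"
  proof -
    have "(\<Sum>y<d. Gs t0 x y * v y) = (\<Sum>y<d. Gs t0 x y * u y) / complex_of_real (sqrt S)" for x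
      by (simp add: v_def sum_divide_distrib)
    then have "lam = (\<Sum>x<d. (cmod (\<Sum>y<d. Gs t0 x y * u y))\<^sup>2) / S"
      using S by (simp add: lam_def norm_divide power_divide flip: sum_divide_distrib)
    then show ?thesis using u S by (simp add: S_def[symmetric] less_divide_eq power_mult_distrib power_divide)
  qed
  define X where "X t x y = (\<Sum>z<4 ^ n. G t x z * Gs t z y)" for t x y
  have X: "cont_loop (4 ^ n) X" unfolding X_def by (rule cont_loop_algebra(3)[OF G(1) Gs])
  have eX: "emb n X = g * star g" unfolding X_def emb_mult[OF n G(1) Gs] eGs g_def ..
  define Q where "Q s = (\<Sum>l<d. cnj (v l) * (\<Sum>l'<d. X s l l' * v l'))" for s
  have Qt0: "Q t0 = complex_of_real lam"
  proof -
    have "Q t0 = (\<Sum>l<d. \<Sum>l'<d. \<Sum>z<d. cnj (Gs t0 z l * v l) * (Gs t0 z l' * v l'))"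
      unfolding Q_def X_def d_def[symmetric] by (simp add: Gs_def sum_distrib_left sum_distrib_right mult_ac)
    also have "\<dots> = (\<Sum>l<d. \<Sum>z<d. \<Sum>l'<d. cnj (Gs t0 z l * v l) * (Gs t0 z l' * v l'))"
      by (intro sum.cong refl sum.swap)
    also have "\<dots> = (\<Sum>z<d. \<Sum>l<d. \<Sum>l'<d. cnj (Gs t0 z l * v l) * (Gs t0 z l' * v l'))" by (rule sum.swap)
    also have "\<dots> = (\<Sum>z<d. (\<Sum>y<d. Gs t0 z y * v y) * cnj (\<Sum>y<d. Gs t0 z y * v y))"
      unfolding cnj_sum sum_product by (subst sum.swap) (simp add: mult_ac)
    also have "\<dots> = complex_of_real lam" unfolding lam_def of_real_sum complex_norm_square ..
    finally show ?thesis .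
  qed
  define w where "w = r\<^sup>2 / (64 * (real d)\<^sup>2)"
  have w: "w > 0" using r d by (simp add: w_def)
  have dw: "real (4 * d) * w \<le> r\<^sup>2 / 16" "(real d)\<^sup>2 * w = r\<^sup>2 / 64"
  proof -
    show 2: "(real d)\<^sup>2 * w = r\<^sup>2 / 64" using d by (simp add: w_def)
    have "real d \<le> (real d)\<^sup>2" using d by (simp add: power2_eq_square)
    then have "real (4 * d) * w \<le> 4 * ((real d)\<^sup>2 * w)" using w by simp
    then show "real (4 * d) * w \<le> r\<^sup>2 / 16" unfolding 2 by simp
  qed
  obtain k0 where k0: "\<forall>s\<in>{0..1}. \<forall>s'\<in>{0..1}. \<bar>s - s'\<bar> \<le> 1 / 2 ^ Suc k0 \<longrightarrow>
     (\<forall>l<4 ^ n. \<forall>l'<4 ^ n. cmod (X s l l' - X s' l l') \<le> w)"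
    using eventually_happens[OF eventually_modulus[OF X w]] by auto
  have Qnear: "cmod (Q s - complex_of_real lam) \<le> r\<^sup>2 / 64" if s: "s \<in> {0..1}" "\<bar>s - t0\<bar> \<le> 1 / 2 ^ Suc k0" for s
  proof -
    have "Q s - Q t0 = (\<Sum>l<d. \<Sum>l'<d. cnj (v l) * ((X s l l' - X t0 l l') * v l'))"
      unfolding Q_def by (simp add: sum_distrib_left algebra_simps flip: sum_subtractf)
    also have "cmod \<dots> \<le> (\<Sum>l<d. \<Sum>l'<d. w)"
    proof (intro sum_norm_le)
      fix l l' assume l: "l \<in> {..<d}" "l' \<in> {..<d}"
      have x: "cmod (X s l l' - X t0 l l') \<le> w" using k0 s t0 l unfolding d_def by blast
      have "cmod (cnj (v l) * ((X s l l' - X t0 l l') * v l')) \<le> 1 * (w * 1)"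
        unfolding norm_mult complex_mod_cnj using l w by (intro mult_mono x vle) auto
      then show "cmod (cnj (v l) * ((X s l l' - X t0 l l') * v l')) \<le> w" by simp
    qed
    also have "\<dots> = r\<^sup>2 / 64" using dw(2) by (simp add: power2_eq_square)
    finally show ?thesis unfolding Qt0 .
  qed
  have ev: "eventually (\<lambda>k. (real d + 1) * 2 ^ Suc k0 \<le> real (2 ^ Suc k)) sequentially"
    by (rule eventually_large_power)
  show ?thesis using ev eventually_modulus[OF X w]
  proof eventually_elim
    case (elim k)
    define K where "K = (2::nat) ^ Suc k"
    have Kb: "(real d + 1) * 2 ^ Suc k0 \<le> real K" using elim(1) by (simp add: K_def)
    have "(real d + 1) * 1 \<le> (real d + 1) * 2 ^ Suc k0" by (intro mult_left_mono one_le_power) auto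
    moreover have "real (d + 1) = (real d + 1) * 1" by simp
    ultimately have "real (d + 1) \<le> real K" using Kb by linarith
    then have dK: "d + 1 \<le> K" by (simp only: of_nat_le_iff)
    obtain a where a: "\<And>m. m < d \<Longrightarrow> a + m < K \<and> 1 \<le> a \<and> \<bar>real (a + m) / real K - t0\<bar> \<le> (real d + 1) / real K"
      using positions_near[OF t0 dK] by blast
    have K0: "real K > 0" by (simp add: K_def)
    have near: "(real d + 1) / real K \<le> 1 / 2 ^ Suc k0"
      using Kb K0 by (simp add: field_simps del: power_Suc)
    define f where "f m = a + m" for m
    have f: "f m < 2 ^ Suc k" "f m \<noteq> 0" "f m = f m' \<Longrightarrow> m = m'" if "m < 4 ^ n" for m m'
      using a[of m] that by (auto simp: f_def K_def d_def)
    have Qf: "cmod (Q (real (f m) / 2 ^ Suc k) - complex_of_real lam) \<le> r\<^sup>2 / 64" if "m < d" for m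
    proof (rule Qnear)
      have "real (f m) \<le> real K" using a[OF that] by (simp add: f_def)
      then have "real (f m) / real K \<in> {0..1}" using K0 by simp
      then show "real (f m) / 2 ^ Suc k \<in> {0..1}" by (simp add: K_def)
      have "\<bar>real (f m) / real K - t0\<bar> \<le> 1 / 2 ^ Suc k0" using a[OF that] near unfolding f_def by linarith
      then show "\<bar>real (f m) / 2 ^ Suc k - t0\<bar> \<le> 1 / 2 ^ Suc k0" by (simp add: K_def)
    qed
    let ?I = "frame_indices n k"
    have colI: "column \<mu> < 4 ^ n" if "\<mu> \<in> ?I" for \<mu> using that by (auto simp: frame_indices_def column_def)
    define y where "y = rep n k (hole_columns f (\<lambda>_. v))"
    let ?p = "coord_proj n k hole"
    have gram: "star (rep n k (hole_columns f W)) * rep n k (hole_columns f W') =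
       rep n k (diag_fun (\<lambda>\<mu>. if \<mu> \<in> hole then \<Sum>l<d. cnj (W (column \<mu>) l) * W' (column \<mu>) l else 0))" for W W'
      unfolding rep_star[OF n, symmetric] rep_mult[OF n]
    proof (rule rep_cong)
      fix \<rho> \<mu> assume i: "\<rho> \<in> ?I" "\<mu> \<in> ?I"
      have e: "hole_columns f W (fst \<mu>, index_sign \<mu>, f (column \<mu>), l) \<rho> = (if \<rho> = \<mu> then W (column \<mu>) l else 0)"
        if "\<mu> \<in> hole" "l < 4 ^ n" for l
        using that f(3)[OF colI[OF i(1)], of "column \<mu>"] colI[OF i(2)]
        by (cases \<rho>; cases \<mu>) (auto simp: hole_columns_def hole_def position_def column_def index_sign_def)
      show "(\<Sum>\<nu>\<in>?I. cnj (hole_columns f W \<nu> \<rho>) * hole_columns f W' \<nu> \<mu>) =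
        diag_fun (\<lambda>\<mu>. if \<mu> \<in> hole then \<Sum>l<d. cnj (W (column \<mu>) l) * W' (column \<mu>) l else 0) \<rho> \<mu>"
      proof -
        have "(\<Sum>\<nu>\<in>?I. cnj (hole_columns f W \<nu> \<rho>) * hole_columns f W' \<nu> \<mu>) =
          (if \<mu> \<in> hole then \<Sum>l<4 ^ n. cnj (hole_columns f W (fst \<mu>, index_sign \<mu>, f (column \<mu>), l) \<rho>) * W' (column \<mu>) l else 0)"
          by (rule sum_hole_columns[OF f(1) i(2)])
        then show ?thesis using e
          by (auto simp: diag_fun_def d_def intro!: sum.cong sum.neutral)
      qed
    qed
    have yy: "star y * y = ?p"
    proof -
      have "(\<Sum>l<d. cnj (v l) * v l) = complex_of_real (\<Sum>l<d. (cmod (v l))\<^sup>2)"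
        unfolding of_real_sum complex_norm_square by (simp add: mult.commute)
      then have "(\<Sum>l<d. cnj (v l) * v l) = 1" unfolding v1 by simp
      then show ?thesis unfolding y_def gram coord_proj_def
        by (intro rep_cong) (auto simp: diag_fun_def indicator_def)
    qed
    have pp: "projection ?p" by (rule projection_coord_proj[OF n])
    have ny: "norm y \<le> 1"
    proof -
      have "(norm y)\<^sup>2 \<le> 1" using cstar_identity[of y] norm_projection_le[OF pp] by (simp add: yy)
      then show ?thesis by (simp add: power_le_one_iff)
    qed
    have yp: "y * ?p = y" unfolding y_def coord_proj_def rep_diag_mult(2)[OF n]
      by (rule rep_cong) (auto simp: hole_columns_def)
    have Qy: "rep n k (diag_fun not_hole) * y = y" unfolding y_def rep_diag_mult(1)[OF n]
    proof (rule rep_cong)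
      fix \<rho> \<mu> assume "\<mu> \<in> ?I"
      then have "f (column \<mu>) \<noteq> 0" by (intro f(2) colI)
      then show "not_hole \<rho> * hole_columns f (\<lambda>_. v) \<rho> \<mu> = hole_columns f (\<lambda>_. v) \<rho> \<mu>"
        by (auto simp: hole_columns_def not_hole_def)
    qed
    have sy: "rep n k (sample k X) * y = rep n k (hole_columns f (\<lambda>m l. \<Sum>l'<d. X (real (f m) / 2 ^ Suc k) l l' * v l'))"
      unfolding y_def rep_mult[OF n]
    proof (rule rep_cong)
      fix \<rho> \<mu> assume i: "\<rho> \<in> ?I" "\<mu> \<in> ?I"
      have "sample k X \<rho> (fst \<mu>, index_sign \<mu>, f (column \<mu>), l) =
        (if fst \<rho> = fst \<mu> \<and> index_sign \<rho> = index_sign \<mu> \<and> position \<rho> = f (column \<mu>) then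
          X (real (f (column \<mu>)) / 2 ^ Suc k) (column \<rho>) l else 0)" for l
        using f(2)[OF colI[OF i(2)]]
        by (cases \<rho>; cases \<mu>) (auto simp: sample_def with_column_def position_def column_def index_sign_def)
      note samp = this
      have S: "(\<Sum>\<nu>\<in>?I. sample k X \<rho> \<nu> * hole_columns f (\<lambda>_. v) \<nu> \<mu>) =
          (if \<mu> \<in> hole then \<Sum>l<4 ^ n. sample k X \<rho> (fst \<mu>, index_sign \<mu>, f (column \<mu>), l) * v l else 0)"
        by (rule sum_hole_columns[OF f(1) i(2)])
      show "(\<Sum>\<nu>\<in>?I. sample k X \<rho> \<nu> * hole_columns f (\<lambda>_. v) \<nu> \<mu>) =
        hole_columns f (\<lambda>m l. \<Sum>l'<d. X (real (f m) / 2 ^ Suc k) l l' * v l') \<rho> \<mu>"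
        unfolding S samp by (auto simp: hole_columns_def d_def)
    qed
    define q where "q \<mu> = (if \<mu> \<in> hole then Q (real (f (column \<mu>)) / 2 ^ Suc k) else 0)" for \<mu>
    have ysy: "star y * (rep n k (sample k X) * y) = rep n k (diag_fun q)"
      unfolding sy unfolding y_def gram by (rule rep_cong) (simp add: diag_fun_def q_def Q_def)
    have lp: "lam *\<^sub>R ?p = rep n k (\<lambda>\<rho> \<mu>. complex_of_real lam * diag_fun (indicator hole) \<rho> \<mu>)"
      unfolding rep_scale[OF n] coord_proj_def scaleC_of_real ..
    have d1: "norm (rep n k (diag_fun q) - lam *\<^sub>R ?p) \<le> r\<^sup>2 / 64"
    proof -
      have "rep n k (diag_fun q) = rep n k (diag_fun (\<lambda>\<mu>. q \<mu> - complex_of_real lam * indicator hole \<mu>)) + lam *\<^sub>R ?p"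
        unfolding lp rep_add[OF n, symmetric] by (rule rep_cong) (simp add: diag_fun_def)
      moreover have "norm (rep n k (diag_fun (\<lambda>\<mu>. q \<mu> - complex_of_real lam * indicator hole \<mu>))) \<le> r\<^sup>2 / 64"
        by (intro norm_rep_le[OF n] op_bound_diag) (use Qf colI in \<open>auto simp: q_def d_def indicator_def\<close>)
      ultimately show ?thesis by simp
    qed
    have d2: "norm (emb n X * y - rep n k (sample k X) * y) \<le> r\<^sup>2 / 16"
    proof -
      have "norm (emb n X * rep n k (diag_fun not_hole) - rep n k (sample k X)) \<le> real (4 * 4 ^ n) * w"
        by (rule emb_close_to_sample[OF n X]) (use w elim(2) in auto)
      then have 1: "norm (emb n X * rep n k (diag_fun not_hole) - rep n k (sample k X)) \<le> r\<^sup>2 / 16"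
        using dw(1) unfolding d_def by linarith
      have "emb n X * y - rep n k (sample k X) * y = (emb n X * rep n k (diag_fun not_hole) - rep n k (sample k X)) * y"
        using Qy by (simp add: left_diff_distrib mult.assoc)
      also have "norm \<dots> \<le> (r\<^sup>2 / 16) * 1"
        using 1 ny by (intro order_trans[OF norm_mult_ineq] mult_mono) auto
      finally show ?thesis by simp
    qed
    have d3: "norm (b * star b - emb n X) \<le> 17 / 64 * r\<^sup>2"
    proof -
      have "b * star b - emb n X = (b - g) * star b + g * star (b - g)"
        unfolding eX by (simp add: star_diff algebra_simps)
      also have "norm \<dots> \<le> norm (b - g) * norm b + norm g * norm (b - g)"
        by (intro order_trans[OF norm_triangle_ineq] add_mono order_trans[OF norm_mult_ineq]) auto
      also have "\<dots> \<le> (r / 8) * r + (9 / 8 * r) * (r / 8)"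
        using bg ng(2) r by (intro add_mono mult_mono) (auto simp: r_def)
      also have "\<dots> = 17 / 64 * r\<^sup>2" by (simp add: power2_eq_square)
      finally show ?thesis .
    qed
    let ?A = "star y * ((b * star b - emb n X) * y)" and ?B = "star y * (emb n X * y - rep n k (sample k X) * y)"
      and ?C = "rep n k (diag_fun q) - lam *\<^sub>R ?p"
    have "star y * (b * star b) * y - lam *\<^sub>R ?p = ?A + ?B + ?C"
      unfolding ysy[symmetric] by (simp add: algebra_simps mult.assoc)
    also have "norm \<dots> \<le> norm ?A + norm ?B + norm ?C"
      using norm_triangle_ineq[of "?A + ?B" ?C] norm_triangle_ineq[of ?A ?B] by linarith
    also have "\<dots> \<le> 1 * (17 / 64 * r\<^sup>2 * 1) + 1 * (r\<^sup>2 / 16) + r\<^sup>2 / 64"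
    proof (intro add_mono d1)
      show "norm ?A \<le> 1 * (17 / 64 * r\<^sup>2 * 1)"
        using d3 ny by (intro order_trans[OF norm_mult_ineq] mult_mono) auto
      show "norm ?B \<le> 1 * (r\<^sup>2 / 16)"
        using d2 ny by (intro order_trans[OF norm_mult_ineq] mult_mono) auto
    qed
    also have "\<dots> < lam" using lam zero_less_power[OF r, of 2] by linarith
    finally have main: "norm (star y * (b * star b) * y - lam *\<^sub>R ?p) < lam" .
    have "lam > 0" using lam zero_less_power[OF r, of 2] by linarith
    have "star (b * star b) = b * star b" by (simp add: star_mult star_star)
    then obtain z where "star z * (b * star b) * z = ?p" "z * ?p = z"
      using self_adjoint_normalize[OF pp _ yp \<open>lam > 0\<close> main] by blast
    then show ?case by blast
  qed
qed

section \<open>Simplicity and the order of the automorphism\<close>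

lemma finite_approximation:
  assumes "finite F" "0 < \<delta>"
  obtains n where "n \<ge> 1" "\<And>a. a \<in> F \<Longrightarrow> \<exists>X. cont_loop (4 ^ n) X \<and> norm (a - emb n X) < \<delta>"
proof -
  have one: "\<exists>n\<ge>1. \<exists>X. cont_loop (4 ^ n) X \<and> norm (a - emb n X) < \<delta>" for a
  proof -
    have "a \<in> closure (\<Union>n\<in>{1..}. \<iota> n ` carrier (blackadar_algebra n))"
      using limit by (simp add: inductive_limit_def)
    then have "\<exists>y\<in>\<Union>n\<in>{1..}. \<iota> n ` carrier (blackadar_algebra n). dist y a < \<delta>"
      using assms(2) by (simp only: closure_approachable)
    then obtain y where "y \<in> (\<Union>n\<in>{1..}. \<iota> n ` carrier (blackadar_algebra n))" "dist y a < \<delta>" by metis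
    then obtain n f where nf: "n \<ge> 1" "f \<in> carrier (blackadar_algebra n)" "norm (a - \<iota> n f) < \<delta>"
      by (auto simp: dist_norm norm_minus_commute)
    then obtain X where "cont_loop (4 ^ n) X" "f = mat_fun (4 ^ n) X"
      using carrier_mat_fun[of f "4 ^ n"] by (auto simp: blackadar_algebra_def)
    then show ?thesis using nf by (auto simp: emb_def)
  qed
  have up: "\<exists>X. cont_loop (4 ^ m) X \<and> norm (a - emb m X) < \<delta>"
    if nm: "n \<ge> 1" "n \<le> m" and X: "cont_loop (4 ^ n) X" "norm (a - emb n X) < \<delta>" for a n m X
    using iterate_loop[OF nm(1) X(1), of "m - n"] emb_iterate[OF nm(1) X(1), of "m - n"] nm(2) X(2)
    by (intro exI[of _ "iterate c n (m - n) X"]) auto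
  have "\<exists>n\<ge>1. \<forall>a\<in>F. \<exists>X. cont_loop (4 ^ n) X \<and> norm (a - emb n X) < \<delta>"
    using assms(1)
  proof (induction F)
    case empty
    then show ?case by auto
  next
    case (insert a F)
    obtain n where n: "n \<ge> 1" "\<forall>a\<in>F. \<exists>X. cont_loop (4 ^ n) X \<and> norm (a - emb n X) < \<delta>" using insert by blast
    obtain m where m: "m \<ge> 1" "\<exists>X. cont_loop (4 ^ m) X \<and> norm (a - emb m X) < \<delta>" using one by blast
    have "\<exists>X. cont_loop (4 ^ max n m) X \<and> norm (a' - emb (max n m) X) < \<delta>" if "a' \<in> insert a F" for a'
      using that n m up[of n "max n m"] up[of m "max n m"] by auto
    then show ?case using n(1) by (intro exI[of _ "max n m"]) auto
  qed
  then show ?thesis using that by blast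
qed

text \<open>All the blocks of positions are equivalent to the hole, and together they add up to
  \<open>1\<close>.\<close>

lemma limit_simple: "simple_algebra TYPE('a)"
  unfolding simple_algebra_def
proof (intro allI impI)
  fix I :: "'a set" assume I: "closed_ideal I"
  show "I = {0} \<or> I = UNIV"
  proof (cases "I = {0}")
    case False
    then obtain b where b: "b \<in> I" "b \<noteq> 0" using I by (auto simp: closed_ideal_def)
    obtain n where n: "n \<ge> 1" "\<And>a. a \<in> {b} \<Longrightarrow> \<exists>X. cont_loop (4 ^ n) X \<and> norm (a - emb n X) < norm b / 8"
      by (rule finite_approximation[of "{b}" "norm b / 8"]) (use b in auto)
    then obtain G where G: "cont_loop (4 ^ n) G" "norm (b - emb n G) < norm b / 8" by blast
    obtain k z where z: "star z * (b * star b) * z = coord_proj n k hole"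
      using eventually_happens[OF hole_projection_comparison[OF n(1) b(2) G]] by auto
    have ideal: "x * b' \<in> I" "b' * x \<in> I" "b' + b'' \<in> I" if "b' \<in> I" "b'' \<in> I" for x b' b''
      using I that by (auto simp: closed_ideal_def)
    have p: "coord_proj n k hole \<in> I" using ideal[OF _ b(1)] b(1) unfolding z[symmetric] by blast
    have level: "coord_proj n k {\<mu>. position \<mu> = i} \<in> I" if "i < 2 ^ Suc k" for i
    proof -
      have "bij_betw (\<lambda>(\<kappa>, s, j, l). (\<kappa>, s, i, l)) (hole \<inter> frame_indices n k) ({\<mu>. position \<mu> = i} \<inter> frame_indices n k)"
        by (rule bij_betw_byWitness[where f' = "\<lambda>(\<kappa>, s, j, l). (\<kappa>, s, 0, l)"])
           (use that in \<open>auto simp: hole_def position_def frame_indices_def\<close>)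
      then have "mvn_equiv (coord_proj n k hole) (coord_proj n k {\<mu>. position \<mu> = i})" by (rule coord_proj_mvn[OF n(1)])
      then obtain v where v: "star v * v = coord_proj n k hole" "v * star v = coord_proj n k {\<mu>. position \<mu> = i}"
        unfolding mvn_equiv_def by blast
      have "coord_proj n k {\<mu>. position \<mu> = i} = v * star v * (v * star v)"
        unfolding v(2) coord_proj_Int[OF n(1)] by simp
      also have "\<dots> = v * (star v * v) * star v" by (simp add: mult.assoc)
      finally show ?thesis unfolding v(1) using ideal p by metis
    qed
    have "coord_proj n k {\<mu>. position \<mu> < m} \<in> I" if "m \<le> 2 ^ Suc k" for m
      using that
    proof (induction m)
      case 0
      then show ?case using I coord_proj_empty[OF n(1)] by (simp add: closed_ideal_def)
    next
      case (Suc m)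
      have "{\<mu>. position \<mu> < Suc m} = {\<mu>. position \<mu> < m} \<union> {\<mu>. position \<mu> = m}" by auto
      moreover have "{\<mu>. position \<mu> < m} \<inter> {\<mu>. position \<mu> = m} = {}" by auto
      ultimately show ?case using Suc level[of m] coord_proj_Un[OF n(1)] ideal(3) by simp
    qed
    from this[OF order_refl] have "coord_proj n k {\<mu>. position \<mu> < 2 ^ Suc k} \<in> I" .
    also have "coord_proj n k {\<mu>. position \<mu> < 2 ^ Suc k} = coord_proj n k UNIV"
      by (rule coord_proj_cong) (auto simp: position_def frame_indices_def)
    finally have "1 \<in> I" by (simp add: coord_proj_UNIV[OF n(1)])
    then have "x \<in> I" for x using ideal(1)[of 1 1 x] by simp
    then show ?thesis by blast
  qed simp
qed

lemma alpha_automorphism: "star_automorphism \<alpha>"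
  using automorphism by (simp add: blackadar_automorphism_def)

text \<open>On the images of the \<open>A\<^sub>n\<close> the square is conjugation by
  \<open>u\<^sub>n\<^sup>2 = 1\<close>; these images are dense and \<open>\<alpha>\<close> is
  contractive.\<close>

lemma alpha_involution: "\<alpha> ^^ 2 = id"
proof
  fix a
  have fix2: "\<alpha> (\<alpha> (emb n X)) = emb n X" if n: "n \<ge> 1" and X: "cont_loop (4 ^ n) X" for n X
  proof -
    have "cont_loop (4 ^ n) (\<lambda>t x y. row_sign n x * X t x y * row_sign n y)"
      using X unfolding cont_loop_def by (auto intro!: continuous_intros)
    then show ?thesis unfolding alpha_emb[OF n X]
      by (subst alpha_emb[OF n]) (auto intro!: emb_cong simp: row_sign_def)
  qed
  have diff: "\<alpha> (x - y) = \<alpha> x - \<alpha> y" for x y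
    using alpha_automorphism unfolding star_automorphism_def by (metis add_diff_cancel diff_add_cancel)
  have "norm (\<alpha> (\<alpha> a) - a) \<le> e" if e: "e > 0" for e
  proof -
    obtain n where n: "n \<ge> 1" "\<And>b. b \<in> {a} \<Longrightarrow> \<exists>X. cont_loop (4 ^ n) X \<and> norm (b - emb n X) < e / 2"
      by (rule finite_approximation[of "{a}" "e / 2"]) (use e in auto)
    then obtain X where X: "cont_loop (4 ^ n) X" "norm (a - emb n X) < e / 2" by blast
    have "\<alpha> (\<alpha> a) - a = \<alpha> (\<alpha> (a - emb n X)) - (a - emb n X)" using fix2[OF n(1) X(1)] by (simp add: diff)
    also have "norm \<dots> \<le> norm (\<alpha> (\<alpha> (a - emb n X))) + norm (a - emb n X)" by (rule norm_triangle_ineq4)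
    also have "\<dots> \<le> norm (a - emb n X) + norm (a - emb n X)"
      using star_automorphism_norm_le[OF alpha_automorphism] by (meson add_right_mono order_trans)
    finally show ?thesis using X(2) by simp
  qed
  then have "norm (\<alpha> (\<alpha> a) - a) \<le> 0" by (rule field_le_epsilon[of _ 0, simplified])
  then show "(\<alpha> ^^ 2) a = id a" by (simp add: eval_nat_numeral)
qed

end

section \<open>Stable finiteness\<close>

lemma square_injective_surjective:
  fixes W :: "'i \<Rightarrow> 'i \<Rightarrow> complex"
  assumes P: "finite P" and inj: "\<And>u. (\<And>x. x \<in> P \<Longrightarrow> (\<Sum>y\<in>P. W x y * u y) = 0) \<Longrightarrow> (\<And>y. y \<in> P \<Longrightarrow> u y = 0)"
  obtains u where "\<And>x. x \<in> P \<Longrightarrow> (\<Sum>y\<in>P. W x y * u y) = w x"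
proof -
  define D where "D = card P"
  obtain f where f: "bij_betw f {..<D} P" using P by (metis D_def ex_bij_betw_nat_finite atLeast0LessThan)
  define g where "g = inv_into {..<D} f"
  have fg: "f (g x) = x" "g x < D" if "x \<in> P" for x
    using f that by (auto simp: g_def bij_betw_def f_inv_into_f intro: inv_into_into[where A = "{..<D}", simplified])
  have gf: "g (f a) = a" "f a \<in> P" if "a < D" for a using f that by (auto simp: g_def bij_betw_def)
  define A where "A = mat D D (\<lambda>(a, b). W (f a) (f b))"
  have A: "A \<in> carrier_mat D D" by (simp add: A_def)
  have Av: "(A *\<^sub>v v) $ a = (\<Sum>y\<in>P. W (f a) y * v $ (g y))" if "v \<in> carrier_vec D" "a < D" for v a
  proof -
    have "(A *\<^sub>v v) $ a = (\<Sum>b<D. W (f a) (f b) * v $ b)"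
      using that by (simp add: A_def scalar_prod_def atLeast0LessThan)
    also have "\<dots> = (\<Sum>b<D. W (f a) (f b) * v $ (g (f b)))" by (intro sum.cong) (auto simp: gf)
    also have "\<dots> = (\<Sum>y\<in>P. W (f a) y * v $ (g y))" by (rule sum.reindex_bij_betw[OF f])
    finally show ?thesis .
  qed
  have "det A \<noteq> 0"
  proof
    assume "det A = 0"
    then obtain v where v: "v \<in> carrier_vec D" "v \<noteq> 0\<^sub>v D" "A *\<^sub>v v = 0\<^sub>v D"
      using det_0_iff_vec_prod_zero_field[OF A] by blast
    have "(\<Sum>y\<in>P. W x y * v $ (g y)) = 0" if "x \<in> P" for x
      using Av[OF v(1) fg(2)[OF that]] v(3) fg[OF that] by simp
    from inj[OF this] have "v $ (g y) = 0" if "y \<in> P" for y using that by blast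
    then have "v $ a = 0" if "a < D" for a using gf[OF that] by metis
    then show False using v by (auto simp: vec_eq_iff)
  qed
  then obtain B where B: "B \<in> carrier_mat D D" "A * B = 1\<^sub>m D"
    using det_non_zero_imp_unit[OF A] by (auto simp: Units_def ring_mat_def)
  define v where "v = B *\<^sub>v vec D (\<lambda>a. w (f a))"
  have v: "v \<in> carrier_vec D" using B by (simp add: v_def)
  have "A *\<^sub>v v = vec D (\<lambda>a. w (f a))"
    unfolding v_def by (subst assoc_mult_mat_vec[symmetric, OF A B(1)]) (auto simp: B)
  then have "(\<Sum>y\<in>P. W x y * v $ (g y)) = w x" if "x \<in> P" for x
    using Av[OF v fg(2)[OF that]] fg[OF that] by simp
  then show ?thesis using that[of "\<lambda>y. v $ (g y)"] by blast
qed

text \<open>\<open>W\<close> intertwines \<open>W\<^sup>*W\<close> and \<open>WW\<^sup>*\<close>, and it is invertible because \<open>W\<^sup>*W\<close>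
  is close to \<open>1\<close>; transporting the error through \<open>W\<close> and its inverse costs at most the factor \<open>2\<close>.\<close>

lemma almost_isometry_almost_unitary:
  fixes W :: "'i \<Rightarrow> 'i \<Rightarrow> complex"
  assumes P: "finite P" and e: "0 \<le> e" "e \<le> 1 / 2"
    and T: "op_bound P P (\<lambda>x y. (\<Sum>z\<in>P. cnj (W z x) * W z y) - (if x = y then 1 else 0)) e"
  shows "op_bound P P (\<lambda>x y. (\<Sum>z\<in>P. W x z * cnj (W y z)) - (if x = y then 1 else 0)) (2 * e)"
proof -
  let ?T = "\<lambda>x y. (\<Sum>z\<in>P. cnj (W z x) * W z y) - (if x = y then 1 else 0)"
  let ?n = "\<lambda>u. \<Sum>x\<in>P. (cmod (u x))\<^sup>2"
  have n0: "0 \<le> ?n u" for u :: "'i \<Rightarrow> complex" by (intro sum_nonneg) auto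
  have Tu: "(\<Sum>y\<in>P. ?T x y * u y) = (\<Sum>z\<in>P. cnj (W z x) * (\<Sum>y\<in>P. W z y * u y)) - u x" if "x \<in> P" for x u
  proof -
    have "(\<Sum>y\<in>P. ?T x y * u y) = (\<Sum>y\<in>P. \<Sum>z\<in>P. cnj (W z x) * (W z y * u y)) - (\<Sum>y\<in>P. if x = y then u y else 0)"
      unfolding sum_subtractf[symmetric] by (intro sum.cong refl) (simp add: sum_distrib_right left_diff_distrib mult.assoc)
    also have "(\<Sum>y\<in>P. \<Sum>z\<in>P. cnj (W z x) * (W z y * u y)) = (\<Sum>z\<in>P. cnj (W z x) * (\<Sum>y\<in>P. W z y * u y))"
      by (subst sum.swap) (simp add: sum_distrib_left)
    finally show ?thesis using that P by simp
  qed
  define \<tau> where "\<tau> u x = (\<Sum>y\<in>P. ?T x y * u y)" for u x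
  define \<omega> where "\<omega> u x = (\<Sum>y\<in>P. W x y * u y)" for u x
  have T\<omega>: "\<tau> u x = (\<Sum>z\<in>P. cnj (W z x) * \<omega> u z) - u x" if "x \<in> P" for u x
    unfolding \<tau>_def \<omega>_def by (rule Tu[OF that])
  have \<tau>: "?n (\<tau> u) \<le> e\<^sup>2 * ?n u" for u
    using T unfolding op_bound_def \<tau>_def by blast
  have near: "\<bar>?n (\<omega> u) - ?n u\<bar> \<le> e * ?n u" for u
  proof -
    define Z where "Z = (\<Sum>x\<in>P. cnj (u x) * \<tau> u x)"
    have "complex_of_real (?n (\<omega> u)) = (\<Sum>z\<in>P. \<omega> u z * (\<Sum>x\<in>P. cnj (W z x) * cnj (u x)))"
      unfolding of_real_sum complex_norm_square by (simp add: \<omega>_def cnj_sum)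
    also have "\<dots> = (\<Sum>z\<in>P. \<Sum>x\<in>P. cnj (u x) * (cnj (W z x) * \<omega> u z))"
      by (simp add: sum_distrib_left mult_ac)
    also have "\<dots> = (\<Sum>x\<in>P. cnj (u x) * (\<Sum>z\<in>P. cnj (W z x) * \<omega> u z))"
      by (subst sum.swap) (simp add: sum_distrib_left)
    also have "\<dots> = (\<Sum>x\<in>P. cnj (u x) * (\<tau> u x + u x))"
      by (intro sum.cong refl) (simp only: T\<omega> diff_add_cancel)
    also have "\<dots> = Z + complex_of_real (?n u)"
      unfolding of_real_sum complex_norm_square Z_def by (simp add: distrib_left sum.distrib mult.commute)
    finally have "complex_of_real (?n (\<omega> u) - ?n u) = Z" by simp
    from arg_cong[OF this, of cmod] have eq: "\<bar>?n (\<omega> u) - ?n u\<bar> = cmod Z" by (simp only: norm_of_real)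
    have "(cmod Z)\<^sup>2 \<le> ?n u * ?n (\<tau> u)"
      using complex_Cauchy_Schwarz[of "\<lambda>x. cnj (u x)" "\<tau> u" P] by (simp add: Z_def)
    also have "\<dots> \<le> ?n u * (e\<^sup>2 * ?n u)" by (intro mult_left_mono \<tau> n0)
    also have "\<dots> = (e * ?n u)\<^sup>2" by (simp add: power2_eq_square)
    finally have "cmod Z \<le> e * ?n u" by (rule power2_le_imp_le) (intro mult_nonneg_nonneg e n0)
    then show ?thesis unfolding eq .
  qed
  show ?thesis unfolding op_bound_def
  proof
    fix w :: "'i \<Rightarrow> complex"
    have inj: "u y = 0" if "\<And>x. x \<in> P \<Longrightarrow> (\<Sum>y\<in>P. W x y * u y) = 0" "y \<in> P" for u y
    proof -
      have "?n (\<omega> u) = 0" using that(1) by (simp add: \<omega>_def)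
      then have "?n u \<le> e * ?n u" using near[of u] n0[of u] by (simp add: abs_le_iff)
      then have "?n u \<le> (1 / 2) * ?n u" using mult_right_mono[OF e(2) n0[of u]] by linarith
      then have "?n u = 0" using n0[of u] by simp
      then show ?thesis using that(2) P by (subst (asm) sum_nonneg_eq_0_iff) auto
    qed
    obtain u where u: "\<And>x. x \<in> P \<Longrightarrow> (\<Sum>y\<in>P. W x y * u y) = w x"
      by (rule square_injective_surjective[OF P, of W w]) (use inj in blast)+
    have \<omega>u: "\<omega> u x = w x" if "x \<in> P" for x using u[OF that] by (simp add: \<omega>_def)
    have "(\<Sum>y\<in>P. ((\<Sum>z\<in>P. W x z * cnj (W y z)) - (if x = y then 1 else 0)) * w y) = \<omega> (\<tau> u) x"
      if x: "x \<in> P" for x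
    proof -
      have "(\<Sum>y\<in>P. ((\<Sum>z\<in>P. W x z * cnj (W y z)) - (if x = y then 1 else 0)) * w y) =
         (\<Sum>y\<in>P. \<Sum>z\<in>P. W x z * (cnj (W y z) * w y)) - (\<Sum>y\<in>P. if x = y then w y else 0)"
        unfolding sum_subtractf[symmetric] by (intro sum.cong refl) (simp add: sum_distrib_right left_diff_distrib mult.assoc)
      also have "\<dots> = (\<Sum>z\<in>P. W x z * (\<Sum>y\<in>P. cnj (W y z) * w y)) - w x"
        using x P by (subst sum.swap) (simp add: sum_distrib_left)
      also have "(\<Sum>z\<in>P. W x z * (\<Sum>y\<in>P. cnj (W y z) * w y)) = (\<Sum>z\<in>P. W x z * (\<tau> u z + u z))"
        by (intro sum.cong refl) (simp add: T\<omega> \<omega>u)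
      also have "\<dots> = \<omega> (\<tau> u) x + \<omega> u x"
        by (simp add: \<omega>_def distrib_left sum.distrib)
      finally show ?thesis by (simp add: \<omega>u x)
    qed
    then have "?n (\<lambda>x. \<Sum>y\<in>P. ((\<Sum>z\<in>P. W x z * cnj (W y z)) - (if x = y then 1 else 0)) * w y) = ?n (\<omega> (\<tau> u))" by simp
    also have "\<dots> \<le> (1 + e) * ?n (\<tau> u)"
      using near[of "\<tau> u"] by (simp add: algebra_simps abs_le_iff)
    also have "\<dots> \<le> (1 + e) * (e\<^sup>2 * ?n u)"
      using e by (intro mult_left_mono \<tau>) auto
    also have "\<dots> \<le> 2 * (e\<^sup>2 * (2 * ?n w))"
    proof (intro mult_mono mult_left_mono)
      have "?n (\<omega> u) = ?n w" using \<omega>u by simp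
      then have "?n u - e * ?n u \<le> ?n w" using near[of u] by (simp add: abs_le_iff)
      then show "?n u \<le> 2 * ?n w" using mult_right_mono[OF e(2) n0[of u]] by linarith
    qed (use e n0 in auto)
    finally show "?n (\<lambda>x. \<Sum>y\<in>P. ((\<Sum>z\<in>P. W x z * cnj (W y z)) - (if x = y then 1 else 0)) * w y) \<le> (2 * e)\<^sup>2 * ?n w"
      by (simp add: power2_eq_square)
  qed
qed

text \<open>The Cauchy-Schwarz inequality in the sum over the \<open>k\<close> blocks of a row.\<close>

lemma op_bound_blocks:
  fixes T :: "nat \<times> nat \<Rightarrow> nat \<times> nat \<Rightarrow> complex"
  assumes e: "0 \<le> e" and T: "\<And>i j. i < k \<Longrightarrow> j < k \<Longrightarrow> op_bound {..<d} {..<d} (\<lambda>x y. T (i, x) (j, y)) e"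
  shows "op_bound ({..<k} \<times> {..<d}) ({..<k} \<times> {..<d}) T (real k * e)"
  unfolding op_bound_def
proof
  fix u :: "nat \<times> nat \<Rightarrow> complex"
  let ?s = "\<lambda>j. \<Sum>y<d. (cmod (u (j, y)))\<^sup>2"
  have row: "(\<Sum>x<d. (cmod (\<Sum>j<k. \<Sum>y<d. T (i, x) (j, y) * u (j, y)))\<^sup>2) \<le> real k * e\<^sup>2 * (\<Sum>j<k. ?s j)" if i: "i < k" for i
  proof -
    have "(\<Sum>x<d. (cmod (\<Sum>j<k. \<Sum>y<d. T (i, x) (j, y) * u (j, y)))\<^sup>2) \<le>
       (\<Sum>x<d. real k * (\<Sum>j<k. (cmod (\<Sum>y<d. T (i, x) (j, y) * u (j, y)))\<^sup>2))"
    proof (rule sum_mono)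
      fix x
      show "(cmod (\<Sum>j<k. \<Sum>y<d. T (i, x) (j, y) * u (j, y)))\<^sup>2 \<le> real k * (\<Sum>j<k. (cmod (\<Sum>y<d. T (i, x) (j, y) * u (j, y)))\<^sup>2)"
        using complex_Cauchy_Schwarz[of "\<lambda>_. 1" "\<lambda>j. \<Sum>y<d. T (i, x) (j, y) * u (j, y)" "{..<k}"] by simp
    qed
    also have "\<dots> = real k * (\<Sum>j<k. \<Sum>x<d. (cmod (\<Sum>y<d. T (i, x) (j, y) * u (j, y)))\<^sup>2)"
      unfolding sum_distrib_left[symmetric] by (subst sum.swap) simp
    also have "\<dots> \<le> real k * (\<Sum>j<k. e\<^sup>2 * ?s j)"
    proof (intro mult_left_mono sum_mono)
      fix j assume "j \<in> {..<k}"
      then have "op_bound {..<d} {..<d} (\<lambda>x y. T (i, x) (j, y)) e" using T i by blast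
      then show "(\<Sum>x<d. (cmod (\<Sum>y<d. T (i, x) (j, y) * u (j, y)))\<^sup>2) \<le> e\<^sup>2 * ?s j"
        unfolding op_bound_def by (rule spec[where x = "\<lambda>y. u (j, y)"])
    qed simp
    finally show ?thesis by (simp add: sum_distrib_left mult.assoc)
  qed
  have "(\<Sum>p\<in>{..<k} \<times> {..<d}. (cmod (\<Sum>q\<in>{..<k} \<times> {..<d}. T p q * u q))\<^sup>2) =
     (\<Sum>i<k. \<Sum>x<d. (cmod (\<Sum>j<k. \<Sum>y<d. T (i, x) (j, y) * u (j, y)))\<^sup>2)"
    by (simp add: sum.cartesian_product split_def)
  also have "\<dots> \<le> (\<Sum>i<k. real k * e\<^sup>2 * (\<Sum>j<k. ?s j))" by (rule sum_mono) (use row in blast)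
  also have "\<dots> = (real k * e)\<^sup>2 * (\<Sum>q\<in>{..<k} \<times> {..<d}. (cmod (u q))\<^sup>2)"
    by (simp add: sum.cartesian_product split_def power2_eq_square)
  finally show "(\<Sum>p\<in>{..<k} \<times> {..<d}. (cmod (\<Sum>q\<in>{..<k} \<times> {..<d}. T p q * u q))\<^sup>2)
     \<le> (real k * e)\<^sup>2 * (\<Sum>q\<in>{..<k} \<times> {..<d}. (cmod (u q))\<^sup>2)" .
qed

lemma op_bound_block:
  fixes T :: "nat \<times> nat \<Rightarrow> nat \<times> nat \<Rightarrow> complex"
  assumes T: "op_bound ({..<k} \<times> {..<d}) ({..<k} \<times> {..<d}) T e" and i: "i < k" "j < k"
  shows "op_bound {..<d} {..<d} (\<lambda>x y. T (i, x) (j, y)) e"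
  unfolding op_bound_def
proof
  fix u :: "nat \<Rightarrow> complex"
  let ?P = "{..<k} \<times> {..<d}"
  define v where "v q = (if fst q = j then u (snd q) else 0)" for q :: "nat \<times> nat"
  have Tv: "(\<Sum>q\<in>?P. T p q * v q) = (\<Sum>y<d. T p (j, y) * u y)" for p
  proof -
    have "(\<Sum>q\<in>?P. T p q * v q) = (\<Sum>j'<k. \<Sum>y<d. T p (j', y) * v (j', y))"
      by (simp add: sum.cartesian_product split_def)
    also have "\<dots> = (\<Sum>j'<k. if j' = j then (\<Sum>y<d. T p (j', y) * u y) else 0)"
      by (intro sum.cong refl) (simp add: v_def)
    finally show ?thesis using i by simp
  qed
  have vn: "(\<Sum>q\<in>?P. (cmod (v q))\<^sup>2) = (\<Sum>y<d. (cmod (u y))\<^sup>2)"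
  proof -
    have "(\<Sum>q\<in>?P. (cmod (v q))\<^sup>2) = (\<Sum>j'<k. \<Sum>y<d. (cmod (v (j', y)))\<^sup>2)"
      by (simp add: sum.cartesian_product split_def)
    also have "\<dots> = (\<Sum>j'<k. if j' = j then (\<Sum>y<d. (cmod (u y))\<^sup>2) else 0)"
      by (intro sum.cong refl) (simp add: v_def)
    finally show ?thesis using i by simp
  qed
  have "(\<Sum>x<d. (cmod (\<Sum>y<d. T (i, x) (j, y) * u y))\<^sup>2) \<le> (\<Sum>i'<k. \<Sum>x<d. (cmod (\<Sum>y<d. T (i', x) (j, y) * u y))\<^sup>2)"
    using i by (intro member_le_sum[where f = "\<lambda>i'. \<Sum>x<d. (cmod (\<Sum>y<d. T (i', x) (j, y) * u y))\<^sup>2"]) (auto intro: sum_nonneg)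
  also have "\<dots> = (\<Sum>p\<in>?P. (cmod (\<Sum>q\<in>?P. T p q * v q))\<^sup>2)"
    unfolding Tv by (simp add: sum.cartesian_product split_def)
  also have "\<dots> \<le> e\<^sup>2 * (\<Sum>q\<in>?P. (cmod (v q))\<^sup>2)" using T unfolding op_bound_def by blast
  finally show "(\<Sum>x<d. (cmod (\<Sum>y<d. T (i, x) (j, y) * u y))\<^sup>2) \<le> e\<^sup>2 * (\<Sum>y<d. (cmod (u y))\<^sup>2)"
    unfolding vn .
qed

context blackadar_limit
begin

text \<open>Every point \<open>s\<close> is \<open>t/2\<close> or \<open>(t + 1)/2\<close> for some
  \<open>t\<close>, so \<open>X s\<close> occurs as a diagonal block, cut out by the vectors \<open>\<rho>
  l\<close>, of the image of \<open>X\<close> at \<open>t\<close>.\<close>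

lemma op_bound_step_descend:
  assumes n: "n \<ge> 1" and b: "\<And>t. t \<in> {0..1} \<Longrightarrow> op_bound {..<4 ^ Suc n} {..<4 ^ Suc n} (iterate c n (Suc 0) X t) C"
    and s: "s \<in> {0..1}"
  shows "op_bound {..<4 ^ n} {..<4 ^ n} (X s) C"
proof -
  define j :: nat where "j = (if s \<le> 1 / 2 then 0 else 1)"
  define t where "t = 2 * s - real j"
  have t: "t \<in> {0..1}" and j: "j < 2" using s by (auto simp: t_def j_def)
  define \<rho> :: "nat \<Rightarrow> frame_index" where "\<rho> l = ([], True, j, l)" for l
  let ?I = "frame_indices n 0" and ?J = "{..<(4::nat) ^ Suc n}" and ?r = "raw_frame c n t"
  have \<rho>I: "\<rho> l \<in> ?I" if "l < 4 ^ n" for l using that j by (simp add: \<rho>_def frame_indices_def)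
  have pt: "index_point t (\<rho> l) = s" for l
    by (simp add: \<rho>_def index_point_def point_def side_def t_def)
  have on: "orthonormal ?I ?J ?r" using raw_frame_orthonormal[OF n t, of 0] by simp
  have gram: "(\<Sum>x\<in>?J. ?r (\<rho> l) x * cnj (?r \<mu> x)) = (if \<mu> = \<rho> l then 1 else 0)" if "l < 4 ^ n" "\<mu> \<in> ?I" for l \<mu>
    using on \<rho>I[OF that(1)] that(2) by (auto simp: orthonormal_def)
  have iso: "(\<Sum>x\<in>?J. (cmod (\<Sum>l<4 ^ n. ?r (\<rho> l) x * a l))\<^sup>2) = (\<Sum>l<4 ^ n. (cmod (a l))\<^sup>2)" for a
    by (rule isometry_norm) (use gram \<rho>I in \<open>auto simp: \<rho>_def\<close>)
  show ?thesis unfolding op_bound_def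
  proof
    fix u :: "nat \<Rightarrow> complex"
    define U where "U x = (\<Sum>l<4 ^ n. ?r (\<rho> l) x * u l)" for x
    let ?Y = "\<lambda>\<rho> \<mu>. if \<mu> = with_column \<rho> (column \<mu>) then X (index_point t \<rho>) (column \<rho>) (column \<mu>) else 0"
    have proj: "(\<Sum>y\<in>?J. cnj (?r \<mu> y) * U y) = (\<Sum>l<4 ^ n. if \<mu> = \<rho> l then u l else 0)" if \<mu>: "\<mu> \<in> ?I" for \<mu>
    proof -
      have "(\<Sum>y\<in>?J. cnj (?r \<mu> y) * U y) = (\<Sum>l<4 ^ n. u l * (\<Sum>y\<in>?J. ?r (\<rho> l) y * cnj (?r \<mu> y)))"
        unfolding U_def sum_distrib_left by (subst sum.swap) (simp add: mult_ac)
      also have "\<dots> = (\<Sum>l<4 ^ n. if \<mu> = \<rho> l then u l else 0)"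
      proof (rule sum.cong[OF refl])
        fix l :: nat assume "l \<in> {..<4 ^ n}"
        then have "l < 4 ^ n" by simp
        then show "u l * (\<Sum>y\<in>?J. ?r (\<rho> l) y * cnj (?r \<mu> y)) = (if \<mu> = \<rho> l then u l else 0)"
          using gram[OF _ \<mu>, of l] by (simp only: if_distrib[of "\<lambda>z. u l * z"] mult_1_right mult_zero_right)
      qed
      finally show ?thesis .
    qed
    have "(\<Sum>y\<in>?J. iterate c n (Suc 0) X t x y * U y) = (\<Sum>l<4 ^ n. ?r (\<rho> l) x * (\<Sum>l'<4 ^ n. X s l l' * u l'))"
      if x: "x \<in> ?J" for x
    proof -
      have "(\<Sum>y\<in>?J. iterate c n (Suc 0) X t x y * U y) = (\<Sum>y\<in>?J. sandwich ?I ?r ?Y ?r x y * U y)"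
        by (intro sum.cong refl) (use x iterate_sandwich[OF n, of x 0] in \<open>simp del: iterate.simps power_Suc\<close>)
      also have "\<dots> = (\<Sum>\<rho>\<in>?I. \<Sum>\<mu>\<in>?I. ?r \<rho> x * ?Y \<rho> \<mu> * (\<Sum>y\<in>?J. cnj (?r \<mu> y) * U y))"
      proof -
        have "(\<Sum>y\<in>?J. sandwich ?I ?r ?Y ?r x y * U y) = (\<Sum>y\<in>?J. \<Sum>\<rho>\<in>?I. \<Sum>\<mu>\<in>?I. ?r \<rho> x * ?Y \<rho> \<mu> * (cnj (?r \<mu> y) * U y))"
          unfolding sandwich_def sum_distrib_right by (simp only: mult.assoc)
        also have "\<dots> = (\<Sum>\<rho>\<in>?I. \<Sum>y\<in>?J. \<Sum>\<mu>\<in>?I. ?r \<rho> x * ?Y \<rho> \<mu> * (cnj (?r \<mu> y) * U y))" by (rule sum.swap)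
        also have "\<dots> = (\<Sum>\<rho>\<in>?I. \<Sum>\<mu>\<in>?I. \<Sum>y\<in>?J. ?r \<rho> x * ?Y \<rho> \<mu> * (cnj (?r \<mu> y) * U y))"
          by (intro sum.cong refl sum.swap)
        finally show ?thesis by (simp only: sum_distrib_left)
      qed
      also have "\<dots> = (\<Sum>\<rho>'\<in>?I. \<Sum>l'<4 ^ n. \<Sum>\<mu>\<in>?I. if \<mu> = \<rho> l' then ?r \<rho>' x * ?Y \<rho>' \<mu> * u l' else 0)"
      proof (rule sum.cong[OF refl])
        fix \<rho>'
        have "(\<Sum>\<mu>\<in>?I. ?r \<rho>' x * ?Y \<rho>' \<mu> * (\<Sum>y\<in>?J. cnj (?r \<mu> y) * U y)) =
          (\<Sum>\<mu>\<in>?I. ?r \<rho>' x * ?Y \<rho>' \<mu> * (\<Sum>l'<4 ^ n. if \<mu> = \<rho> l' then u l' else 0))"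
          by (intro sum.cong refl) (simp only: proj)
        also have "\<dots> = (\<Sum>\<mu>\<in>?I. \<Sum>l'<4 ^ n. if \<mu> = \<rho> l' then ?r \<rho>' x * ?Y \<rho>' \<mu> * u l' else 0)"
          unfolding sum_distrib_left by (intro sum.cong refl) simp
        also have "\<dots> = (\<Sum>l'<4 ^ n. \<Sum>\<mu>\<in>?I. if \<mu> = \<rho> l' then ?r \<rho>' x * ?Y \<rho>' \<mu> * u l' else 0)"
          by (rule sum.swap)
        finally show "(\<Sum>\<mu>\<in>?I. ?r \<rho>' x * ?Y \<rho>' \<mu> * (\<Sum>y\<in>?J. cnj (?r \<mu> y) * U y)) =
          (\<Sum>l'<4 ^ n. \<Sum>\<mu>\<in>?I. if \<mu> = \<rho> l' then ?r \<rho>' x * ?Y \<rho>' \<mu> * u l' else 0)" .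
      qed
      also have "\<dots> = (\<Sum>\<rho>'\<in>?I. \<Sum>l'<4 ^ n. ?r \<rho>' x * ?Y \<rho>' (\<rho> l') * u l')"
        by (intro sum.cong refl) (simp add: \<rho>I)
      also have "\<dots> = (\<Sum>l'<4 ^ n. \<Sum>\<rho>'\<in>?I. ?r \<rho>' x * ?Y \<rho>' (\<rho> l') * u l')" by (rule sum.swap)
      also have "\<dots> = (\<Sum>l'<4 ^ n. \<Sum>l<4 ^ n. ?r (\<rho> l) x * (X s l l' * u l'))"
      proof (rule sum.cong[OF refl])
        fix l' :: nat assume l': "l' \<in> {..<4 ^ n}"
        have "(\<Sum>\<rho>'\<in>?I. ?r \<rho>' x * ?Y \<rho>' (\<rho> l') * u l') =
          (\<Sum>\<rho>'\<in>?I. if \<rho>' = with_column (\<rho> l') (column \<rho>') then ?r \<rho>' x * (X (index_point t \<rho>') (column \<rho>') l' * u l') else 0)"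
          by (intro sum.cong refl) (auto simp: \<rho>_def with_column_def column_def split: prod.splits)
        also have "\<dots> = (\<Sum>l<4 ^ n. ?r (with_column (\<rho> l') l) x * (X (index_point t (with_column (\<rho> l') l)) (column (with_column (\<rho> l') l)) l' * u l'))"
          by (rule sum_with_column) (use l' \<rho>I in blast)
        also have "\<dots> = (\<Sum>l<4 ^ n. ?r (\<rho> l) x * (X s l l' * u l'))"
        proof -
          have "with_column (\<rho> l') l = \<rho> l" "column (\<rho> l) = l" for l by (simp_all add: \<rho>_def with_column_def column_def)
          then show ?thesis by (simp only: pt)
        qed
        finally show "(\<Sum>\<rho>'\<in>?I. ?r \<rho>' x * ?Y \<rho>' (\<rho> l') * u l') = (\<Sum>l<4 ^ n. ?r (\<rho> l) x * (X s l l' * u l'))" .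
      qed
      also have "\<dots> = (\<Sum>l<4 ^ n. ?r (\<rho> l) x * (\<Sum>l'<4 ^ n. X s l l' * u l'))"
        by (subst sum.swap) (simp add: sum_distrib_left)
      finally show ?thesis .
    qed
    then have "(\<Sum>x\<in>?J. (cmod (\<Sum>y\<in>?J. iterate c n (Suc 0) X t x y * U y))\<^sup>2) =
       (\<Sum>x\<in>?J. (cmod (\<Sum>l<4 ^ n. ?r (\<rho> l) x * (\<Sum>l'<4 ^ n. X s l l' * u l')))\<^sup>2)"
      by (simp del: iterate.simps power_Suc)
    also have "\<dots> = (\<Sum>l<4 ^ n. (cmod (\<Sum>l'<4 ^ n. X s l l' * u l'))\<^sup>2)" by (rule iso)
    finally have "(\<Sum>l<4 ^ n. (cmod (\<Sum>l'<4 ^ n. X s l l' * u l'))\<^sup>2) =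
      (\<Sum>x\<in>?J. (cmod (\<Sum>y\<in>?J. iterate c n (Suc 0) X t x y * U y))\<^sup>2)" ..
    also have "\<dots> \<le> C\<^sup>2 * (\<Sum>y\<in>?J. (cmod (U y))\<^sup>2)" using b[OF t] unfolding op_bound_def by blast
    also have "(\<Sum>y\<in>?J. (cmod (U y))\<^sup>2) = (\<Sum>l<4 ^ n. (cmod (u l))\<^sup>2)" unfolding U_def by (rule iso)
    finally show "(\<Sum>l<4 ^ n. (cmod (\<Sum>l'<4 ^ n. X s l l' * u l'))\<^sup>2) \<le> C\<^sup>2 * (\<Sum>l<4 ^ n. (cmod (u l))\<^sup>2)" .
  qed
qed

lemma op_bound_iterate_descend:
  assumes n: "n \<ge> 1" and "\<And>t. t \<in> {0..1} \<Longrightarrow> op_bound {..<4 ^ (n + q)} {..<4 ^ (n + q)} (iterate c n q X t) C"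
    and s: "s \<in> {0..1}"
  shows "op_bound {..<4 ^ n} {..<4 ^ n} (X s) C"
  using assms(2) s
proof (induction q arbitrary: s)
  case (Suc q)
  have "op_bound {..<4 ^ (n + q)} {..<4 ^ (n + q)} (iterate c n q X s) C" if "s \<in> {0..1}" for s
    by (rule op_bound_step_descend[OF _ _ that]) (use Suc.prems(1) n in \<open>auto simp del: power_Suc\<close>)
  then show ?case using Suc.IH Suc.prems(2) by blast
qed simp

text \<open>Together with \<open>norm_emb_le\<close>: the embeddings into the limit are isometric. Norms
  cannot decrease along the system, since values of \<open>X\<close> persist as blocks.\<close>

lemma op_bound_norm_emb:
  assumes n: "n \<ge> 1" and X: "cont_loop (4 ^ n) X" and s: "s \<in> {0..1}"
  shows "op_bound {..<4 ^ n} {..<4 ^ n} (X s) (norm (emb n X))"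
  unfolding op_bound_def
proof
  fix u :: "nat \<Rightarrow> complex"
  let ?N = "\<lambda>q. norm_of (circle_algebra (4 ^ (n + q))) (mat_fun (4 ^ (n + q)) (iterate c n q X))"
  have b: "op_bound {..<4 ^ n} {..<4 ^ n} (X s) (?N q)" for q
    by (rule op_bound_iterate_descend[OF n _ s]) (rule op_bound_norm_of[OF iterate_loop[OF n X]])
  have "(\<lambda>q. (?N q)\<^sup>2 * (\<Sum>y<4 ^ n. (cmod (u y))\<^sup>2)) \<longlonglongrightarrow> (norm (emb n X))\<^sup>2 * (\<Sum>y<4 ^ n. (cmod (u y))\<^sup>2)"
    by (intro tendsto_intros norm_limit[OF n X])
  then show "(\<Sum>x<4 ^ n. (cmod (\<Sum>y<4 ^ n. X s x y * u y))\<^sup>2) \<le> (norm (emb n X))\<^sup>2 * (\<Sum>y<4 ^ n. (cmod (u y))\<^sup>2)"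
    by (rule LIMSEQ_le_const) (use b in \<open>auto simp: op_bound_def\<close>)
qed

lemma emb_sum:
  assumes "n \<ge> 1" "finite A" "\<And>p. p \<in> A \<Longrightarrow> cont_loop (4 ^ n) (X p)"
  shows "emb n (\<lambda>t x y. \<Sum>p\<in>A. X p t x y) = (\<Sum>p\<in>A. emb n (X p)) \<and> cont_loop (4 ^ n) (\<lambda>t x y. \<Sum>p\<in>A. X p t x y)"
  using assms(2,3)
proof (induction A)
  case empty
  have "emb n (\<lambda>t x y. 0 * (0::complex)) = 0 *\<^sub>C emb n (\<lambda>t x y. 0)"
    by (rule emb_scale[OF assms(1) cont_loop_const])
  then show ?case by (simp add: cont_loop_const)
next
  case (insert p A)
  then have X: "cont_loop (4 ^ n) (X p)" "cont_loop (4 ^ n) (\<lambda>t x y. \<Sum>p\<in>A. X p t x y)"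
    "emb n (\<lambda>t x y. \<Sum>p\<in>A. X p t x y) = (\<Sum>p\<in>A. emb n (X p))" by auto
  show ?case using emb_add[OF assms(1) X(1,2)] cont_loop_algebra(1)[OF X(1,2)] X(3) insert(1,2) by simp
qed


text \<open>For small \<open>\<delta>\<close> replace the entries of the isometry \<open>V\<close> by elements
  \<open>g\<close> of some \<open>A\<^sub>n\<close> within \<open>\<delta>\<close>. The norm of
  \<open>V\<^sup>*V - 1 = 0\<close> controls the matrices \<open>T\<close> of \<open>g\<^sup>* g - 1\<close>
  pointwise, because the embeddings are isometric; at each point \<open>g\<close> is a square complex matrix,
  so \<open>g g\<^sup>* - 1\<close>, with the entries \<open>S\<close>, is small as well.\<close>

lemma limit_stably_finite: "stably_finite TYPE('a)"
  unfolding stably_finite_def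
proof (intro allI impI, elim conjE)
  fix k and V :: "'a mat" assume V: "V \<in> carrier_mat k k" and VV: "mat_star V * V = 1\<^sub>m k"
  define v where "v i j = V $$ (i, j)" for i j
  have sV: "mat_star V \<in> carrier_mat k k" using V by (simp add: mat_star_def)
  have ent: "(mat_star V * V) $$ (i, j) = (\<Sum>p<k. star (v p i) * v p j)"
    "(V * mat_star V) $$ (i, j) = (\<Sum>p<k. v i p * star (v j p))" if "i < k" "j < k" for i j
    using that V sV by (auto simp: scalar_prod_def atLeast0LessThan mat_star_def v_def intro!: sum.cong)
  have iso: "(\<Sum>p<k. star (v p i) * v p j) = (if i = j then 1 else 0)" if "i < k" "j < k" for i j
    using ent(1)[OF that] that unfolding VV by simp
  define M where "M = (\<Sum>i<k. \<Sum>j<k. norm (v i j))"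
  have M: "norm (v i j) \<le> M" if "i < k" "j < k" for i j
  proof -
    have "norm (v i j) \<le> (\<Sum>j<k. norm (v i j))" using that by (intro member_le_sum) auto
    also have "\<dots> \<le> M" unfolding M_def using that
      by (intro member_le_sum[where f = "\<lambda>i. \<Sum>j<k. norm (v i j)"]) (auto intro: sum_nonneg)
    finally show ?thesis .
  qed
  have M0: "0 \<le> M" unfolding M_def by (intro sum_nonneg) auto
  define C where "C = 2 * M + 1"
  have C: "C > 0" using M0 by (simp add: C_def)
  have prod: "norm (a * b - a' * b') \<le> C * \<delta>"
    if "norm a \<le> M" "norm b \<le> M" "norm (a - a') \<le> \<delta>" "norm (b - b') \<le> \<delta>" "\<delta> \<le> 1" for a b a' b' :: 'a and \<delta>
  proof -
    have \<delta>: "0 \<le> \<delta>" using that(3) norm_ge_zero order_trans by blast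
    have b': "norm b' \<le> M + 1" using that(2,4,5) norm_triangle_ineq2[of b' b] by (simp add: norm_minus_commute)
    have "a * b - a' * b' = a * (b - b') + (a - a') * b'" by (simp add: algebra_simps)
    also have "norm \<dots> \<le> norm a * norm (b - b') + norm (a - a') * norm b'"
      by (intro order_trans[OF norm_triangle_ineq] add_mono norm_mult_ineq)
    also have "\<dots> \<le> M * \<delta> + \<delta> * (M + 1)"
      using that b' M0 \<delta> by (intro add_mono mult_mono) auto
    finally show ?thesis by (simp add: C_def algebra_simps)
  qed
  define B where "B = 2 * (real k * (real k * C)) + real k * C"
  have B: "0 \<le> B" using C by (simp add: B_def)
  have est: "norm ((\<Sum>p<k. v i0 p * star (v j0 p)) - (if i0 = j0 then 1 else 0)) \<le> B * \<delta>"
    if ij0: "i0 < k" "j0 < k" and \<delta>: "0 < \<delta>" "\<delta> \<le> 1" "real k * (real k * C * \<delta>) \<le> 1 / 2" for i0 j0 \<delta>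
  proof -
    obtain n where n: "n \<ge> 1" "\<And>a. a \<in> (\<lambda>(i, j). v i j) ` ({..<k} \<times> {..<k}) \<Longrightarrow> \<exists>X. cont_loop (4 ^ n) X \<and> norm (a - emb n X) < \<delta>"
      by (rule finite_approximation[of "(\<lambda>(i, j). v i j) ` ({..<k} \<times> {..<k})" \<delta>]) (use \<delta> in auto)
    have "\<exists>X. cont_loop (4 ^ n) X \<and> norm (v i j - emb n X) < \<delta>" if "i < k" "j < k" for i j
      by (rule n(2)) (use that in auto)
    then obtain X where X: "\<And>i j. i < k \<Longrightarrow> j < k \<Longrightarrow> cont_loop (4 ^ n) (X i j)"
      "\<And>i j. i < k \<Longrightarrow> j < k \<Longrightarrow> norm (v i j - emb n (X i j)) < \<delta>" by metis
    define d where "d = (4::nat) ^ n"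
    define g where "g i j = emb n (X i j)" for i j
    define unit :: "nat \<Rightarrow> nat \<Rightarrow> real \<Rightarrow> nat \<Rightarrow> nat \<Rightarrow> complex"
      where "unit i j = (\<lambda>t x y. if i = j then (if x = y then 1 else 0) else 0)" for i j
    have unit: "cont_loop (4 ^ n) (unit i j)" "emb n (unit i j) = (if i = j then 1 else 0)" for i j
      using cont_loop_const emb_one[OF n(1)] emb_sum[OF n(1), of "{}"] by (auto simp: unit_def)
    have ng: "norm (v i j - g i j) \<le> \<delta>" "norm (star (v i j) - star (g i j)) \<le> \<delta>" if "i < k" "j < k" for i j
      using X(2)[OF that] by (auto simp: g_def simp flip: star_diff)
    define T where "T i j = (\<lambda>t x y. (\<Sum>p<k. \<Sum>z<4 ^ n. cnj (X p i t z x) * X p j t z y) - unit i j t x y)" for i j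
    define S where "S i j = (\<lambda>t x y. (\<Sum>p<k. \<Sum>z<4 ^ n. X i p t x z * cnj (X j p t y z)) - unit i j t x y)" for i j
    have adj: "cont_loop (4 ^ n) (\<lambda>t x y. cnj (X i j t y x))" "emb n (\<lambda>t x y. cnj (X i j t y x)) = star (g i j)"
      if "i < k" "j < k" for i j
      using cont_loop_algebra(4)[OF X(1)[OF that] X(1)[OF that]] emb_star[OF n(1) X(1)[OF that]] by (auto simp: g_def)
    have T: "cont_loop (4 ^ n) (T i j) \<and> emb n (T i j) = (\<Sum>p<k. star (g p i) * g p j) - (if i = j then 1 else 0)"
      if ij: "i < k" "j < k" for i j
    proof -
      have s: "cont_loop (4 ^ n) (\<lambda>t x y. \<Sum>z<4 ^ n. cnj (X p i t z x) * X p j t z y)"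
        "emb n (\<lambda>t x y. \<Sum>z<4 ^ n. cnj (X p i t z x) * X p j t z y) = star (g p i) * g p j" if "p \<in> {..<k}" for p
        using cont_loop_algebra(3)[OF adj(1) X(1)] emb_mult[OF n(1) adj(1) X(1)] adj(2) that ij by (auto simp: g_def)
      have l: "cont_loop (4 ^ n) (\<lambda>t x y. \<Sum>p<k. \<Sum>z<4 ^ n. cnj (X p i t z x) * X p j t z y)"
        "emb n (\<lambda>t x y. \<Sum>p<k. \<Sum>z<4 ^ n. cnj (X p i t z x) * X p j t z y) = (\<Sum>p<k. star (g p i) * g p j)"
        using emb_sum[OF n(1) finite_lessThan s(1)] s(2) by auto
      have "cont_loop (4 ^ n) (\<lambda>t x y. (\<Sum>p<k. \<Sum>z<4 ^ n. cnj (X p i t z x) * X p j t z y) + (-1) * unit i j t x y)"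
        using l(1) unit(1) by (intro cont_loop_algebra)
      then have "cont_loop (4 ^ n) (T i j)" by (simp add: T_def)
      then show ?thesis unfolding T_def using emb_diff[OF n(1) l(1) unit(1)] l(2) unit(2) by simp
    qed
    have S: "cont_loop (4 ^ n) (S i j) \<and> emb n (S i j) = (\<Sum>p<k. g i p * star (g j p)) - (if i = j then 1 else 0)"
      if ij: "i < k" "j < k" for i j
    proof -
      have s: "cont_loop (4 ^ n) (\<lambda>t x y. \<Sum>z<4 ^ n. X i p t x z * cnj (X j p t y z))"
        "emb n (\<lambda>t x y. \<Sum>z<4 ^ n. X i p t x z * cnj (X j p t y z)) = g i p * star (g j p)" if "p \<in> {..<k}" for p
        using cont_loop_algebra(3)[OF X(1) adj(1)] emb_mult[OF n(1) X(1) adj(1)] adj(2) that ij by (auto simp: g_def)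
      have l: "cont_loop (4 ^ n) (\<lambda>t x y. \<Sum>p<k. \<Sum>z<4 ^ n. X i p t x z * cnj (X j p t y z))"
        "emb n (\<lambda>t x y. \<Sum>p<k. \<Sum>z<4 ^ n. X i p t x z * cnj (X j p t y z)) = (\<Sum>p<k. g i p * star (g j p))"
        using emb_sum[OF n(1) finite_lessThan s(1)] s(2) by auto
      have "cont_loop (4 ^ n) (\<lambda>t x y. (\<Sum>p<k. \<Sum>z<4 ^ n. X i p t x z * cnj (X j p t y z)) + (-1) * unit i j t x y)"
        using l(1) unit(1) by (intro cont_loop_algebra)
      then have "cont_loop (4 ^ n) (S i j)" by (simp add: S_def)
      then show ?thesis unfolding S_def using emb_diff[OF n(1) l(1) unit(1)] l(2) unit(2) by simp
    qed
    have nT: "norm (emb n (T i j)) \<le> real k * C * \<delta>" if ij: "i < k" "j < k" for i j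
    proof -
      have "emb n (T i j) = (\<Sum>p<k. star (g p i) * g p j - star (v p i) * v p j)"
        using T[OF ij] iso[OF ij] by (simp add: sum_subtractf)
      also have "norm \<dots> \<le> (\<Sum>p<k. C * \<delta>)"
      proof (rule sum_norm_le)
        fix p assume "p \<in> {..<k}"
        then have "norm (star (v p i) * v p j - star (g p i) * g p j) \<le> C * \<delta>"
          using M ng \<delta> ij by (intro prod) auto
        then show "norm (star (g p i) * g p j - star (v p i) * v p j) \<le> C * \<delta>" by (simp add: norm_minus_commute)
      qed
      finally show ?thesis by simp
    qed
    let ?e = "real k * C * \<delta>"
    have e0: "0 \<le> ?e" using C \<delta> by simp
    have obS: "op_bound {..<d} {..<d} (S i0 j0 t) (2 * (real k * ?e))" if t: "t \<in> {0..1}" for t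
    proof -
      let ?P = "{..<k} \<times> {..<d}"
      define W where "W a b = X (fst a) (fst b) t (snd a) (snd b)" for a b :: "nat \<times> nat"
      have 1: "op_bound {..<d} {..<d} (\<lambda>x y. (\<Sum>q\<in>?P. cnj (W q (i, x)) * W q (j, y)) - (if (i, x) = (j, y) then 1 else 0)) ?e"
        if ij: "i < k" "j < k" for i j
      proof -
        have "(\<lambda>x y. (\<Sum>q\<in>?P. cnj (W q (i, x)) * W q (j, y)) - (if (i, x) = (j, y) then 1 else 0)) = T i j t"
          unfolding T_def unit_def W_def d_def[symmetric]
          by (intro ext) (auto simp: sum.cartesian_product split_def)
        moreover have "op_bound {..<d} {..<d} (T i j t) ?e"
          unfolding d_def using op_bound_mono[OF op_bound_norm_emb[OF n(1) _ t] norm_ge_zero nT[OF ij]] T[OF ij] by blast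
        ultimately show ?thesis by simp
      qed
      have 2: "op_bound ?P ?P (\<lambda>a b. (\<Sum>q\<in>?P. cnj (W q a) * W q b) - (if a = b then 1 else 0)) (real k * ?e)"
        by (rule op_bound_blocks[OF e0 1])
      have 3: "op_bound ?P ?P (\<lambda>a b. (\<Sum>q\<in>?P. W a q * cnj (W b q)) - (if a = b then 1 else 0)) (2 * (real k * ?e))"
        by (rule almost_isometry_almost_unitary[OF _ _ _ 2]) (use e0 \<delta> in auto)
      have "op_bound {..<d} {..<d} (\<lambda>x y. (\<Sum>q\<in>?P. W (i0, x) q * cnj (W (j0, y) q)) - (if (i0, x) = (j0, y) then 1 else 0)) (2 * (real k * ?e))"
        by (rule op_bound_block[OF 3 ij0])
      moreover have "(\<lambda>x y. (\<Sum>q\<in>?P. W (i0, x) q * cnj (W (j0, y) q)) - (if (i0, x) = (j0, y) then 1 else 0)) = S i0 j0 t"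
        unfolding S_def unit_def W_def d_def[symmetric]
        by (intro ext) (auto simp: sum.cartesian_product split_def)
      ultimately show ?thesis by simp
    qed
    have nS: "norm (emb n (S i0 j0)) \<le> 2 * (real k * ?e)"
      by (rule norm_emb_le[OF n(1) conjunct1[OF S[OF ij0]] _ obS[unfolded d_def]]) (use e0 in auto)
    have "(\<Sum>p<k. v i0 p * star (v j0 p)) - (if i0 = j0 then 1 else 0) =
      emb n (S i0 j0) + (\<Sum>p<k. v i0 p * star (v j0 p) - g i0 p * star (g j0 p))"
      using S[OF ij0] by (simp add: sum_subtractf)
    also have "norm \<dots> \<le> 2 * (real k * ?e) + (\<Sum>p<k. C * \<delta>)"
    proof (intro order_trans[OF norm_triangle_ineq] add_mono nS sum_norm_le)
      fix p assume "p \<in> {..<k}"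
      then show "norm (v i0 p * star (v j0 p) - g i0 p * star (g j0 p)) \<le> C * \<delta>"
        using M ng \<delta> ij0 by (intro prod) auto
    qed
    finally show ?thesis by (simp add: B_def algebra_simps)
  qed
  show "V * mat_star V = 1\<^sub>m k"
  proof (rule eq_matI)
    fix i j assume "i < dim_row (1\<^sub>m k :: 'a mat)" "j < dim_col (1\<^sub>m k :: 'a mat)"
    then have ij: "i < k" "j < k" by auto
    define E where "E = (\<Sum>p<k. v i p * star (v j p)) - (if i = j then 1 else 0)"
    define \<delta>0 where "\<delta>0 = min 1 (1 / (2 * (real k * (real k * C))))"
    have kC: "real k * (real k * C) > 0" using ij C by simp
    have \<delta>0: "\<delta>0 > 0" using kC by (simp add: \<delta>0_def)
    have "norm E \<le> 0 + \<eta>" if \<eta>: "\<eta> > 0" for \<eta>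
    proof -
      define \<delta> where "\<delta> = min \<delta>0 (\<eta> / (B + 1))"
      have \<delta>: "0 < \<delta>" "\<delta> \<le> 1" using \<delta>0 \<eta> B by (auto simp: \<delta>_def \<delta>0_def)
      have "\<delta> \<le> 1 / (2 * (real k * (real k * C)))" by (simp add: \<delta>_def \<delta>0_def)
      then have "real k * (real k * C * \<delta>) \<le> 1 / 2" using kC by (simp add: field_simps)
      from est[OF ij \<delta> this] have "norm E \<le> B * \<delta>" by (simp add: E_def)
      also have "\<dots> \<le> (B + 1) * (\<eta> / (B + 1))"
        using B \<delta> by (intro mult_mono) (auto simp: \<delta>_def)
      also have "\<dots> = \<eta>" using B by simp
      finally show ?thesis by simp
    qed
    then have "norm E \<le> 0" by (rule field_le_epsilon)
    then have "(\<Sum>p<k. v i p * star (v j p)) = (if i = j then 1 else 0)" by (simp add: E_def)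
    then show "(V * mat_star V) $$ (i, j) = 1\<^sub>m k $$ (i, j)" using ent(2)[OF ij] ij by simp
  qed (use V in \<open>auto simp: mat_star_def\<close>)
qed

section \<open>The tracial Rokhlin property\<close>

text \<open>A set \<open>S\<close> of whole blocks gives a projection which commutes exactly with block
  diagonal matrices. The estimate for \<open>e X\<close> is the adjoint of the one for \<open>X\<^sup>*
  e\<close>.\<close>

lemma rokhlin_projection_commutator:
  assumes n: "n \<ge> 1" and X: "cont_loop (4 ^ n) X" and w: "0 \<le> w"
    and mod: "\<And>s s' l l'. s \<in> {0..1} \<Longrightarrow> s' \<in> {0..1} \<Longrightarrow> \<bar>s - s'\<bar> \<le> 1 / 2 ^ Suc k \<Longrightarrow> l < 4 ^ n \<Longrightarrow> l' < 4 ^ n \<Longrightarrow>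
       cmod (X s l l' - X s' l l') \<le> w"
    and S: "S \<inter> hole = {}" "\<And>\<mu> l. with_column \<mu> l \<in> S \<longleftrightarrow> \<mu> \<in> S"
  shows "norm (coord_proj n k S * emb n X - emb n X * coord_proj n k S) \<le> 2 * (real (4 * 4 ^ n) * w)"
proof -
  let ?e = "coord_proj n k S" and ?Q = "rep n k (diag_fun not_hole)"
  have e1: "norm ?e \<le> 1" by (rule norm_projection_le[OF projection_coord_proj[OF n]])
  have Qe: "?Q * ?e = ?e"
  proof -
    have "?Q = coord_proj n k (- hole)" by (simp add: coord_proj_def not_hole_indicator)
    moreover have "- hole \<inter> S = S" using S(1) by auto
    ultimately show ?thesis by (simp add: coord_proj_Int[OF n])
  qed
  define Xs where "Xs = (\<lambda>t x y. cnj (X t y x))"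
  have Xs: "cont_loop (4 ^ n) Xs" "emb n Xs = star (emb n X)"
    unfolding Xs_def using cont_loop_algebra(4)[OF X X] emb_star[OF n X] by auto
  have half: "norm (emb n Y * ?e - rep n k (sample k Y) * ?e) \<le> real (4 * 4 ^ n) * w"
    if "cont_loop (4 ^ n) Y" "\<And>s s' l l'. s \<in> {0..1} \<Longrightarrow> s' \<in> {0..1} \<Longrightarrow> \<bar>s - s'\<bar> \<le> 1 / 2 ^ Suc k \<Longrightarrow> l < 4 ^ n \<Longrightarrow> l' < 4 ^ n \<Longrightarrow>
       cmod (Y s l l' - Y s' l l') \<le> w" for Y
  proof -
    have "emb n Y * ?e - rep n k (sample k Y) * ?e = (emb n Y * ?Q - rep n k (sample k Y)) * ?e"
      using Qe by (simp add: left_diff_distrib mult.assoc)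
    also have "norm \<dots> \<le> (real (4 * 4 ^ n) * w) * 1"
      using emb_close_to_sample[OF n that(1) w that(2)] e1 w
      by (intro order_trans[OF norm_mult_ineq] mult_mono) auto
    finally show ?thesis by simp
  qed
  have commute: "?e * rep n k (sample k X) = rep n k (sample k X) * ?e"
    unfolding coord_proj_def rep_diag_mult[OF n]
  proof (rule rep_cong)
    fix \<rho> \<mu>
    show "indicator S \<rho> * sample k X \<rho> \<mu> = sample k X \<rho> \<mu> * indicator S \<mu>"
      using S(2)[of \<mu> "column \<rho>"] by (auto simp: sample_def indicator_def)
  qed
  have sstar: "star (rep n k (sample k Xs)) = rep n k (sample k X)"
    unfolding rep_star[OF n, symmetric]
  proof (rule rep_cong)
    fix \<rho> \<mu>
    show "cnj (sample k Xs \<mu> \<rho>) = sample k X \<rho> \<mu>"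
      by (cases \<rho>; cases \<mu>) (auto simp: sample_def Xs_def with_column_def column_def position_def)
  qed
  have 1: "norm (emb n X * ?e - rep n k (sample k X) * ?e) \<le> real (4 * 4 ^ n) * w"
    by (rule half[OF X mod])
  have "norm (emb n Xs * ?e - rep n k (sample k Xs) * ?e) \<le> real (4 * 4 ^ n) * w"
  proof (rule half[OF Xs(1)])
    fix s s' :: real and l l' :: nat
    assume a: "s \<in> {0..1}" "s' \<in> {0..1}" "\<bar>s - s'\<bar> \<le> 1 / 2 ^ Suc k" "l < 4 ^ n" "l' < 4 ^ n"
    have "cmod (Xs s l l' - Xs s' l l') = cmod (X s l' l - X s' l' l)"
      by (simp add: Xs_def flip: complex_cnj_diff)
    then show "cmod (Xs s l l' - Xs s' l l') \<le> w" using mod[OF a(1-3) a(5,4)] by simp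
  qed
  then have 2: "norm (?e * emb n X - ?e * rep n k (sample k X)) \<le> real (4 * 4 ^ n) * w"
    using norm_star[of "emb n Xs * ?e - rep n k (sample k Xs) * ?e"]
    by (simp add: star_diff star_mult coord_proj_star[OF n] sstar Xs(2) star_star)
  have "?e * emb n X - emb n X * ?e = (?e * emb n X - ?e * rep n k (sample k X)) - (emb n X * ?e - rep n k (sample k X) * ?e)"
    using commute by simp
  also have "norm \<dots> \<le> real (4 * 4 ^ n) * w + real (4 * 4 ^ n) * w"
    by (intro order_trans[OF norm_triangle_ineq4] add_mono 1 2)
  finally show ?thesis by linarith
qed

text \<open>The Rokhlin projections are the spans of the sums and of the differences, without the holes. The
  \<open>i\<close>-th copy of the hole below \<open>e j\<close> uses the positions \<open>2 i + 1\<close> and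
  \<open>2 i + 2\<close>: two, because the hole has vectors for both values of \<open>s\<close> and \<open>e
  j\<close> only for one.\<close>

theorem tracial_rokhlin_alpha: "tracial_rokhlin 2 \<alpha>"
  unfolding tracial_rokhlin_def
proof (intro conjI limit_simple limit_stably_finite alpha_automorphism alpha_involution allI impI)
  fix F :: "'a set" and \<epsilon> :: real and N :: nat and x :: 'a
  assume "finite F \<and> 0 < \<epsilon> \<and> cpositive x \<and> x \<noteq> 0"
  then obtain b where F: "finite F" and \<epsilon>: "0 < \<epsilon>" and x: "x = star b * b" and "x \<noteq> 0"
    unfolding cpositive_def by blast
  then have b: "b \<noteq> 0" by auto
  have pos: "0 < min (\<epsilon> / 8) (norm b / 8)" using \<epsilon> b by simp
  obtain n where n: "n \<ge> 1"
    and ap: "\<And>a. a \<in> insert b F \<Longrightarrow> \<exists>X. cont_loop (4 ^ n) X \<and> norm (a - emb n X) < min (\<epsilon> / 8) (norm b / 8)"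
    using finite_approximation[OF finite.insertI[OF F, of b] pos] by metis
  obtain G where G: "cont_loop (4 ^ n) G" "norm (b - emb n G) < norm b / 8" using ap[of b] by auto
  obtain X where X: "\<And>a. a \<in> F \<Longrightarrow> cont_loop (4 ^ n) (X a)" "\<And>a. a \<in> F \<Longrightarrow> norm (a - emb n (X a)) < \<epsilon> / 8"
    using ap by (metis insert_iff min_less_iff_conj)
  define w where "w = \<epsilon> / (32 * 4 ^ n)"
  have w: "0 < w" "2 * (real (4 * 4 ^ n) * w) = \<epsilon> / 4" using \<epsilon> by (auto simp: w_def field_simps)
  have "eventually (\<lambda>k. \<forall>a\<in>F. \<forall>s\<in>{0..1}. \<forall>s'\<in>{0..1}. \<bar>s - s'\<bar> \<le> 1 / 2 ^ Suc k \<longrightarrow>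
     (\<forall>l<4 ^ n. \<forall>l'<4 ^ n. cmod (X a s l l' - X a s' l l') \<le> w)) sequentially"
    by (intro eventually_ball_finite[OF F] ballI eventually_modulus X(1) w(1))
  then have ev: "eventually (\<lambda>k. (\<forall>a\<in>F. \<forall>s\<in>{0..1}. \<forall>s'\<in>{0..1}. \<bar>s - s'\<bar> \<le> 1 / 2 ^ Suc k \<longrightarrow>
     (\<forall>l<4 ^ n. \<forall>l'<4 ^ n. cmod (X a s l l' - X a s' l l') \<le> w)) \<and>
     (\<exists>z. star z * (b * star b) * z = coord_proj n k hole \<and> z * coord_proj n k hole = z) \<and>
     2 * real N + 1 \<le> real (2 ^ Suc k)) sequentially"
    by (intro eventually_conj hole_projection_comparison[OF n b G] eventually_large_power)
  obtain k where k: "\<forall>a\<in>F. \<forall>s\<in>{0..1}. \<forall>s'\<in>{0..1}. \<bar>s - s'\<bar> \<le> 1 / 2 ^ Suc k \<longrightarrow>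
     (\<forall>l<4 ^ n. \<forall>l'<4 ^ n. cmod (X a s l l' - X a s' l l') \<le> w)"
    and z': "\<exists>z. star z * (b * star b) * z = coord_proj n k hole \<and> z * coord_proj n k hole = z"
    and K: "2 * real N + 1 \<le> real (2 ^ Suc k)"
    using eventually_happens[OF ev] trivial_limit_sequentially by blast
  obtain z where z: "star z * (b * star b) * z = coord_proj n k hole" "z * coord_proj n k hole = z" using z' by blast
  have mod: "cmod (X a s l l' - X a s' l l') \<le> w"
    if "a \<in> F" "s \<in> {0..1}" "s' \<in> {0..1}" "\<bar>s - s'\<bar> \<le> 1 / 2 ^ Suc k" "l < 4 ^ n" "l' < 4 ^ n" for a s s' l l'
    using k that by blast
  have "real (2 * N + 1) \<le> real (2 ^ Suc k)" using K by simp
  then have K: "2 * N + 1 \<le> 2 ^ Suc k" by (simp only: of_nat_le_iff)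
  define S where "S j = {\<mu>. position \<mu> \<noteq> 0 \<and> (index_sign \<mu> \<longleftrightarrow> j = 0)}" for j :: nat
  define e where "e j = coord_proj n k (S j)" for j
  have two: "j = 0 \<or> j = 1" if "j < 2" for j :: nat using that by auto
  have rest: "1 - (\<Sum>j<2. e j) = coord_proj n k hole"
  proof -
    have "S 0 \<union> S 1 = - hole" "S 0 \<inter> S 1 = {}" by (auto simp: S_def hole_def)
    then have "e 0 + e 1 = coord_proj n k (- hole)" unfolding e_def using coord_proj_Un[OF n, of "S 0" "S 1" k] by simp
    moreover have "coord_proj n k hole + coord_proj n k (- hole) = 1"
      using coord_proj_Un[OF n, of hole "- hole" k] coord_proj_UNIV[OF n, of k] by simp
    ultimately show ?thesis by (simp add: lessThan_nat_numeral eval_nat_numeral eq_diff_eq algebra_simps)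
  qed
  show "\<exists>e. (\<forall>j<2. projection (e j)) \<and> orthogonal_family 2 e \<and>
          (\<forall>j. j + 1 < 2 \<longrightarrow> norm (\<alpha> (e j) - e (j + 1)) < \<epsilon>) \<and>
          (\<forall>j<2. \<forall>a\<in>F. norm (e j * a - a * e j) < \<epsilon>) \<and>
          (\<exists>q\<in>hereditary_generated x. projection q \<and> mvn_equiv (1 - (\<Sum>j<2. e j)) q) \<and>
          (\<forall>j<2. \<exists>f. (\<forall>i<N. projection (f i) \<and> cle (f i) (e j) \<and> mvn_equiv (f i) (1 - (\<Sum>j<2. e j))) \<and>
                      orthogonal_family N f)"
  proof (rule exI[of _ e], intro conjI allI impI ballI)
    fix j :: nat assume "j < 2"
    show "projection (e j)" unfolding e_def by (rule projection_coord_proj[OF n])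
  next
    have "S i \<inter> S j = {}" if "i < 2" "j < 2" "i \<noteq> j" for i j
      using two[OF that(1)] two[OF that(2)] that(3) by (auto simp: S_def)
    then show "orthogonal_family 2 e"
      unfolding orthogonal_family_def e_def by (simp add: coord_proj_Int[OF n] coord_proj_empty[OF n])
  next
    fix j :: nat assume "j + 1 < 2"
    then have j: "j = 0" by simp
    have "\<alpha> (e 0) = rep n k (diag_fun (indicator (S 0) \<circ> flip_index))"
      unfolding e_def coord_proj_def by (rule alpha_rep_diag[OF n]) (simp add: S_def)
    also have "indicator (S 0) \<circ> flip_index = (indicator (S 1) :: frame_index \<Rightarrow> complex)"
      by (auto simp: fun_eq_iff S_def indicator_def flip_index_def position_def index_sign_def)
    finally show "norm (\<alpha> (e j) - e (j + 1)) < \<epsilon>" using \<epsilon> by (simp add: j e_def coord_proj_def)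
  next
    fix j :: nat and a assume j: "j < 2" and a: "a \<in> F"
    let ?g = "emb n (X a)"
    have e1: "norm (e j) \<le> 1" unfolding e_def by (rule norm_projection_le[OF projection_coord_proj[OF n]])
    have c: "norm (e j * ?g - ?g * e j) \<le> 2 * (real (4 * 4 ^ n) * w)"
      unfolding e_def
    proof (rule rokhlin_projection_commutator[OF n X(1)[OF a] _ mod[OF a]])
      show "S j \<inter> hole = {}" by (auto simp: S_def hole_def)
      show "with_column \<mu> l \<in> S j \<longleftrightarrow> \<mu> \<in> S j" for \<mu> l
        by (auto simp: S_def with_column_def position_def index_sign_def split: prod.splits)
    qed (use w in auto)
    have "e j * a - a * e j = e j * (a - ?g) - (a - ?g) * e j + (e j * ?g - ?g * e j)" by (simp add: algebra_simps)
    also have "norm \<dots> \<le> norm (e j * (a - ?g)) + norm ((a - ?g) * e j) + norm (e j * ?g - ?g * e j)"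
      by (intro order_trans[OF norm_triangle_ineq] add_mono norm_triangle_ineq4) auto
    also have "\<dots> \<le> 1 * (\<epsilon> / 8) + (\<epsilon> / 8) * 1 + \<epsilon> / 4"
      using e1 X(2)[OF a] c w(2) \<epsilon>
      by (intro add_mono order_trans[OF norm_mult_ineq] mult_mono) auto
    also have "\<dots> < \<epsilon>" using \<epsilon> by simp
    finally show "norm (e j * a - a * e j) < \<epsilon>" .
  next
    show "\<exists>q\<in>hereditary_generated x. projection q \<and> mvn_equiv (1 - (\<Sum>j<2. e j)) q"
      unfolding rest x by (rule mvn_equiv_in_hereditary_generated[OF z])
  next
    fix j :: nat assume j: "j < 2"
    define A where "A i = {\<mu>. (index_sign \<mu> \<longleftrightarrow> j = 0) \<and> (position \<mu> = 2 * i + 1 \<or> position \<mu> = 2 * i + 2)}" for i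
    show "\<exists>f. (\<forall>i<N. projection (f i) \<and> cle (f i) (e j) \<and> mvn_equiv (f i) (1 - (\<Sum>j<2. e j))) \<and> orthogonal_family N f"
    proof (rule exI[of _ "\<lambda>i. coord_proj n k (A i)"], intro conjI allI impI)
      fix i assume i: "i < N"
      show "projection (coord_proj n k (A i))" by (rule projection_coord_proj[OF n])
      show "cle (coord_proj n k (A i)) (e j)" unfolding e_def by (rule coord_proj_cle[OF n]) (auto simp: A_def S_def)
      have "2 * i + 2 < 2 ^ Suc k" using i K by simp
      then have "bij_betw (\<lambda>(\<kappa>, s, p, l). (\<kappa>, p = 2 * i + 2, 0, l)) (A i \<inter> frame_indices n k) (hole \<inter> frame_indices n k)"
        by (intro bij_betw_byWitness[where f' = "\<lambda>(\<kappa>, s, p, l). (\<kappa>, j = 0, if s then 2 * i + 2 else 2 * i + 1, l)"])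
           (auto simp: A_def hole_def position_def index_sign_def frame_indices_def split: if_splits)
      then show "mvn_equiv (coord_proj n k (A i)) (1 - (\<Sum>j<2. e j))" unfolding rest by (rule coord_proj_mvn[OF n])
    next
      have "A i \<inter> A i' = {}" if "i \<noteq> i'" for i i' using that by (auto simp: A_def)
      then show "orthogonal_family N (\<lambda>i. coord_proj n k (A i))"
        unfolding orthogonal_family_def by (simp add: coord_proj_Int[OF n] coord_proj_empty[OF n])
    qed
  qed
qed simp

end

theorem proposition12p14:
  fixes c :: "real \<Rightarrow> complex mat"
    and \<iota> :: "nat \<Rightarrow> (real \<Rightarrow> complex mat) \<Rightarrow> 'a::unital_cstar_algebra"
    and \<alpha> :: "'a \<Rightarrow> 'a"
  assumes "swap_path c"
    and "inductive_limit blackadar_algebra (blackadar_map c) \<iota>"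
    and "blackadar_automorphism \<iota> \<alpha>"
  shows "tracial_rokhlin 2 \<alpha>"
proof -
  interpret blackadar_limit c \<iota> \<alpha>
    by unfold_locales (fact assms)+
  show ?thesis by (rule tracial_rokhlin_alpha)
qed

end
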